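(* Let $A\in\mathbb{R}^{n\times n}$, $B\in\mathbb{R}^{n\times m}$, let $U\subset\mathbb{R}^m$ be a compact convex neighborhood of $0$, and consider the control system induced on the Poincaré sphere $\mathbb{S}^n$ by $\dot x=Ax+Bu$, $u\in\mathcal{U}$, with associated control flow $\pi\Phi^1$ on $\mathcal{U}\times\mathbb{S}^n$. Let $\lambda_{i_0}\ne0$ be a Lyapunov exponent of $A$, and consider the compact set ${}_{\mathbb{S}}L(\lambda_{i_0})^\infty\subset\mathbb{S}^{n,0}$ and the stable subbundle ${}_{\mathbb{S}}\mathcal{V}^-$ in the decomposition $\mathcal{U}\times T_{{}_{\mathbb{S}}L(\lambda_{i_0})^\infty}\mathbb{S}^n={}_{\mathbb{S}}\mathcal{V}^-\oplus{}_{\mathbb{S}}\mathcal{V}^+$. Then there are $\delta>0$ and a map $$S^-:\{(u,s,v,v_{n+1})\in{}_{\mathbb{S}}\mathcal{V}^-\mid\|(v,v_{n+1})\|<\delta\}\to\mathcal{U}\times{}_{\mathbb{S}}L(\lambda_{i_0})^\infty\times\mathbb{S}^n,$$ which is a bundle isomorphism onto its image $\mathcal{W}^-_{loc}:=\operatorname{im}S^-$, with the following properties. (i) Every $(u,s_0,s)\in\mathcal{W}^-_{loc}$ satisfies $$\lim_{t\to\infty}e^{-\alpha t}d(\pi\varphi^1(t,s,u),\pi\varphi^1(t,s_0,u))=0\quad\text{for every }\alpha\in(\kappa({}_{\mathbb{S}}\mathcal{V}^-),0),$$ where $d$ is the Riemannian distance on $\mathbb{S}^n$. (The set $\mathcal{W}^-_{loc}\subset\mathcal{U}\times{}_{\mathbb{S}}L(\lambda_{i_0})^\infty\times\mathbb{S}^n$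 is called a local stable manifold corresponding to the stable subbundle ${}_{\mathbb{S}}\mathcal{V}^-$.) (ii) For every $(u,s_0)\in\mathcal{U}\times{}_{\mathbb{S}}L(\lambda_{i_0})^\infty$ the local stable manifold for $(u,s_0)$ defined by $\mathcal{W}^-_{loc}(u,s_0):=\{s\in\mathbb{S}^n\mid(u,s_0,s)\in\mathcal{W}^-_{loc}\}\subset\mathbb{S}^n$ has topological dimension equal to the dimension of ${}_{\mathbb{S}}\mathcal{V}^-$. (iii) $\mathcal{W}^-_{loc}$ is positively invariant under $\pi\Phi^1$, i.e., for $s\in\mathcal{W}^-_{loc}(u,s_0)$ it holds that $\pi\varphi^1(t,s,u)\in\mathcal{W}^-_{loc}(u(t+\cdot),\pi\varphi^1(t,s_0,0))$ for all $t\ge0$. (iv) The distance of $\mathcal{W}^-_{loc}$ to ${}_{\mathbb{S}}\mathcal{V}^-$ can be made arbitrarily small by choosing $\delta>0$ small: for all $h>0$ there is $\delta>0$ such that $\mathcal{W}^-_{loc}$ is contained in the set of angle $h$ around ${}_{\mathbb{S}}\mathcal{V}^-$ given by $$C({}_{\mathbb{S}}\mathcal{V}^-,h)=\left\{(u,s,\exp(s,v^++v^-))\in\mathcal{U}\times{}_{\mathbb{S}}L(\lambda_{i_0})^\infty\times\mathbb{S}^n\mid(u,s,v^\pm)\in{}_{\mathbb{S}}\mathcal{V}^\pm,\ \|v^+\|\le h\|v^-\|\right\}.$$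
   Context: $\mathcal{U}=\{u\in L^\infty(\mathbb{R},\mathbb{R}^m)\mid u(t)\in U\text{ for a.a. }t\}$ with the weak$^*$ topology (compact metrizable). The Lyapunov exponents of $A$ are the distinct real parts $\lambda_1>\dots>\lambda_\ell$ of its eigenvalues; $L(\lambda_i)$ is the sum of the real generalized eigenspaces for eigenvalues with real part $\lambda_i$; $L(\lambda_i)^\infty=L(\lambda_i)\times\{0\}\subset\mathbb{R}^{n+1}$. $L^0=L(0)$ if $0$ is a Lyapunov exponent, $L^0=\{0\}$ otherwise; $L^\pm=\bigoplus_{\pm\lambda_i>0}L(\lambda_i)$; $\pi^h:\mathbb{R}^n\to L^+\oplus L^-$ is the projection along $L^0$. For $u\in\mathcal{U}$, $e(u,\cdot)$ is the unique bounded solution on $\mathbb{R}$ in $L^+\oplus L^-$ of $\dot y=A\pi^hy+\pi^hBu(t)$. Put $\mathcal{V}_c=\{(u,-re(u,0)+y,r)\mid u\in\mathcal{U},y\in L^0,r\in\mathbb{R}\}\subset\mathcal{U}\times\mathbb{R}^{n+1}$. $\mathbb{R}^n$ carries a scalar product making the Lyapunov spaces pairwise orthogonal, $\mathbb{R}^{n+1}$ carries $\langle(x,x_{n+1}),(y,y_{n+1})\rangle=\langle x,y\rangle+x_{n+1}y_{n+1}$; $\mathbb{S}^n\subset\mathbb{R}^{n+1}$ is the unit sphere with induced Riemannian metric, $T_s\mathbb{S}^n=\{v\mid\langle v,s\rangle=0\}$, $\mathbb{S}^{n,0}=\{(x,0)\in\mathbb{S}^n\}$. $\pi(y)=y/\|y\|$,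 and for $s\in\mathbb{S}^n$, $T_s\pi(v)=v-\langle v,s\rangle s$. For the sphere the paper uses $\exp(s,v)=(s+v)/\|s+v\|$ for $s\in\mathbb{S}^n,v\in T_s\mathbb{S}^n$. $\varphi^1(t,x,r,u)=\big(e^{At}x+r\int_0^te^{A(t-\sigma)}Bu(\sigma)d\sigma,r\big)$ is the solution of the lifted system $\dot x=Ax+x_{n+1}Bu,\ \dot x_{n+1}=0$. The induced system on $\mathbb{S}^n$ has trajectories $\pi\varphi^1(t,s,u)=\varphi^1(t,s,u)/\|\varphi^1(t,s,u)\|$ and control flow $\pi\Phi^1_t(u,s)=(u(t+\cdot),\pi\varphi^1(t,s,u))$. For $s\in\mathbb{S}^{n,0}$ one has $\pi\varphi^1(t,s,u)=\pi\varphi^1(t,s,0)$. ${}_{\mathbb{S}}L(\lambda_{i_0})^\infty$ is one (arbitrarily chosen) of the one or two maximal chain transitive sets contained in $L(\lambda_{i_0})^\infty\cap\mathbb{S}^n$ of the flow induced by $e^{At}$ on $\mathbb{S}^{n,0}$. $T_{{}_{\mathbb{S}}L(\lambda_{i_0})^\infty}\mathbb{S}^n=\bigcup_{s\in{}_{\mathbb{S}}L(\lambda_{i_0})^\infty}T_s\mathbb{S}^n$. Subbundles of $\mathcal{U}\times T_{{}_{\mathbb{S}}L(\lambda_{i_0})^\infty}\mathbb{S}^n$: ${}_{\mathbb{S}}\mathcal{V}_c=\{(u,s,T_s\pi(w,r))\mid s\in{}_{\mathbb{S}}L(\lambda_{i_0})^\infty,(u,w,r)\in\mathcal{V}_c\}$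 and, for $\lambda_i\neq0$, ${}_{\mathbb{S}}\mathcal{V}_i=\{(u,s,T_s\pi(v,0))\mid u\in\mathcal{U},s\in{}_{\mathbb{S}}L(\lambda_{i_0})^\infty,v\in L(\lambda_i)\}$ (trivial for $i=i_0$ if $\dim L(\lambda_{i_0})=1$). The stable subbundle is ${}_{\mathbb{S}}\mathcal{V}^-=\bigoplus_{i>i_0,\lambda_i\ne0}{}_{\mathbb{S}}\mathcal{V}_i\oplus{}_{\mathbb{S}}\mathcal{V}_c$ if $\lambda_{i_0}>0$, and ${}_{\mathbb{S}}\mathcal{V}^-=\bigoplus_{i>i_0}{}_{\mathbb{S}}\mathcal{V}_i$ if $\lambda_{i_0}<0$. In this result ${}_{\mathbb{S}}\mathcal{V}^+$ denotes the sum of all remaining subbundles among ${}_{\mathbb{S}}\mathcal{V}_c$, ${}_{\mathbb{S}}\mathcal{V}_i$ ($\lambda_i\ne0$), including the center bundle ${}_{\mathbb{S}}\mathcal{V}_{i_0}$. $\kappa({}_{\mathbb{S}}\mathcal{V}^-)$ is the supremum, over all $(u,s,v)\in{}_{\mathbb{S}}\mathcal{V}^-$ with $v\ne0$, of the Lyapunov exponents $\limsup_{t\to\infty}\frac1t\log\|D_s\pi\varphi^1(t,s,u)v\|$, with $D_s$ the derivative with respect to $s$. Bundles: a bundle is a continuous map $p:E\to B$ of metric spaces; a bundle morphism from $p:E\to B$ to $p':E'\to B'$ is a pair of continuous maps $g:E\to E'$, $h:B\to B'$ with $p'\circ g=h\circ p$; it is an isomorphism if it has an inverse bundle morphism. Here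 both sides are bundles over $\mathcal{U}\times{}_{\mathbb{S}}L(\lambda_{i_0})^\infty$. In (iv), $\mathcal{W}^-_{loc}$ is the local stable manifold belonging to the $\delta$ chosen there.
   Formalization: V_c is taken with +r e(u,0) instead of the printed −r e(u,0): with the minus sign V_c is not invariant under the lifted flow, and for A=diag(2,1), B=(1,0)^T, U=[-1,1], exponent 1 and u=1, properties (ii)–(iv) cannot hold together. *)

theory Defs
  imports "HOL-Analysis.Analysis"
begin

section \<open>Controls\<close>

text \<open>\<open>L\<^sup>\<infinity>(\<real>, \<real>\<^sup>m)\<close> as equivalence classes modulo equality almost everywhere.  Every
  class of Lebesgue measurable functions contains a Borel measurable one, so Borel
  representatives suffice.\<close>

definition ess_bounded :: "(real \<Rightarrow> 'b::euclidean_space) \<Rightarrow> bool" where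
  "ess_bounded f \<longleftrightarrow> f \<in> borel_measurable lborel \<and> (\<exists>c. AE t in lborel. norm (f t) \<le> c)"

definition linf_rel :: "(real \<Rightarrow> 'b::euclidean_space) \<Rightarrow> (real \<Rightarrow> 'b) \<Rightarrow> bool" where
  "linf_rel f g \<longleftrightarrow> ess_bounded f \<and> ess_bounded g \<and> (AE t in lborel. f t = g t)"

quotient_type (overloaded) 'b linf = "real \<Rightarrow> 'b::euclidean_space" / partial: linf_rel
proof (rule part_equivpI)
  have "linf_rel (\<lambda>_. 0 :: 'b) (\<lambda>_. 0)"
    by (auto simp: linf_rel_def ess_bounded_def intro!: exI[of _ 0])
  then show "\<exists>f :: real \<Rightarrow> 'b. linf_rel f f" by blast
  show "symp (linf_rel :: (real \<Rightarrow> 'b) \<Rightarrow> _)"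
    by (auto simp: symp_def linf_rel_def)
  show "transp (linf_rel :: (real \<Rightarrow> 'b) \<Rightarrow> _)"
    by (auto simp: transp_def linf_rel_def)
qed

definition linf_zero :: "'b::euclidean_space linf" where
  "linf_zero = abs_linf (\<lambda>_. 0)"

definition shift :: "real \<Rightarrow> 'b::euclidean_space linf \<Rightarrow> 'b linf" where
  "shift t u = abs_linf (\<lambda>\<tau>. rep_linf u (t + \<tau>))"

definition weak_star :: "'b::euclidean_space linf topology" where
  "weak_star = topology_generated_by
     {{u. (LINT t|lborel. g t \<bullet> rep_linf u t) \<in> W} | g W. integrable lborel g \<and> open W}"

definition controls :: "'b::euclidean_space set \<Rightarrow> 'b linf set" where
  "controls U = {u. AE t in lborel. rep_linf u t \<in> U}"


section \<open>Lyapunov spaces\<close>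

definition complexify :: "real^'n^'n \<Rightarrow> complex^'n^'n" where
  "complexify A = (\<chi> i j. complex_of_real (A $ i $ j))"

definition eigenvalues :: "real^'n^'n \<Rightarrow> complex set" where
  "eigenvalues A = {\<mu>. \<exists>z. z \<noteq> 0 \<and> complexify A *v z = \<mu> *s z}"

text \<open>The real parts of the vectors in the complex generalized eigenspace of \<open>\<mu>\<close>; as that
  space is closed under multiplication by \<open>\<i>\<close>, the imaginary parts are covered too.\<close>

definition real_gen_eigenspace :: "real^'n^'n \<Rightarrow> complex \<Rightarrow> (real^'n) set" where
  "real_gen_eigenspace A \<mu> =
     {(\<chi> i. Re (z $ i)) | z. \<exists>k. ((\<lambda>w. complexify A *v w - \<mu> *s w) ^^ k) z = 0}"

definition lyapunov_exponents :: "real^'n^'n \<Rightarrow> real set" where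
  "lyapunov_exponents A = Re ` eigenvalues A"

definition lyapunov_space :: "real^'n^'n \<Rightarrow> real \<Rightarrow> (real^'n) set" where
  "lyapunov_space A l = span (\<Union>\<mu>\<in>{\<mu> \<in> eigenvalues A. Re \<mu> = l}. real_gen_eigenspace A \<mu>)"

text \<open>This is \<open>{0}\<close> if \<open>0\<close> is not a Lyapunov exponent, since the span is then that of the
  empty set.\<close>

definition L_zero :: "real^'n^'n \<Rightarrow> (real^'n) set" where
  "L_zero A = lyapunov_space A 0"

definition L_plus :: "real^'n^'n \<Rightarrow> (real^'n) set" where
  "L_plus A = span (\<Union>l\<in>{l \<in> lyapunov_exponents A. l > 0}. lyapunov_space A l)"

definition L_minus :: "real^'n^'n \<Rightarrow> (real^'n) set" where
  "L_minus A = span (\<Union>l\<in>{l \<in> lyapunov_exponents A. l < 0}. lyapunov_space A l)"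

definition L_hyp :: "real^'n^'n \<Rightarrow> (real^'n) set" where
  "L_hyp A = {x + y | x y. x \<in> L_plus A \<and> y \<in> L_minus A}"

definition proj_hyp :: "real^'n^'n \<Rightarrow> real^'n \<Rightarrow> real^'n" where
  "proj_hyp A x = (THE y. y \<in> L_hyp A \<and> x - y \<in> L_zero A)"


section \<open>The lifted system on \<open>\<real>\<^sup>n\<^sup>+\<^sup>1\<close>\<close>

type_synonym 'n lifted = "(real^'n) \<times> real"

definition mat_exp :: "real^'n^'n \<Rightarrow> real^'n^'n" where
  "mat_exp A = (\<Sum>k. (1 / fact k) *\<^sub>R (((**) A ^^ k) (mat 1)))"

definition phi1 :: "real^'n^'n \<Rightarrow> real^'m^'n \<Rightarrow> real \<Rightarrow> 'n lifted \<Rightarrow> (real^'m) linf \<Rightarrow> 'n lifted" where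
  "phi1 A B t p u =
     (mat_exp (t *\<^sub>R A) *v fst p
        + snd p *\<^sub>R (LBINT \<sigma>=0..ereal t. mat_exp ((t - \<sigma>) *\<^sub>R A) *v (B *v rep_linf u \<sigma>)),
      snd p)"

text \<open>Solutions are understood in the sense of Caratheodory, i.e. through the integral equation.\<close>

definition bounded_hyp_solution ::
  "real^'n^'n \<Rightarrow> real^'m^'n \<Rightarrow> (real^'m) linf \<Rightarrow> (real \<Rightarrow> real^'n) \<Rightarrow> bool" where
  "bounded_hyp_solution A B u y \<longleftrightarrow>
     continuous_on UNIV y \<and> bounded (range y) \<and> range y \<subseteq> L_hyp A \<and>
     (\<forall>t. y t = y 0 + (LBINT \<sigma>=0..ereal t. A *v proj_hyp A (y \<sigma>) + proj_hyp A (B *v rep_linf u \<sigma>)))"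

definition e_sol :: "real^'n^'n \<Rightarrow> real^'m^'n \<Rightarrow> (real^'m) linf \<Rightarrow> real \<Rightarrow> real^'n" where
  "e_sol A B u = (THE y. bounded_hyp_solution A B u y)"

text \<open>The term is \<open>+r e(u,0)\<close>, not \<open>-r e(u,0)\<close> as in some presentations: the set has to be
  invariant under the lifted flow, and \<open>t \<mapsto> (r e(u,t), r)\<close> solves the lifted system modulo
  \<open>L\<^sup>0\<close>, whereas the solution through \<open>(-r e(u,0), r)\<close> has hyperbolic component
  \<open>r e(u,t) - 2 r exp(A t) e(u,0)\<close>.  With the minus sign the stable subbundle is not invariant,
  and for \<open>A = diag(2, 1)\<close>, \<open>B = (1, 0)\<^sup>T\<close>, \<open>U = [-1, 1]\<close>, exponent \<open>1\<close> and the constant control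
  \<open>u = 1\<close> no positively invariant local stable manifold stays close to it.\<close>

definition V_c :: "real^'n^'n \<Rightarrow> real^'m^'n \<Rightarrow> (real^'m) set \<Rightarrow> ((real^'m) linf \<times> 'n lifted) set" where
  "V_c A B U = {(u, (r *\<^sub>R e_sol A B u 0 + y, r)) | u y r. u \<in> controls U \<and> y \<in> L_zero A}"


section \<open>The Poincare sphere\<close>

text \<open>The scalar product \<open>ip\<close> on \<open>\<real>\<^sup>n\<close> is in general not the standard one, so the norm,
  the sphere and the projections below all take it as a parameter.\<close>

definition is_scalar_product :: "(real^'n \<Rightarrow> real^'n \<Rightarrow> real) \<Rightarrow> bool" where
  "is_scalar_product ip \<longleftrightarrow> bilinear ip \<and> (\<forall>x y. ip x y = ip y x) \<and> (\<forall>x. x \<noteq> 0 \<longrightarrow> ip x x > 0)"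

definition ip_lift :: "(real^'n \<Rightarrow> real^'n \<Rightarrow> real) \<Rightarrow> 'n lifted \<Rightarrow> 'n lifted \<Rightarrow> real" where
  "ip_lift ip p q = ip (fst p) (fst q) + snd p * snd q"

definition nrm :: "(real^'n \<Rightarrow> real^'n \<Rightarrow> real) \<Rightarrow> 'n lifted \<Rightarrow> real" where
  "nrm ip p = sqrt (ip_lift ip p p)"

definition psphere :: "(real^'n \<Rightarrow> real^'n \<Rightarrow> real) \<Rightarrow> 'n lifted set" where
  "psphere ip = {p. nrm ip p = 1}"

definition psphere0 :: "(real^'n \<Rightarrow> real^'n \<Rightarrow> real) \<Rightarrow> 'n lifted set" where
  "psphere0 ip = {p \<in> psphere ip. snd p = 0}"

definition sproj :: "(real^'n \<Rightarrow> real^'n \<Rightarrow> real) \<Rightarrow> 'n lifted \<Rightarrow> 'n lifted" where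
  "sproj ip p = p /\<^sub>R nrm ip p"

definition tproj :: "(real^'n \<Rightarrow> real^'n \<Rightarrow> real) \<Rightarrow> 'n lifted \<Rightarrow> 'n lifted \<Rightarrow> 'n lifted" where
  "tproj ip s v = v - ip_lift ip v s *\<^sub>R s"

definition sexp :: "(real^'n \<Rightarrow> real^'n \<Rightarrow> real) \<Rightarrow> 'n lifted \<Rightarrow> 'n lifted \<Rightarrow> 'n lifted" where
  "sexp ip s v = (s + v) /\<^sub>R nrm ip (s + v)"

text \<open>The Riemannian distance: infimum of the lengths of piecewise \<open>C\<^sup>1\<close> curves in the sphere.
  The library notion of piecewise \<open>C\<^sup>1\<close> admits unbounded derivatives near the finitely many
  exceptional points; integrability of the speed excludes curves of infinite length, for which
  the integral would be \<open>0\<close> by convention.\<close>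

definition riem_dist :: "(real^'n \<Rightarrow> real^'n \<Rightarrow> real) \<Rightarrow> 'n lifted \<Rightarrow> 'n lifted \<Rightarrow> real" where
  "riem_dist ip p q =
     Inf {integral {0..1} (\<lambda>t. nrm ip (vector_derivative c (at t))) | c.
            c piecewise_C1_differentiable_on {0..1} \<and> c ` {0..1} \<subseteq> psphere ip \<and>
            c 0 = p \<and> c 1 = q \<and>
            (\<lambda>t. nrm ip (vector_derivative c (at t))) integrable_on {0..1}}"

definition sphi :: "(real^'n \<Rightarrow> real^'n \<Rightarrow> real) \<Rightarrow> real^'n^'n \<Rightarrow> real^'m^'n \<Rightarrow>
    real \<Rightarrow> 'n lifted \<Rightarrow> (real^'m) linf \<Rightarrow> 'n lifted" where
  "sphi ip A B t s u = sproj ip (phi1 A B t s u)"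

text \<open>The differential of the sphere map in a tangent direction is that of its extension to
  \<open>\<real>\<^sup>n\<^sup>+\<^sup>1 - {0}\<close>, to which the same formula applies.\<close>

definition D_sphi :: "(real^'n \<Rightarrow> real^'n \<Rightarrow> real) \<Rightarrow> real^'n^'n \<Rightarrow> real^'m^'n \<Rightarrow>
    real \<Rightarrow> 'n lifted \<Rightarrow> (real^'m) linf \<Rightarrow> 'n lifted \<Rightarrow> 'n lifted" where
  "D_sphi ip A B t s u = frechet_derivative (\<lambda>p. sphi ip A B t p u) (at s)"


section \<open>Chain transitivity\<close>

definition has_chain :: "'a set \<Rightarrow> ('a \<Rightarrow> 'a \<Rightarrow> real) \<Rightarrow> (real \<Rightarrow> 'a \<Rightarrow> 'a) \<Rightarrow>
    real \<Rightarrow> real \<Rightarrow> 'a \<Rightarrow> 'a \<Rightarrow> bool" where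
  "has_chain X d \<psi> \<epsilon> T x y \<longleftrightarrow>
     (\<exists>k::nat. \<exists>xs ts. k \<ge> 1 \<and> xs 0 = x \<and> xs k = y \<and> (\<forall>i\<le>k. xs i \<in> X) \<and>
        (\<forall>i<k. ts i \<ge> T \<and> d (\<psi> (ts i) (xs i)) (xs (Suc i)) < \<epsilon>))"

definition chain_transitive :: "'a set \<Rightarrow> ('a \<Rightarrow> 'a \<Rightarrow> real) \<Rightarrow> (real \<Rightarrow> 'a \<Rightarrow> 'a) \<Rightarrow>
    'a set \<Rightarrow> bool" where
  "chain_transitive X d \<psi> M \<longleftrightarrow>
     M \<noteq> {} \<and> M \<subseteq> X \<and> (\<forall>x\<in>M. \<forall>y\<in>M. \<forall>\<epsilon>>0. \<forall>T>0. has_chain X d \<psi> \<epsilon> T x y)"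

definition maximal_chain_transitive :: "'a set \<Rightarrow> ('a \<Rightarrow> 'a \<Rightarrow> real) \<Rightarrow> (real \<Rightarrow> 'a \<Rightarrow> 'a) \<Rightarrow>
    'a set \<Rightarrow> bool" where
  "maximal_chain_transitive X d \<psi> M \<longleftrightarrow>
     chain_transitive X d \<psi> M \<and> (\<forall>N. chain_transitive X d \<psi> N \<and> M \<subseteq> N \<longrightarrow> N = M)"

definition sflow0 :: "(real^'n \<Rightarrow> real^'n \<Rightarrow> real) \<Rightarrow> real^'n^'n \<Rightarrow> real \<Rightarrow> 'n lifted \<Rightarrow> 'n lifted" where
  "sflow0 ip A t s = sproj ip (mat_exp (t *\<^sub>R A) *v fst s, 0)"

definition L_inf :: "real^'n^'n \<Rightarrow> real \<Rightarrow> 'n lifted set" where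
  "L_inf A l = lyapunov_space A l \<times> {0}"

definition is_SL :: "(real^'n \<Rightarrow> real^'n \<Rightarrow> real) \<Rightarrow> real^'n^'n \<Rightarrow> real \<Rightarrow> 'n lifted set \<Rightarrow> bool" where
  "is_SL ip A l M \<longleftrightarrow>
     maximal_chain_transitive (psphere0 ip) (riem_dist ip) (sflow0 ip A) M \<and>
     M \<subseteq> L_inf A l \<inter> psphere ip"


section \<open>Subbundles\<close>

type_synonym ('n, 'm) sbundle = "((real^'m) linf \<times> 'n lifted \<times> 'n lifted) set"

definition fibre :: "('n::finite, 'm::finite) sbundle \<Rightarrow> (real^'m) linf \<Rightarrow> 'n lifted \<Rightarrow> 'n lifted set" where
  "fibre E u s = {v. (u, s, v) \<in> E}"

text \<open>The fibrewise sum of a family of subbundles over the base \<open>controls U \<times> M\<close>; the sum of the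
  empty family is the zero bundle.\<close>

definition bundle_sum :: "(real^'m) set \<Rightarrow> 'n::finite lifted set \<Rightarrow> ('n, 'm) sbundle set \<Rightarrow> ('n, 'm) sbundle" where
  "bundle_sum U M F = {(u, s, v). u \<in> controls U \<and> s \<in> M \<and> v \<in> span (\<Union>E\<in>F. fibre E u s)}"

definition SV_c :: "(real^'n \<Rightarrow> real^'n \<Rightarrow> real) \<Rightarrow> real^'n^'n \<Rightarrow> real^'m^'n \<Rightarrow> (real^'m) set \<Rightarrow>
    'n lifted set \<Rightarrow> ('n, 'm) sbundle" where
  "SV_c ip A B U M = {(u, s, tproj ip s p) | u s p. s \<in> M \<and> (u, p) \<in> V_c A B U}"

definition SV :: "(real^'n \<Rightarrow> real^'n \<Rightarrow> real) \<Rightarrow> real^'n^'n \<Rightarrow> (real^'m) set \<Rightarrow>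
    'n lifted set \<Rightarrow> real \<Rightarrow> ('n, 'm) sbundle" where
  "SV ip A U M l =
     {(u, s, tproj ip s (v, 0)) | u s v. u \<in> controls U \<and> s \<in> M \<and> v \<in> lyapunov_space A l}"

text \<open>As the exponents are numbered in decreasing order, \<open>i > i\<^sub>0\<close> means that the \<open>i\<close>-th
  exponent is smaller than the exponent \<open>l\<close> with number \<open>i\<^sub>0\<close>.\<close>

definition SV_minus :: "(real^'n \<Rightarrow> real^'n \<Rightarrow> real) \<Rightarrow> real^'n^'n \<Rightarrow> real^'m^'n \<Rightarrow> (real^'m) set \<Rightarrow>
    real \<Rightarrow> 'n lifted set \<Rightarrow> ('n, 'm) sbundle" where
  "SV_minus ip A B U l M = bundle_sum U M
     ((if l > 0 then {SV_c ip A B U M} else {})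
        \<union> SV ip A U M ` {k \<in> lyapunov_exponents A. k < l \<and> k \<noteq> 0})"

definition SV_plus :: "(real^'n \<Rightarrow> real^'n \<Rightarrow> real) \<Rightarrow> real^'n^'n \<Rightarrow> real^'m^'n \<Rightarrow> (real^'m) set \<Rightarrow>
    real \<Rightarrow> 'n lifted set \<Rightarrow> ('n, 'm) sbundle" where
  "SV_plus ip A B U l M = bundle_sum U M
     ((if l > 0 then {} else {SV_c ip A B U M})
        \<union> SV ip A U M ` {k \<in> lyapunov_exponents A. k \<ge> l \<and> k \<noteq> 0})"

text \<open>Extended real valued: for the zero bundle the supremum is \<open>-\<infinity>\<close>.\<close>

definition kappa :: "(real^'n \<Rightarrow> real^'n \<Rightarrow> real) \<Rightarrow> real^'n^'n \<Rightarrow> real^'m^'n \<Rightarrow>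
    ('n, 'm) sbundle \<Rightarrow> ereal" where
  "kappa ip A B E =
     Sup {Limsup at_top (\<lambda>t. ereal (1 / t * ln (nrm ip (D_sphi ip A B t s u v)))) | u s v.
            (u, s, v) \<in> E \<and> v \<noteq> 0}"

definition angle_cone :: "(real^'n \<Rightarrow> real^'n \<Rightarrow> real) \<Rightarrow> ('n, 'm) sbundle \<Rightarrow> ('n, 'm) sbundle \<Rightarrow>
    real \<Rightarrow> ('n, 'm) sbundle" where
  "angle_cone ip Em Ep h =
     {(u, s, sexp ip s (vp + vm)) | u s vp vm.
        (u, s, vp) \<in> Ep \<and> (u, s, vm) \<in> Em \<and> nrm ip vp \<le> h * nrm ip vm}"


section \<open>Bundle isomorphisms\<close>

text \<open>A bundle is given by topologies on its total space and base together with a projection.\<close>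

definition bundle_morphism :: "'e topology \<Rightarrow> 'b topology \<Rightarrow> ('e \<Rightarrow> 'b) \<Rightarrow>
    'f topology \<Rightarrow> 'c topology \<Rightarrow> ('f \<Rightarrow> 'c) \<Rightarrow> ('e \<Rightarrow> 'f) \<Rightarrow> ('b \<Rightarrow> 'c) \<Rightarrow> bool" where
  "bundle_morphism E B p E' B' p' g h \<longleftrightarrow>
     continuous_map E B p \<and> continuous_map E' B' p' \<and>
     continuous_map E E' g \<and> continuous_map B B' h \<and> (\<forall>x\<in>topspace E. p' (g x) = h (p x))"

definition bundle_isomorphism :: "'e topology \<Rightarrow> 'b topology \<Rightarrow> ('e \<Rightarrow> 'b) \<Rightarrow>
    'f topology \<Rightarrow> 'c topology \<Rightarrow> ('f \<Rightarrow> 'c) \<Rightarrow> ('e \<Rightarrow> 'f) \<Rightarrow> ('b \<Rightarrow> 'c) \<Rightarrow> bool" where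
  "bundle_isomorphism E B p E' B' p' g h \<longleftrightarrow>
     bundle_morphism E B p E' B' p' g h \<and>
     (\<exists>g' h'. bundle_morphism E' B' p' E B p g' h' \<and>
        (\<forall>x\<in>topspace E. g' (g x) = x) \<and> (\<forall>y\<in>topspace E'. g (g' y) = y) \<and>
        (\<forall>b\<in>topspace B. h' (h b) = b) \<and> (\<forall>c\<in>topspace B'. h (h' c) = c))"

definition base_top :: "(real^'m) set \<Rightarrow> 'n::finite lifted set \<Rightarrow> ((real^'m) linf \<times> 'n lifted) topology" where
  "base_top U M = subtopology (prod_topology weak_star euclidean) (controls U \<times> M)"

definition total_top :: "('n::finite, 'm::finite) sbundle \<Rightarrow> ((real^'m) linf \<times> 'n lifted \<times> 'n lifted) topology" where
  "total_top E = subtopology (prod_topology weak_star (prod_topology euclidean euclidean)) E"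

definition base_proj :: "'u \<times> 's \<times> 'v \<Rightarrow> 'u \<times> 's" where
  "base_proj = (\<lambda>(u, s, v). (u, s))"

definition ball_bundle :: "(real^'n \<Rightarrow> real^'n \<Rightarrow> real) \<Rightarrow> ('n, 'm) sbundle \<Rightarrow> real \<Rightarrow> ('n, 'm) sbundle" where
  "ball_bundle ip E \<delta> = {(u, s, v). (u, s, v) \<in> E \<and> nrm ip v < \<delta>}"

text \<open>The library relation \<open>dim_le\<close> is the small inductive dimension, which agrees with the
  covering dimension and the large inductive dimension on separable metrizable spaces.\<close>

definition has_top_dimension :: "'a::topological_space set \<Rightarrow> nat \<Rightarrow> bool" where
  "has_top_dimension S k \<longleftrightarrow>
     top_of_set S dim_le int k \<and> \<not> top_of_set S dim_le (int k - 1)"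


section \<open>Local stable manifolds\<close>

definition W_loc :: "(real^'n \<Rightarrow> real^'n \<Rightarrow> real) \<Rightarrow> ('n, 'm) sbundle \<Rightarrow> real \<Rightarrow>
    ((real^'m) linf \<times> 'n lifted \<times> 'n lifted \<Rightarrow> (real^'m) linf \<times> 'n lifted \<times> 'n lifted) \<Rightarrow>
    ('n, 'm) sbundle" where
  "W_loc ip E \<delta> S = S ` ball_bundle ip E \<delta>"

text \<open>Both sides are bundles over the same base, so the isomorphism covers the identity.\<close>

definition bundle_iso_onto_image :: "(real^'n \<Rightarrow> real^'n \<Rightarrow> real) \<Rightarrow> (real^'m) set \<Rightarrow>
    'n lifted set \<Rightarrow> ('n, 'm) sbundle \<Rightarrow> real \<Rightarrow>
    ((real^'m) linf \<times> 'n lifted \<times> 'n lifted \<Rightarrow> (real^'m) linf \<times> 'n lifted \<times> 'n lifted) \<Rightarrow> bool" where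
  "bundle_iso_onto_image ip U M E \<delta> S \<longleftrightarrow>
     W_loc ip E \<delta> S \<subseteq> controls U \<times> M \<times> psphere ip \<and>
     bundle_isomorphism
       (total_top (ball_bundle ip E \<delta>)) (base_top U M) base_proj
       (total_top (W_loc ip E \<delta> S)) (base_top U M) base_proj S id"

definition exponentially_attracted :: "(real^'n \<Rightarrow> real^'n \<Rightarrow> real) \<Rightarrow> real^'n^'n \<Rightarrow> real^'m^'n \<Rightarrow>
    ('n, 'm) sbundle \<Rightarrow> ereal \<Rightarrow> bool" where
  "exponentially_attracted ip A B W \<kappa> \<longleftrightarrow>
     (\<forall>u s0 s. (u, s0, s) \<in> W \<longrightarrow>
        (\<forall>\<alpha>::real. \<kappa> < ereal \<alpha> \<and> \<alpha> < 0 \<longrightarrow>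
          ((\<lambda>t. exp (- \<alpha> * t) * riem_dist ip (sphi ip A B t s u) (sphi ip A B t s0 u)) \<longlongrightarrow> 0) at_top))"

definition positively_invariant :: "(real^'n \<Rightarrow> real^'n \<Rightarrow> real) \<Rightarrow> real^'n^'n \<Rightarrow> real^'m^'n \<Rightarrow>
    (real^'m) set \<Rightarrow> 'n lifted set \<Rightarrow> ('n, 'm) sbundle \<Rightarrow> bool" where
  "positively_invariant ip A B U M W \<longleftrightarrow>
     (\<forall>u\<in>controls U. \<forall>s0\<in>M. \<forall>s\<in>fibre W u s0. \<forall>t\<ge>0.
        sphi ip A B t s u \<in> fibre W (shift t u) (sphi ip A B t s0 linf_zero))"

definition local_stable :: "(real^'n \<Rightarrow> real^'n \<Rightarrow> real) \<Rightarrow> real^'n^'n \<Rightarrow> real^'m^'n \<Rightarrow>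
    (real^'m) set \<Rightarrow> 'n lifted set \<Rightarrow> ('n, 'm) sbundle \<Rightarrow> real \<Rightarrow>
    ((real^'m) linf \<times> 'n lifted \<times> 'n lifted \<Rightarrow> (real^'m) linf \<times> 'n lifted \<times> 'n lifted) \<Rightarrow> bool" where
  "local_stable ip A B U M E \<delta> S \<longleftrightarrow>
     bundle_iso_onto_image ip U M E \<delta> S \<and>
     exponentially_attracted ip A B (W_loc ip E \<delta> S) (kappa ip A B E) \<and>
     (\<forall>u\<in>controls U. \<forall>s0\<in>M.
        has_top_dimension (fibre (W_loc ip E \<delta> S) u s0) (dim (fibre E u s0))) \<and>
     positively_invariant ip A B U M (W_loc ip E \<delta> S)"

definition lyapunov_orthogonal :: "(real^'n \<Rightarrow> real^'n \<Rightarrow> real) \<Rightarrow> real^'n^'n \<Rightarrow> bool" where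
  "lyapunov_orthogonal ip A \<longleftrightarrow>
     (\<forall>k\<in>lyapunov_exponents A. \<forall>l\<in>lyapunov_exponents A. k \<noteq> l \<longrightarrow>
        (\<forall>x\<in>lyapunov_space A k. \<forall>y\<in>lyapunov_space A l. ip x y = 0))"

end

theory Submission
  imports Defs "HOL-Computational_Algebra.Fundamental_Theorem_Algebra" "HOL-Real_Asymp.Real_Asymp"
begin

text \<open>
  The system lifted to \<open>\<real>\<^sup>n\<^sup>+\<^sup>1\<close> is linear, so the local stable manifold is explicit.  Let
  \<open>V u\<close> be the subspace of vectors which under the control \<open>u\<close> grow more slowly than the
  points of \<open>SL\<close>: it is spanned by the Lyapunov spaces with exponents below \<open>l0\<close> and, for
  \<open>l0 > 0\<close>, by \<open>(e(u,0), 1)\<close>.  The fibre of the stable subbundle at \<open>(u, s)\<close> is the tangential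
  part of \<open>V u\<close>, and the lifted flow maps \<open>s + w\<close> with \<open>w \<in> V u\<close> to a multiple of \<open>s' + w'\<close>
  with \<open>w' \<in> V (u(t + \<cdot>))\<close>.  Hence the points \<open>\<pi>(s + w)\<close> with \<open>w\<close> small in an adapted norm
  \<open>N\<close>, for which the flow is contracting without a constant, form a positively invariant
  manifold.  Since \<open>\<pi>(s + w) = exp(s, v)\<close> with \<open>v\<close> in the stable fibre, it even lies in the
  cone of angle \<open>0\<close>, and the distance of two trajectories is comparable to the norm of the
  linearized flow, which gives the rate \<open>\<kappa>\<close>.

  The fibres are balls, so their dimension requires that the small inductive dimension of a
  \<open>k\<close>-dimensional ball is at least \<open>k\<close>.  If it were smaller, every map from a closed subset of
  the ball to the sphere would extend to the ball, contrary to Brouwer's theorem.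
\<close>

section \<open>Small inductive dimension\<close>

text \<open>A ball of the given norm in the stable bundle need not stay inside the balls of the same
  radius: vectors may grow before they decay. Therefore w at s is measured by a quotient
  \<open>N\<close>. The numerator is a norm of w that grows along the lifted flow at most like
  e^{\<beta>t}, the denominator a norm of s that grows at least like e^{\<gamma>t}, both with
  constant 1, where \<beta> < \<gamma> lie between the exponents below \<open>l0\<close> and
  \<open>l0\<close> itself. The obstacle is the last coordinate: it is constant in time and feeds
  the input into the others. If \<open>l0 > 0\<close>, then \<beta> > 0 is possible, and a suitable
  weight on this coordinate absorbs the input; if \<open>l0 < 0\<close>, the coordinate vanishes on
  the slow spaces. Controls are only measurable, so the bounded solution is a convolution with
  Green's function, verified through integral equations. The same convolution writes e(u,0) as a
  pairing of u with integrable functions, hence as weak star continuous in u; the chart depends on u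
  through this vector alone, which reduces its continuity to a question on Euclidean spaces.\<close>

lemma frontier_of_top_of_set_subset:
  assumes "open U"
  shows "top_of_set S frontier_of (S \<inter> U) \<subseteq> S \<inter> closure U - U"
proof -
  have "S \<inter> U \<subseteq> top_of_set S interior_of (S \<inter> U)"
    using assms by (intro interior_of_maximal) auto
  moreover have "top_of_set S closure_of (S \<inter> U) \<subseteq> S \<inter> closure U"
    by (auto simp: closure_of_subtopology euclidean_closure_of) (meson closure_mono inf_le2 subsetD in_mono Int_lower2 le_infE)+
  ultimately show ?thesis
    by (auto simp: frontier_of_def)
qed

text \<open>Small balls form a neighbourhood base, and the relative frontier of
  \<open>S \<inter> ball x d\<close> lies in the sphere of radius d, so it is enough to bound the
  traces of small spheres. The bound \<open>e\<close> lets callers discard radii for which these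
  traces degenerate.\<close>

lemma dim_le_by_balls:
  fixes S :: "'a::euclidean_space set"
  assumes "-1 \<le> n" and "\<And>x. x \<in> S \<Longrightarrow> e x > (0::real)"
    and "\<And>x d. x \<in> S \<Longrightarrow> 0 < d \<Longrightarrow> d < e x \<Longrightarrow> top_of_set (S \<inter> sphere x d) dim_le (n - 1)"
  shows "top_of_set S dim_le n"
proof (rule iffD2[OF dimension_le_eq_subtopology], intro conjI allI impI)
  fix V a assume "openin euclidean V \<and> a \<in> V \<and> a \<in> S"
  then have V: "open V" "a \<in> V" "a \<in> S" by auto
  then obtain d0 where d0: "d0 > 0" "ball a d0 \<subseteq> V"
    by (meson openE)
  define d where "d = min (d0 / 2) (e a / 2)"
  have d: "0 < d" "d < e a" "ball a d \<subseteq> V"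
    using d0 assms(2)[of a] V by (auto simp: d_def min_def ball_def)
  have "top_of_set S frontier_of (S \<inter> ball a d) \<subseteq> S \<inter> sphere a d"
    using frontier_of_top_of_set_subset[of "ball a d" S] d by (auto simp: closure_ball)
  then have "top_of_set (top_of_set S frontier_of (S \<inter> ball a d)) dim_le (n - 1)"
    using assms(3)[OF V(3) d(1,2)] dimension_le_subtopologies by blast
  then show "\<exists>U. a \<in> U \<and> U \<subseteq> V \<and> openin euclidean U \<and>
          top_of_set (top_of_set S frontier_of (S \<inter> U)) dim_le (n - 1)"
    using d by (intro exI[of _ "ball a d"]) auto
qed (fact assms(1))

text \<open>A sphere around a point x of a given sphere meets it in a sphere inside a hyperplane
  section of T, so one dimension is lost and the induction applies. Radii below 2r keep the section
  from being tangential. If T is a point, the sphere is empty, which is dimension -1.\<close>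

lemma sphere_Int_sphere_dim_le:
  fixes T :: "'a::euclidean_space set"
  assumes "affine T" "a \<in> T" "r > 0" "aff_dim T \<le> int k"
  shows "top_of_set (T \<inter> sphere a r) dim_le (int k - 1)"
  using assms
proof (induction k arbitrary: T a r)
  case 0
  then have "T \<subseteq> {a}"
    using aff_dim_eq_0[of T] aff_dim_negative_iff[of T] by (cases "aff_dim T = 0") (auto simp: order_class.le_less)
  then have "T \<inter> sphere a r = {}" using 0 by auto
  then show ?case by simp
next
  case (Suc k)
  show ?case
  proof (rule dim_le_by_balls[where e = "\<lambda>_. 2 * r"])
    fix x d assume x: "x \<in> T \<inter> sphere a r" and d: "0 < d" "d < 2 * r"
    \<comment> \<open>Points y of both spheres satisfy (x - a) \<bullet> (y - a) = c.
      \<open>H\<close> is this hyperplane; \<open>a'\<close>, its intersection with the line through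
      a and x, is the centre of the section.\<close>
    define c where "c = r\<^sup>2 - d\<^sup>2 / 2"
    define H where "H = {y. (x - a) \<bullet> y = c + (x - a) \<bullet> a}"
    define s where "s = d\<^sup>2 / (2 * r\<^sup>2)"
    define a' where "a' = x - s *\<^sub>R (x - a)"
    have nx: "(x - a) \<bullet> (x - a) = r\<^sup>2" 
      using x by (simp add: dist_norm norm_minus_commute power2_norm_eq_inner[symmetric])
    have aT: "affine (T \<inter> H)"
      unfolding H_def by (intro affine_Int Suc.prems affine_hyperplane)
    have a'T: "a' \<in> T"
    proof -
      have "a' = (1 - s) *\<^sub>R x + s *\<^sub>R a" by (simp add: a'_def algebra_simps)
      then show ?thesis using x Suc.prems mem_affine[of T x a "1 - s" s] by auto
    qed
    have "(x - a) \<bullet> a' = (x - a) \<bullet> x - s * r\<^sup>2"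
      by (simp only: a'_def inner_diff_right[of _ x "s *\<^sub>R (x - a)"] inner_scaleR_right nx)
    also have "\<dots> = c + (x - a) \<bullet> a"
      using nx Suc.prems inner_diff_right[of "x - a" x a] by (simp add: s_def c_def)
    finally have a'H: "a' \<in> H" by (simp add: H_def)
    \<comment> \<open>By Pythagoras this is the squared radius of the section. It equals d^2 (1 -
      s/2), and s < 2 is the condition d < 2r.\<close>
    have d2: "d\<^sup>2 - s\<^sup>2 * r\<^sup>2 > 0"
    proof -
      have "s * r\<^sup>2 = d\<^sup>2/2" using Suc.prems by (simp add: s_def)
      then have "d\<^sup>2 - s\<^sup>2 * r\<^sup>2 = d\<^sup>2 * (1 - s / 2)"
        by (simp add: power2_eq_square algebra_simps)
      moreover have "s < 2"
      proof -
        have "d\<^sup>2 < (2 * r)\<^sup>2" using d by (intro power_strict_mono) auto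
        then show ?thesis using Suc.prems by (simp add: s_def divide_simps power_mult_distrib)
      qed
      ultimately show ?thesis using d by simp
    qed
    have sub: "T \<inter> sphere a r \<inter> sphere x d \<subseteq> T \<inter> H \<inter> sphere a' (sqrt (d\<^sup>2 - s\<^sup>2 * r\<^sup>2))"
    proof
      fix y assume y: "y \<in> T \<inter> sphere a r \<inter> sphere x d"
      then have 1: "(y - a) \<bullet> (y - a) = r\<^sup>2" "(y - x) \<bullet> (y - x) = d\<^sup>2"
        by (simp_all add: dist_norm norm_minus_commute power2_norm_eq_inner[symmetric])
      have "(y - x) \<bullet> (y - x) = (y - a) \<bullet> (y - a) - 2 * ((x - a) \<bullet> (y - a)) + (x - a) \<bullet> (x - a)"
        by (simp add: inner_diff_left inner_diff_right inner_commute)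
      then have 2: "(x - a) \<bullet> (y - a) = c"
        using 1 nx by (simp add: c_def field_simps)
      then have yH: "y \<in> H" by (simp add: H_def inner_diff_right)
      have 3: "(x - a) \<bullet> (y - a') = 0"
        using yH a'H by (simp add: H_def inner_diff_right)
      have "(y - x) \<bullet> (y - x) = (y - a' - s *\<^sub>R (x - a)) \<bullet> (y - a' - s *\<^sub>R (x - a))"
        by (simp add: a'_def)
      also have "\<dots> = (y - a') \<bullet> (y - a') - 2 * s * ((x - a) \<bullet> (y - a')) + s\<^sup>2 * ((x - a) \<bullet> (x - a))"
        by (simp only: inner_diff_left inner_diff_right inner_scaleR_left inner_scaleR_right)
           (simp add: power2_eq_square algebra_simps inner_commute)
      finally have "(norm (y - a'))\<^sup>2 = d\<^sup>2 - s\<^sup>2 * r\<^sup>2"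
        using 1 3 nx by (simp add: power2_norm_eq_inner)
      then have "norm (y - a') = sqrt (d\<^sup>2 - s\<^sup>2 * r\<^sup>2)"
        by (metis norm_ge_zero real_sqrt_unique)
      then show "y \<in> T \<inter> H \<inter> sphere a' (sqrt (d\<^sup>2 - s\<^sup>2 * r\<^sup>2))"
        using y yH by (simp add: dist_norm norm_minus_commute)
    qed
    have "a \<notin> H \<or> x \<notin> H" 
      using nx Suc.prems by (auto simp: H_def inner_diff_right)
    then have "T \<inter> H \<subset> T" using x Suc.prems by auto
    moreover have "T \<inter> H \<noteq> {}" using a'T a'H by auto
    ultimately have "aff_dim (T \<inter> H) < aff_dim T"
      using aff_dim_psubset[of "T \<inter> H" T] aT Suc.prems by (simp add: hull_same)
    then have "top_of_set (T \<inter> H \<inter> sphere a' (sqrt (d\<^sup>2 - s\<^sup>2 * r\<^sup>2))) dim_le (int k - 1)"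
      using Suc.prems a'T a'H d2 aT by (intro Suc.IH) auto
    then show "top_of_set (T \<inter> sphere a r \<inter> sphere x d) dim_le (int (Suc k) - 1 - 1)"
      using dimension_le_subtopologies[OF _ sub] by simp
  qed (use Suc.prems in \<open>simp_all\<close>)
qed

lemma subspace_dim_le:
  fixes T :: "'a::euclidean_space set"
  assumes "subspace T"
  shows "top_of_set T dim_le int (dim T)"
proof (rule dim_le_by_balls[where e = "\<lambda>_. 1"])
  fix x d assume "x \<in> T" "(0::real) < d" "d < 1"
  then show "top_of_set (T \<inter> sphere x d) dim_le int (dim T) - 1"
    using assms by (intro sphere_Int_sphere_dim_le) (auto simp: subspace_imp_affine aff_dim_subspace)
qed auto

text \<open>The extension argument below trades one dimension of the source for one direction of the
  cube.\<close>

definition cube :: "'b::euclidean_space set \<Rightarrow> 'b set" where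
  "cube J = cbox 0 (\<Sum>J)"

text \<open>For \<open>J = {}\<close> the cube is the point 0 and its boundary is empty; in that
  case extending from \<open>K \<times> cube_bd J \<union> C \<times> cube J\<close> means extending
  a map from C to K.\<close>

definition cube_bd :: "'b::euclidean_space set \<Rightarrow> 'b set" where
  "cube_bd J = {y \<in> cube J. \<exists>b\<in>J. y \<bullet> b = 0 \<or> y \<bullet> b = 1}"

lemma inner_sum_Basis_subset:
  assumes "J \<subseteq> Basis" "b \<in> Basis"
  shows "\<Sum>J \<bullet> b = (if b \<in> J then 1 else 0)"
proof -
  have "finite J" using assms finite_Basis finite_subset by blast
  have "\<Sum>J \<bullet> b = (\<Sum>i\<in>J. i \<bullet> b)" by (simp add: inner_sum_left)
  also have "\<dots> = (\<Sum>i\<in>J. if i = b then 1 else 0)"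
    using assms by (intro sum.cong) (auto simp: inner_Basis subset_iff)
  finally show ?thesis using \<open>finite J\<close> by (simp add: sum.delta)
qed

lemma mem_cube:
  assumes "J \<subseteq> Basis"
  shows "y \<in> cube J \<longleftrightarrow> (\<forall>b\<in>J. 0 \<le> y \<bullet> b \<and> y \<bullet> b \<le> 1) \<and> (\<forall>b\<in>Basis - J. y \<bullet> b = 0)"
proof -
  have "y \<in> cube J \<longleftrightarrow> (\<forall>b\<in>Basis. 0 \<le> y \<bullet> b \<and> y \<bullet> b \<le> (if b \<in> J then 1 else 0))"
    using inner_sum_Basis_subset[OF assms] by (auto simp: cube_def mem_box)
  then show ?thesis using assms by (auto simp: subset_iff intro: antisym)
qed

lemma compact_cube: "compact (cube J)" by (simp add: cube_def)

lemma compact_cube_bd: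
  assumes "J \<subseteq> Basis"
  shows "compact (cube_bd J)"
proof -
  have "finite J" using assms finite_Basis finite_subset by blast
  have "cube_bd J = cube J \<inter> (\<Union>b\<in>J. {y. y \<bullet> b = 0} \<union> {y. y \<bullet> b = 1})"
    by (auto simp: cube_bd_def)
  moreover have "closed (\<Union>b\<in>J. {y::'a. y \<bullet> b = 0} \<union> {y. y \<bullet> b = 1})"
    using \<open>finite J\<close> by (intro closed_UN ballI closed_Un closed_Collect_eq continuous_intros)
  ultimately show ?thesis by (simp add: compact_Int_closed compact_cube)
qed

lemma aff_dim_cube:
  assumes "J \<subseteq> Basis"
  shows "aff_dim (cube J) \<le> int (card J)"
proof -
  have "finite J" using assms finite_Basis finite_subset by blast
  have "cube J \<subseteq> span J"
  proof
    fix y assume y: "y \<in> cube J"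
    have "y = (\<Sum>b\<in>Basis. (y \<bullet> b) *\<^sub>R b)" by (simp add: euclidean_representation)
    also have "\<dots> = (\<Sum>b\<in>J. (y \<bullet> b) *\<^sub>R b)"
      using assms y by (intro sum.mono_neutral_right) (auto simp: mem_cube)
    also have "\<dots> \<in> span J" by (intro span_sum span_mul span_base)
    finally show "y \<in> span J" .
  qed
  then have "aff_dim (cube J) \<le> aff_dim (span J)" by (rule aff_dim_subset)
  also have "\<dots> = int (dim (span J))" by (simp add: aff_dim_subspace)
  also have "\<dots> \<le> int (card J)" using \<open>finite J\<close> by (simp add: dim_le_card')
  finally show ?thesis .
qed

text \<open>Splits off the coordinate b: the cube over \<open>insert b J\<close> is a prism over
  \<open>cube J\<close>, and its boundary consists of the two end faces and the lateral
  part.\<close>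

lemma cube_insert:
  assumes "J \<subseteq> Basis" "b \<in> Basis - J"
  shows "y \<in> cube (insert b J) \<longleftrightarrow> 0 \<le> y \<bullet> b \<and> y \<bullet> b \<le> 1 \<and> y - (y \<bullet> b) *\<^sub>R b \<in> cube J" (is ?A)
    and "y \<in> cube_bd (insert b J) \<longleftrightarrow> y \<in> cube (insert b J) \<and>
           (y \<bullet> b = 0 \<or> y \<bullet> b = 1 \<or> y - (y \<bullet> b) *\<^sub>R b \<in> cube_bd J)" (is ?B)
proof -
  have i: "(y - (y \<bullet> b) *\<^sub>R b) \<bullet> c = (if c = b then 0 else y \<bullet> c)" if "c \<in> Basis" for c
    using that assms by (auto simp: inner_diff_left inner_Basis)
  have J: "insert b J \<subseteq> Basis" using assms by auto
  have iJ: "(y - (y \<bullet> b) *\<^sub>R b) \<bullet> c = y \<bullet> c" if "c \<in> J" for c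
    using i[of c] that assms by auto
  show ?A
    unfolding mem_cube[OF J] mem_cube[OF assms(1)] using assms by (auto simp: i iJ)
  then show ?B
    unfolding cube_bd_def using assms by (auto simp: iJ)
qed

lemma cube_subset_insert:
  assumes "J \<subseteq> Basis" "b \<in> Basis - J" "y \<in> cube J" "0 \<le> t" "t \<le> 1"
  shows "y + t *\<^sub>R b \<in> cube (insert b J)" "(y + t *\<^sub>R b) \<bullet> b = t"
    "(y + t *\<^sub>R b) - ((y + t *\<^sub>R b) \<bullet> b) *\<^sub>R b = y"
proof -
  have "y \<bullet> b = 0" using assms mem_cube by blast
  then show *: "(y + t *\<^sub>R b) \<bullet> b = t" using assms by (simp add: inner_add_left)
  then show "(y + t *\<^sub>R b) - ((y + t *\<^sub>R b) \<bullet> b) *\<^sub>R b = y" by simp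
  then show "y + t *\<^sub>R b \<in> cube (insert b J)" using assms * by (simp add: cube_insert)
qed


text \<open>The induction glues two partial extensions along the frontier of a small open set.  This
  frontier has smaller dimension, and the induction hypothesis for the enlarged cube is a homotopy
  between the two extensions there.\<close>

lemma extend_map_cube_product:
  fixes K C :: "'a::euclidean_space set" and f :: "'a \<times> 'b::euclidean_space \<Rightarrow> 'c::euclidean_space"
  assumes "compact K" "closed C" "C \<subseteq> K" "top_of_set K dim_le (int k - 1)"
    and T: "convex T" "bounded T" and J: "J \<subseteq> Basis"
    and dim: "int k + int (card J) \<le> aff_dim T" "aff_dim T \<le> int DIM('b)"
    and f: "continuous_on (K \<times> cube_bd J \<union> C \<times> cube J) f"
      "f ` (K \<times> cube_bd J \<union> C \<times> cube J) \<subseteq> rel_frontier T"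
  shows "\<exists>g. continuous_on (K \<times> cube J) g \<and> g ` (K \<times> cube J) \<subseteq> rel_frontier T \<and>
           (\<forall>p\<in>K \<times> cube_bd J \<union> C \<times> cube J. g p = f p)"
  using assms
proof (induction k arbitrary: K C f J)
  case 0
  \<comment> \<open>The dimension bound is -1 here.\<close>
  then have "K = {}" by (simp add: subtopology_trivial_iff)
  then show ?case using 0 by (intro exI[of _ f]) auto
next
  case (Suc k)
  define D where "D = K \<times> cube_bd J \<union> C \<times> cube J"
  note fD = Suc.prems(10,11)[folded D_def]
  have finJ: "finite J" using Suc.prems finite_Basis finite_subset by blast
  have "compact C" using Suc.prems compact_Int_closed[of K C] by (simp add: Int_absorb1)
  then have compD: "compact D"
    unfolding D_def using Suc.prems by (intro compact_Un compact_Times compact_cube compact_cube_bd)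
  have bd_sub: "cube_bd J \<subseteq> cube J" by (auto simp: cube_bd_def)
  have ANR_T: "ANR (rel_frontier T)" using T by (simp add: ANR_rel_frontier_convex)
  have "card J < DIM('b)" using Suc.prems by linarith
  then obtain b where b: "b \<in> Basis - J"
    by (metis Diff_eq_empty_iff card_mono ex_in_conv finJ linorder_not_less)
  have J': "insert b J \<subseteq> Basis" "card (insert b J) = Suc (card J)"
    using b Suc.prems finJ by auto
  \<comment> \<open>Extendability over Z, compatibly with f. The aim is \<open>ext K\<close>,
    reached by adding small closed sets one at a time.\<close>
  define ext where "ext Z \<longleftrightarrow> (\<exists>g. continuous_on (Z \<times> cube J) g \<and> g ` (Z \<times> cube J) \<subseteq> rel_frontier T \<and>
      (\<forall>p\<in>(Z \<times> cube J) \<inter> D. g p = f p))" for Z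
  \<comment> \<open>Over the single point x the map extends because the cube has smaller dimension
    than T. The relative frontier of T is an ANR, so the extension spreads to a neighbourhood, which
    the tube lemma makes a product. Inside it U is chosen by the definition of the
    dimension.\<close>
  have local: "\<exists>U. open U \<and> x \<in> U \<and> ext (closure (K \<inter> U)) \<and>
      top_of_set (closure (K \<inter> U) - U) dim_le (int k - 1)" if x: "x \<in> K" for x
  proof -
    have "\<exists>h. continuous_on (D \<union> {x} \<times> cube J) h \<and> h ` (D \<union> {x} \<times> cube J) \<subseteq> rel_frontier T
        \<and> (\<forall>p\<in>D. h p = f p)"
    proof (cases "x \<in> C")
      case True
      then have "D \<union> {x} \<times> cube J = D" by (auto simp: D_def)
      then show ?thesis using fD by (intro exI[of _ f]) auto
    next
      case False
      have "\<And>p. p \<in> cube_bd J \<Longrightarrow> (x, p) \<in> D" using x by (auto simp: D_def)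
      then have c1: "continuous_on (cube_bd J) (\<lambda>y. f (x, y))"
        by (intro continuous_on_compose2[OF fD(1)] continuous_intros) auto
      have c2: "(\<lambda>y. f (x, y)) \<in> cube_bd J \<rightarrow> rel_frontier T"
        using fD(2) x by (auto simp: D_def)
      obtain g where g: "continuous_on (\<Union>{cube J}) g" "g \<in> (\<Union>{cube J}) \<rightarrow> rel_frontier T"
         "\<And>y. y \<in> cube_bd J \<Longrightarrow> g y = f (x, y)"
      proof (rule extend_map_cell_complex_to_sphere[of "{cube J}" "cube_bd J" T "\<lambda>y. f (x, y)"])
        show "closed (cube_bd J)" using compact_cube_bd Suc.prems compact_imp_closed by blast
        show "polytope X" if "X \<in> {cube J}" for X using that by (simp add: cube_def polytope_interval)
        show "aff_dim X < aff_dim T" if "X \<in> {cube J}" for X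
          using that aff_dim_cube[OF Suc.prems(7)] Suc.prems by auto
        show "(X \<inter> Y) face_of X" if "X \<in> {cube J}" "Y \<in> {cube J}" for X Y
          using that by (auto simp: cube_def intro: face_of_refl)
      qed (use bd_sub T c1 c2 in auto)
      define h where "h p = (if p \<in> D then f p else g (snd p))" for p
      have "continuous_on (D \<union> {x} \<times> cube J) h"
        unfolding h_def
      proof (rule continuous_on_cases)
        show "closed D" using compD compact_imp_closed by blast
        show "closed ({x} \<times> cube J)" by (simp add: closed_Times compact_cube compact_imp_closed)
        show "continuous_on ({x} \<times> cube J) (\<lambda>p. g (snd p))"
          by (rule continuous_on_compose2[OF g(1)]) (auto intro: continuous_intros)
        show "\<forall>p. p \<in> D \<and> p \<notin> D \<or> p \<in> {x} \<times> cube J \<and> p \<in> D \<longrightarrow> f p = g (snd p)"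
          using False g(3) by (auto simp: D_def)
      qed (rule fD(1))
      moreover have "h ` (D \<union> {x} \<times> cube J) \<subseteq> rel_frontier T"
        using fD(2) g(2) by (fastforce simp: h_def)
      ultimately show ?thesis by (intro exI[of _ h]) (auto simp: h_def)
    qed
    then obtain h where h: "continuous_on (D \<union> {x} \<times> cube J) h"
      "h \<in> (D \<union> {x} \<times> cube J) \<rightarrow> rel_frontier T" "\<And>p. p \<in> D \<Longrightarrow> h p = f p" by blast
    have "closed (D \<union> {x} \<times> cube J)"
      by (intro closed_Un compact_imp_closed compD compact_Times compact_cube) auto
    then obtain V g where V: "D \<union> {x} \<times> cube J \<subseteq> V" "open V" "continuous_on V g"
       "g \<in> V \<rightarrow> rel_frontier T" "\<And>p. p \<in> D \<union> {x} \<times> cube J \<Longrightarrow> g p = h p"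
      using neighbourhood_extension_into_ANR[OF h(1,2) ANR_T] by metis
    obtain X0 where X0: "x \<in> X0" "open X0" "X0 \<times> cube J \<subseteq> V"
      using Elementary_Topology.tube_lemma[OF compact_cube V(2), of x J] V(1) by auto
    then obtain e where e: "e > 0" "cball x e \<subseteq> X0"
      by (meson open_contains_cball)
    have "openin euclidean (ball x e)" "x \<in> ball x e" using e by auto
    then obtain U where U: "x \<in> U" "U \<subseteq> ball x e" "openin euclidean U"
        "top_of_set (top_of_set K frontier_of (K \<inter> U)) dim_le (int (Suc k) - 1 - 1)"
      using Suc.prems(4) x unfolding dimension_le_eq_subtopology[of euclidean K] by metis
    have "closed K" using Suc.prems compact_imp_closed by blast
    then have clK: "closure (K \<inter> U) \<subseteq> K" by (simp add: closure_minimal)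
    have "top_of_set K frontier_of (K \<inter> U) = closure (K \<inter> U) - U"
    proof -
      have "openin (top_of_set K) (K \<inter> U)" using U by auto
      then have "top_of_set K interior_of (K \<inter> U) = K \<inter> U" by (rule interior_of_openin)
      moreover have "top_of_set K closure_of (K \<inter> U) = closure (K \<inter> U)"
        using clK by (simp add: closure_of_subtopology euclidean_closure_of Int_absorb1 Int_absorb2 flip: Int_assoc)
      ultimately show ?thesis using clK by (auto simp: frontier_of_def)
    qed
    moreover have "ext (closure (K \<inter> U))"
    proof -
      have "closure (K \<inter> U) \<subseteq> cball x e"
        using U by (intro closure_minimal) (auto simp: subset_iff less_imp_le)
      then have sub: "closure (K \<inter> U) \<times> cube J \<subseteq> V" using e X0 by blast
      have "continuous_on (closure (K \<inter> U) \<times> cube J) g"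
        using V(3) sub continuous_on_subset by blast
      moreover have "g ` (closure (K \<inter> U) \<times> cube J) \<subseteq> rel_frontier T"
        using V(4) sub by blast
      moreover have "\<forall>p\<in>(closure (K \<inter> U) \<times> cube J) \<inter> D. g p = f p"
        using V(5) h(3) by auto
      ultimately show ?thesis unfolding ext_def by blast
    qed
    ultimately show ?thesis using U by auto
  qed
  have step: "ext (A \<union> closure (K \<inter> U))" if A: "compact A" "A \<subseteq> K" "ext A" and U: "open U"
      "ext (closure (K \<inter> U))" "top_of_set (closure (K \<inter> U) - U) dim_le (int k - 1)" for A U
  proof -
    define E where "E = closure (K \<inter> U)"
    \<comment> \<open>Cutting U out of A leaves an overlap F with E inside
      \<open>closure (K \<inter> U) - U\<close>, where the dimension has dropped.\<close>
    define A' where "A' = A - U"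
    define F where "F = A' \<inter> E"
    define CF where "CF = C \<inter> F"
    have "closed K" using Suc.prems compact_imp_closed by blast
    then have EK: "E \<subseteq> K" by (simp add: E_def closure_minimal)
    have compE: "compact E"
      unfolding E_def compact_closure using Suc.prems(1) compact_imp_bounded bounded_subset by blast
    have compA': "compact A'" using A U by (simp add: A'_def compact_diff)
    have compF: "compact F" using compA' compE by (simp add: F_def compact_Int)
    have AE: "A \<union> E = A' \<union> E" using A closure_subset[of "K \<inter> U"] by (auto simp: A'_def E_def)
    have dimF: "top_of_set F dim_le (int k - 1)"
      by (rule dimension_le_subtopologies[OF U(3)]) (auto simp: F_def A'_def E_def)
    obtain g1 where g1: "continuous_on (A \<times> cube J) g1" "g1 ` (A \<times> cube J) \<subseteq> rel_frontier T"
      "\<And>p. p \<in> (A \<times> cube J) \<inter> D \<Longrightarrow> g1 p = f p"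
      using A unfolding ext_def by blast
    obtain g2 where g2: "continuous_on (E \<times> cube J) g2" "g2 ` (E \<times> cube J) \<subseteq> rel_frontier T"
      "\<And>p. p \<in> (E \<times> cube J) \<inter> D \<Longrightarrow> g2 p = f p"
      using U unfolding ext_def E_def by blast
    have FA: "F \<subseteq> A" and FE: "F \<subseteq> E" and FK: "F \<subseteq> K" using A by (auto simp: F_def A'_def)
    have FAJ: "F \<times> cube J \<subseteq> A \<times> cube J" and FEJ: "F \<times> cube J \<subseteq> E \<times> cube J"
      using FA FE by auto
    define pj where "pj p = (fst p, snd p - (snd p \<bullet> b) *\<^sub>R b)" for p :: "'a \<times> 'b"
    \<comment> \<open>The data on the prism over F: \<open>g1\<close> on the bottom,
      \<open>g2\<close> on the top, and f on the lateral part and over C.\<close>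
    define M0 where "M0 = {p \<in> F \<times> cube (insert b J). snd p \<bullet> b = 0}"
    define M1 where "M1 = {p \<in> F \<times> cube (insert b J). snd p \<bullet> b = 1}"
    define M2 where "M2 = {p \<in> F \<times> cube (insert b J). pj p \<in> D}"
    define H0 where "H0 p = (if p \<in> M0 then g1 (pj p) else if p \<in> M1 then g2 (pj p) else f (pj p))"
      for p :: "'a \<times> 'b"
    have cpj: "continuous_on X pj" for X
      unfolding pj_def by (intro continuous_intros)
    have pjin: "pj p \<in> F \<times> cube J" if "p \<in> F \<times> cube (insert b J)" for p
      using that b cube_insert[OF Suc.prems(7) b] by (auto simp: pj_def)
    have clM: "closed (F \<times> cube (insert b J))"
      by (simp add: closed_Times compF compact_cube compact_imp_closed)
    have clM0: "closed M0" "closed M1"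
    proof -
      have "M0 = F \<times> cube (insert b J) \<inter> {p. snd p \<bullet> b = 0}" "M1 = F \<times> cube (insert b J) \<inter> {p. snd p \<bullet> b = 1}"
        by (auto simp: M0_def M1_def)
      then show "closed M0" "closed M1"
        using clM by (auto intro!: closed_Int closed_Collect_eq continuous_intros)
    qed
    have clM2: "closed M2"
    proof -
      have "M2 = F \<times> cube (insert b J) \<inter> pj -` D" by (auto simp: M2_def)
      moreover have "closed (pj -` D)"
        using cpj[of UNIV] compD by (intro closed_vimage compact_imp_closed) (auto simp: continuous_on_eq_continuous_at)
      ultimately show ?thesis using clM by auto
    qed
    have dom: "F \<times> cube_bd (insert b J) \<union> CF \<times> cube (insert b J) = M0 \<union> (M1 \<union> M2)"
    proof (rule set_eqI)
      fix p :: "'a \<times> 'b"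
      show "p \<in> F \<times> cube_bd (insert b J) \<union> CF \<times> cube (insert b J) \<longleftrightarrow> p \<in> M0 \<union> (M1 \<union> M2)"
        using cube_insert[OF Suc.prems(7) b, of "snd p"] FK
        by (cases p) (auto simp: M0_def M1_def M2_def pj_def D_def CF_def)
    qed
    have cH: "continuous_on (M0 \<union> (M1 \<union> M2)) H0"
      unfolding H0_def
    proof (rule continuous_on_cases)
      have "pj ` M0 \<subseteq> A \<times> cube J" using pjin FA by (fastforce simp: M0_def)
      then show "continuous_on M0 (\<lambda>p. g1 (pj p))"
        by (intro continuous_on_compose2[OF g1(1) cpj])
      show "continuous_on (M1 \<union> M2) (\<lambda>p. if p \<in> M1 then g2 (pj p) else f (pj p))"
      proof (rule continuous_on_cases)
        have "pj ` M1 \<subseteq> E \<times> cube J" using pjin FE by (fastforce simp: M1_def)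
        then show "continuous_on M1 (\<lambda>p. g2 (pj p))"
          by (intro continuous_on_compose2[OF g2(1) cpj])
        show "continuous_on M2 (\<lambda>p. f (pj p))"
          by (intro continuous_on_compose2[OF fD(1) cpj]) (auto simp: M2_def)
        show "\<forall>p. p \<in> M1 \<and> p \<notin> M1 \<or> p \<in> M2 \<and> p \<in> M1 \<longrightarrow> g2 (pj p) = f (pj p)"
        proof (intro allI impI)
          fix p assume "p \<in> M1 \<and> p \<notin> M1 \<or> p \<in> M2 \<and> p \<in> M1"
          then have "p \<in> F \<times> cube (insert b J)" "pj p \<in> D" by (auto simp: M2_def)
          then show "g2 (pj p) = f (pj p)" by (intro g2(3) IntI subsetD[OF FEJ] pjin)
        qed
      qed (use clM0 clM2 in auto)
      show "\<forall>p. p \<in> M0 \<and> p \<notin> M0 \<or> p \<in> M1 \<union> M2 \<and> p \<in> M0 \<longrightarrow>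
         g1 (pj p) = (if p \<in> M1 then g2 (pj p) else f (pj p))"
      proof (intro allI impI)
        fix p assume "p \<in> M0 \<and> p \<notin> M0 \<or> p \<in> M1 \<union> M2 \<and> p \<in> M0"
        then have "p \<in> F \<times> cube (insert b J)" "pj p \<in> D" "p \<notin> M1" by (auto simp: M0_def M1_def M2_def)
        moreover from this have "g1 (pj p) = f (pj p)" by (intro g1(3) IntI subsetD[OF FAJ] pjin)
        ultimately show "g1 (pj p) = (if p \<in> M1 then g2 (pj p) else f (pj p))" by simp
      qed
    qed (use clM0 clM2 in auto)
    have imH: "H0 ` (M0 \<union> (M1 \<union> M2)) \<subseteq> rel_frontier T"
    proof -
      have "g1 (pj p) \<in> rel_frontier T" if "p \<in> M0" for p
        using that by (intro subsetD[OF g1(2)] imageI subsetD[OF FAJ] pjin) (simp add: M0_def)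
      moreover have "g2 (pj p) \<in> rel_frontier T" if "p \<in> M1" for p
        using that by (intro subsetD[OF g2(2)] imageI subsetD[OF FEJ] pjin) (simp add: M1_def)
      moreover have "f (pj p) \<in> rel_frontier T" if "p \<in> M2" for p
        using that by (intro subsetD[OF fD(2)] imageI) (simp add: M2_def)
      ultimately show ?thesis by (auto simp: H0_def)
    qed
    \<comment> \<open>One dimension less for the source, one more direction for the cube: the
      induction hypothesis fills the prism, so H deforms \<open>g1\<close> into \<open>g2\<close>
      and keeps f where f is prescribed.\<close>
    have "\<exists>H. continuous_on (F \<times> cube (insert b J)) H \<and> H ` (F \<times> cube (insert b J)) \<subseteq> rel_frontier T \<and>
           (\<forall>p\<in>F \<times> cube_bd (insert b J) \<union> CF \<times> cube (insert b J). H p = H0 p)"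
    proof (rule Suc.IH)
      show "continuous_on (F \<times> cube_bd (insert b J) \<union> CF \<times> cube (insert b J)) H0"
        "H0 ` (F \<times> cube_bd (insert b J) \<union> CF \<times> cube (insert b J)) \<subseteq> rel_frontier T"
        unfolding dom by (rule cH, rule imH)
      show "closed CF" unfolding CF_def using Suc.prems(2) compact_imp_closed[OF compF] by (rule closed_Int)
      show "CF \<subseteq> F" by (simp add: CF_def)
      show "int k + int (card (insert b J)) \<le> aff_dim T" using Suc.prems J' by simp
    qed (use compF dimF T J' Suc.prems in simp_all)
    then obtain H where H: "continuous_on (F \<times> cube (insert b J)) H"
      "H ` (F \<times> cube (insert b J)) \<subseteq> rel_frontier T" "\<And>p. p \<in> M0 \<union> (M1 \<union> M2) \<Longrightarrow> H p = H0 p"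
      unfolding dom by blast
    define S0 where "S0 = F \<times> cube J \<union> (E \<times> cube J) \<inter> D"
    \<comment> \<open>The prism is traversed from top to bottom, so that the homotopy starts at
      \<open>g2\<close>, the map that is already defined on all of
      \<open>E \<times> cube J\<close>.\<close>
    define sh where "sh t p = (fst p, snd p + (1 - t) *\<^sub>R b)" for t :: real and p :: "'a \<times> 'b"
    define hm where "hm q = (if q \<in> {0..1} \<times> (F \<times> cube J) then H (sh (fst q) (snd q)) else f (snd q))"
      for q :: "real \<times> 'a \<times> 'b"
    have sh: "sh t p \<in> F \<times> cube (insert b J)" "snd (sh t p) \<bullet> b = 1 - t" "pj (sh t p) = p"
      if "t \<in> {0..1}" "p \<in> F \<times> cube J" for t p
      using that cube_subset_insert[OF Suc.prems(7) b, of "snd p" "1 - t"]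
      by (auto simp: sh_def pj_def)
    have HD: "H (sh t p) = f p" if "t \<in> {0..1}" "p \<in> F \<times> cube J" "p \<in> D" for t p
    proof -
      have M2: "sh t p \<in> M2" using sh[OF that(1,2)] that(3) by (simp add: M2_def)
      moreover have "g1 p = f p" by (rule g1(3)[OF IntI[OF subsetD[OF FAJ that(2)] that(3)]])
      moreover have "g2 p = f p" by (rule g2(3)[OF IntI[OF subsetD[OF FEJ that(2)] that(3)]])
      ultimately show ?thesis using H(3)[of "sh t p"] sh[OF that(1,2)] by (simp add: H0_def)
    qed
    have H1: "H (sh 0 p) = g2 p" "H (sh 1 p) = g1 p" if "p \<in> F \<times> cube J" for p
    proof -
      have "sh 0 p \<in> M1" "sh 0 p \<notin> M0" "sh 1 p \<in> M0" using sh[of _ p] that by (simp_all add: M0_def M1_def)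
      then show "H (sh 0 p) = g2 p" "H (sh 1 p) = g1 p"
        using H(3) sh(3)[of 0 p] sh(3)[of 1 p] that by (simp_all add: H0_def)
    qed
    define g' where "g' p = (if p \<in> F \<times> cube J then g1 p else f p)" for p
    have clS: "closed (F \<times> cube J)" "closed ((E \<times> cube J) \<inter> D)"
      by (simp_all add: closed_Times compF compE compact_cube compact_imp_closed compD closed_Int)
    have "homotopic_with_canon (\<lambda>x. True) S0 (rel_frontier T) g2 g'"
    proof (rule iffD2[OF homotopic_with], simp, intro exI[of _ hm] conjI ballI)
      have eq: "{0..1::real} \<times> S0 = {0..1} \<times> (F \<times> cube J) \<union> {0..1} \<times> ((E \<times> cube J) \<inter> D)"
        by (auto simp: S0_def)
      have "continuous_on ({0..1} \<times> S0) hm"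
        unfolding hm_def eq
      proof (rule continuous_on_cases)
        have "continuous_on ({0..1} \<times> (F \<times> cube J)) (\<lambda>q. sh (fst q) (snd q))"
          unfolding sh_def by (intro continuous_intros)
        moreover have "(\<lambda>q. sh (fst q) (snd q)) ` ({0..1} \<times> (F \<times> cube J)) \<subseteq> F \<times> cube (insert b J)"
          using sh(1) by fastforce
        ultimately show "continuous_on ({0..1} \<times> (F \<times> cube J)) (\<lambda>q. H (sh (fst q) (snd q)))"
          by (intro continuous_on_compose2[OF H(1)])
        show "continuous_on ({0..1} \<times> ((E \<times> cube J) \<inter> D)) (\<lambda>q. f (snd q))"
          by (rule continuous_on_compose2[OF fD(1)]) (auto intro: continuous_intros)
      qed (use clS HD in \<open>auto intro: closed_Times\<close>)
      moreover have "hm ` ({0..1::real} \<times> S0) \<subseteq> rel_frontier T"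
      proof (rule image_subsetI)
        fix q assume q: "q \<in> {0..1::real} \<times> S0"
        show "hm q \<in> rel_frontier T"
        proof (cases "q \<in> {0..1} \<times> (F \<times> cube J)")
          case True
          then have "sh (fst q) (snd q) \<in> F \<times> cube (insert b J)" by (intro sh(1)) auto
          then show ?thesis using True H(2) by (simp only: hm_def if_True image_subset_iff)
        next
          case False
          then have "snd q \<in> D" using q by (auto simp: S0_def)
          then show ?thesis using False fD(2) by (simp only: hm_def if_False image_subset_iff)
        qed
      qed
      ultimately show "continuous_map (prod_topology (top_of_set {0..1}) (top_of_set S0)) (top_of_set (rel_frontier T)) hm"
        by (simp add: subtopology_Times[symmetric] image_subset_iff_funcset)
      show "hm (0, x) = g2 x" if "x \<in> topspace (top_of_set S0)" for x
        using that g2(3)[of x] H1(1)[of x] by (cases "x \<in> F \<times> cube J") (simp_all add: hm_def S0_def)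
      show "hm (1, x) = g' x" if "x \<in> topspace (top_of_set S0)" for x
        using H1(2)[of x] by (cases "x \<in> F \<times> cube J") (simp_all add: hm_def g'_def)
    qed auto
    moreover have "closedin (top_of_set (E \<times> cube J)) S0"
      using clS FE by (intro closed_subset closed_Un) (auto simp: S0_def)
    \<comment> \<open>Homotopy extension replaces \<open>g2\<close> by a map over E that agrees with
      \<open>g1\<close> over F and still extends f, so that the two can be glued.\<close>
    ultimately obtain g3 where g3: "continuous_on (E \<times> cube J) g3" "g3 ` (E \<times> cube J) \<subseteq> rel_frontier T"
        "\<And>p. p \<in> S0 \<Longrightarrow> g3 p = g' p"
      using Borsuk_homotopy_extension_homotopic[of "E \<times> cube J" S0 "rel_frontier T" g2 g'] ANR_T g2
      by (metis image_subset_iff_funcset)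
    define g where "g p = (if p \<in> A' \<times> cube J then g1 p else g3 p)" for p
    have "continuous_on (A' \<times> cube J \<union> E \<times> cube J) g"
      unfolding g_def
    proof (rule continuous_on_cases)
      show "continuous_on (A' \<times> cube J) g1" by (rule continuous_on_subset[OF g1(1)]) (auto simp: A'_def)
      show "\<forall>p. p \<in> A' \<times> cube J \<and> p \<notin> A' \<times> cube J \<or> p \<in> E \<times> cube J \<and> p \<in> A' \<times> cube J \<longrightarrow> g1 p = g3 p"
        using g3(3) by (auto simp: S0_def g'_def F_def)
    qed (use compA' compE g3 in \<open>auto simp: closed_Times compact_cube compact_imp_closed\<close>)
    moreover have "(A \<union> E) \<times> cube J = A' \<times> cube J \<union> E \<times> cube J" using AE by blast
    moreover have "g ` (A' \<times> cube J \<union> E \<times> cube J) \<subseteq> rel_frontier T"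
      using g1(2) g3(2) by (fastforce simp: g_def A'_def)
    moreover have "g p = f p" if p: "p \<in> (A' \<times> cube J \<union> E \<times> cube J) \<inter> D" for p
    proof (cases "p \<in> A' \<times> cube J")
      case True
      then show ?thesis using p g1(3)[of p] by (auto simp: g_def A'_def)
    next
      case False
      then have "p \<in> S0" "p \<notin> F \<times> cube J" using p by (auto simp: S0_def F_def)
      then show ?thesis using False g3(3) by (simp add: g_def g'_def)
    qed
    ultimately show ?thesis unfolding ext_def E_def[symmetric] by auto
  qed
  obtain U where U: "\<And>x. x \<in> K \<Longrightarrow> open (U x) \<and> x \<in> U x \<and> ext (closure (K \<inter> U x)) \<and>
      top_of_set (closure (K \<inter> U x) - U x) dim_le (int k - 1)"
    using local by metis
  have "K \<subseteq> (\<Union>x\<in>K. U x)" using U by blast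
  then obtain I where I: "I \<subseteq> K" "finite I" "K \<subseteq> (\<Union>x\<in>I. U x)"
    using compactE_image[OF Suc.prems(1), of K U] U by metis
  have clK: "closure (K \<inter> U x) \<subseteq> K" for x
    using Suc.prems(1) by (simp add: closure_minimal compact_imp_closed)
  have compcl: "compact (closure (K \<inter> U x))" for x
    unfolding compact_closure using Suc.prems(1) compact_imp_bounded bounded_subset by blast
  have "ext (\<Union>x\<in>I. closure (K \<inter> U x))"
    using I(2,1)
  proof (induction I rule: finite_induct)
    case empty
    then show ?case by (auto simp: ext_def)
  next
    case (insert x I)
    have "compact (\<Union>x\<in>I. closure (K \<inter> U x))"
      using insert.hyps(1) compcl by (intro compact_UN) auto
    then have "ext ((\<Union>x\<in>I. closure (K \<inter> U x)) \<union> closure (K \<inter> U x))"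
      using insert U clK by (intro step) auto
    then show ?case by (simp add: Un_commute)
  qed
  moreover have "(\<Union>x\<in>I. closure (K \<inter> U x)) = K"
  proof
    show "(\<Union>x\<in>I. closure (K \<inter> U x)) \<subseteq> K" using clK by (intro UN_least)
    show "K \<subseteq> (\<Union>x\<in>I. closure (K \<inter> U x))"
    proof
      fix z assume "z \<in> K"
      then obtain x where "x \<in> I" "z \<in> K \<inter> U x" using I by blast
      then show "z \<in> (\<Union>x\<in>I. closure (K \<inter> U x))" using closure_subset[of "K \<inter> U x"] by (intro UN_I) auto
    qed
  qed
  ultimately have "ext K" by simp
  moreover have "D \<subseteq> K \<times> cube J" using Suc.prems bd_sub by (auto simp: D_def)
  ultimately show ?case unfolding ext_def D_def[symmetric] by blast
qed

text \<open>If the dimension were smaller, the identity of the relative frontier would extend to a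
  retraction g of the ball. A fixed point of -g would lie on the frontier, where g is the identity,
  hence be 0; this contradicts Brouwer's theorem.\<close>

lemma not_dim_le_cball:
  fixes T :: "'a::euclidean_space set"
  assumes "subspace T" "r > 0"
  shows "\<not> top_of_set (T \<inter> cball 0 r) dim_le (int (dim T) - 1)"
proof
  assume dimT: "top_of_set (T \<inter> cball 0 r) dim_le (int (dim T) - 1)"
  define K where "K = T \<inter> cball 0 r"
  have 0: "0 \<in> T" using assms by (simp add: subspace_0)
  have K: "compact K" "convex K" "bounded K" "closed K" "K \<noteq> {}"
    using assms 0 by (auto simp: K_def subspace_imp_convex closed_subspace intro!: convex_Int closed_Int_compact
        bounded_Int closed_Int)
  have affT: "affine T" using assms subspace_imp_affine by blast
  have ri: "rel_interior K = T \<inter> ball 0 r"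
  proof -
    have "rel_interior (T \<inter> cball 0 r) = rel_interior T \<inter> rel_interior (cball 0 r)"
      using 0 assms by (intro convex_rel_interior_inter_two)
        (auto simp: subspace_imp_convex rel_interior_affine[OF affT] rel_interior_nonempty_interior)
    then show ?thesis
      using assms by (simp add: K_def rel_interior_affine[OF affT] rel_interior_nonempty_interior)
  qed
  have "rel_frontier K = K - T \<inter> ball 0 r" using K(4) by (simp add: rel_frontier_def ri)
  moreover have "x \<in> K - T \<inter> ball 0 r \<longleftrightarrow> x \<in> T \<inter> sphere 0 r" for x
    unfolding K_def Diff_iff Int_iff mem_ball_0 mem_cball_0 mem_sphere_0 by (cases "x \<in> T") linarith+
  ultimately have rf: "rel_frontier K = T \<inter> sphere 0 r" by blast
  have affK: "aff_dim K = int (dim T)"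
  proof -
    have "T \<inter> ball 0 r \<subseteq> K" by (auto simp: K_def)
    moreover have "aff_dim (T \<inter> ball 0 r) = aff_dim T"
      using 0 assms by (intro aff_dim_convex_Int_open subspace_imp_convex) auto
    ultimately show ?thesis
      using aff_dim_subset[of K T] aff_dim_subset[of "T \<inter> ball 0 r" K] assms
      by (simp add: aff_dim_subspace K_def)
  qed
  have cube0: "cube_bd {} = ({} :: 'a set)" "cube {} = {0 :: 'a}"
    by (auto simp: cube_bd_def cube_def)
  have rfK: "rel_frontier K \<subseteq> K" unfolding rf by (auto simp: K_def)
  have "closed (rel_frontier K)"
    unfolding rf using assms by (simp add: closed_Int closed_subspace)
  moreover note affK
  moreover have "top_of_set K dim_le (int (dim T) - 1)" using dimT by (simp add: K_def)
  moreover have "int (dim T) \<le> int DIM('a)" using dim_subset_UNIV[of T] by simp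
  \<comment> \<open>With \<open>J = {}\<close> the second factor is the point 0 and serves as a
    dummy; the prescribed map is the identity on the frontier, written \<open>fst\<close>.\<close>
  ultimately have "\<exists>g. continuous_on (K \<times> cube {}) g \<and> g ` (K \<times> cube {}) \<subseteq> rel_frontier K \<and>
           (\<forall>p\<in>K \<times> cube_bd {} \<union> rel_frontier K \<times> cube ({} :: 'a set). g p = fst p)"
    using K rfK by (intro extend_map_cube_product[where k = "dim T"])
      (auto simp: cube0 continuous_on_fst)
  then obtain g where g: "continuous_on (K \<times> {0::'a}) g" "g ` (K \<times> {0::'a}) \<subseteq> rel_frontier K"
     "\<And>p. p \<in> rel_frontier K \<times> {0::'a} \<Longrightarrow> g p = fst p"
    unfolding cube0 by blast
  define h where "h x = - g (x, 0)" for x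
  have "continuous_on K h"
    unfolding h_def by (intro continuous_intros continuous_on_compose2[OF g(1)]) auto
  moreover have rfh: "h x \<in> rel_frontier K" if "x \<in> K" for x
    using g(2) that assms unfolding rf h_def by (auto simp: subspace_neg dist_norm image_subset_iff)
  ultimately obtain x where x: "x \<in> K" "h x = x"
    using brouwer[of K h] K rfK by blast
  then have "g (x, 0) = x" using rfh[of x] g(3)[of "(x, 0)"] by auto
  then have "2 *\<^sub>R x = 0" using x unfolding h_def by (metis add.right_inverse scaleR_2)
  then have "x = 0" by simp
  then show False using rfh[of x] x assms by (simp add: rf)
qed

section \<open>The matrix exponential\<close>

definition mpow :: "real^'n^'n \<Rightarrow> nat \<Rightarrow> real^'n^'n" where
  "mpow A k = ((**) A ^^ k) (mat 1)"

lemma mpow_0 [simp]: "mpow A 0 = mat 1" and mpow_Suc: "mpow A (Suc k) = A ** mpow A k"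
  by (simp_all add: mpow_def)

lemma mpow_Suc2: "mpow A (Suc k) = mpow A k ** A"
  by (induction k) (simp_all add: mpow_Suc matrix_mul_assoc)

lemma mpow_scaleR: "mpow (t *\<^sub>R A) k = t ^ k *\<^sub>R mpow A k"
proof (induction k)
  case (Suc k)
  then show ?case
    by (simp add: mpow_Suc matrix_matrix_mult_def vec_eq_iff sum_distrib_left algebra_simps)
qed simp

text \<open>Dominates every row sum of absolute values, so that the entries of the k-th power are at
  most the k-th power of this number.\<close>

definition msum :: "real^'n^'n \<Rightarrow> real" where
  "msum A = (\<Sum>i\<in>UNIV. \<Sum>j\<in>UNIV. \<bar>A $ i $ j\<bar>)"

lemma mpow_bound: "\<bar>mpow A k $ i $ j\<bar> \<le> msum A ^ k"
proof (induction k arbitrary: i)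
  case (Suc k)
  have "\<bar>mpow A (Suc k) $ i $ j\<bar> \<le> (\<Sum>l\<in>UNIV. \<bar>A $ i $ l\<bar> * \<bar>mpow A k $ l $ j\<bar>)"
    unfolding abs_mult[symmetric] by (simp add: mpow_Suc matrix_matrix_mult_def sum_abs)
  also have "\<dots> \<le> (\<Sum>l\<in>UNIV. \<bar>A $ i $ l\<bar> * msum A ^ k)"
    by (intro sum_mono mult_left_mono Suc.IH) auto
  also have "\<dots> = (\<Sum>l\<in>UNIV. \<bar>A $ i $ l\<bar>) * msum A ^ k" by (simp add: sum_distrib_right)
  also have "\<dots> \<le> msum A * msum A ^ k"
    unfolding msum_def
    by (intro mult_right_mono member_le_sum zero_le_power sum_nonneg) auto
  finally show ?case by simp
qed (simp add: mat_def)

lemma norm_matrix_le_entries: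
  fixes A :: "real^'n^'m"
  assumes "\<And>i j. \<bar>A $ i $ j\<bar> \<le> c"
  shows "norm A \<le> real CARD('m) * (real CARD('n) * c)"
proof -
  have "norm A \<le> (\<Sum>i\<in>UNIV. norm (A $ i))" by (simp add: norm_vec_def L2_set_le_sum)
  also have "\<dots> \<le> (\<Sum>i\<in>UNIV. \<Sum>j\<in>UNIV. \<bar>A $ i $ j\<bar>)"
    by (intro sum_mono norm_le_l1_cart)
  also have "\<dots> \<le> (\<Sum>i\<in>(UNIV::'m set). \<Sum>j\<in>(UNIV::'n set). c)"
    by (intro sum_mono assms)
  finally show ?thesis by simp
qed

lemma summable_mat_exp:
  fixes A :: "real^'n^'n"
  shows "summable (\<lambda>k. (1 / fact k) *\<^sub>R mpow A k)"
proof (rule summable_comparison_test')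
  define N where "N = real CARD('n)"
  have "summable (\<lambda>k. N * (N * (inverse (fact k) *\<^sub>R (msum A ^ k))))"
    by (intro summable_mult summable_exp_generic)
  then show "summable (\<lambda>k. N * (N * (1 / fact k * msum A ^ k)))"
    by (simp add: field_simps)
  show "norm ((1 / fact k) *\<^sub>R mpow A k) \<le> N * (N * (1 / fact k * msum A ^ k))" for k
  proof -
    have "\<bar>((1 / fact k) *\<^sub>R mpow A k) $ i $ j\<bar> \<le> 1 / fact k * msum A ^ k" for i j
    proof -
      have "\<bar>((1 / fact k) *\<^sub>R mpow A k) $ i $ j\<bar> = 1 / fact k * \<bar>mpow A k $ i $ j\<bar>"
        by (simp add: abs_mult)
      also have "\<dots> \<le> 1 / fact k * msum A ^ k"
        by (intro mult_left_mono mpow_bound) simp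
      finally show ?thesis .
    qed
    then show ?thesis unfolding N_def by (rule norm_matrix_le_entries)
  qed
qed

lemma mat_exp_sums: "(\<lambda>k. (1 / fact k) *\<^sub>R mpow A k) sums mat_exp A"
  using summable_mat_exp[of A] by (simp add: mat_exp_def mpow_def summable_sums)

lemma mat_exp_entry_sums:
  fixes A :: "real^'n^'n"
  shows "(\<lambda>k. (mpow A k $ i $ j / fact k) * t ^ k) sums (mat_exp (t *\<^sub>R A) $ i $ j)"
proof -
  have "bounded_linear (\<lambda>X :: real^'n^'n. X $ i $ j)"
    by (intro bounded_linear_compose[OF bounded_linear_vec_nth bounded_linear_vec_nth])
  from bounded_linear.sums[OF this mat_exp_sums[of "t *\<^sub>R A"]]
  show ?thesis by (simp add: mpow_scaleR mult_ac)
qed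

text \<open>The entries are everywhere convergent power series in t and are differentiated termwise.
  Factoring A out of the next power on the left or on the right gives the two forms.\<close>

lemma mat_exp_entry_deriv:
  fixes A :: "real^'n^'n"
  shows "((\<lambda>t. mat_exp (t *\<^sub>R A) $ i $ j) has_real_derivative (A ** mat_exp (t *\<^sub>R A)) $ i $ j) (at t)" (is ?A)
  "((\<lambda>t. mat_exp (t *\<^sub>R A) $ i $ j) has_real_derivative (mat_exp (t *\<^sub>R A) ** A) $ i $ j) (at t)" (is ?B)
proof -
  define c where "c k = mpow A k $ i $ j / fact k" for k
  have E: "(\<lambda>t. mat_exp (t *\<^sub>R A) $ i $ j) = (\<lambda>t. \<Sum>k. c k * t ^ k)"
    using mat_exp_entry_sums[of A i j] by (auto simp: c_def sums_iff)
  have "summable (\<lambda>k. c k * y ^ k)" for y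
    using mat_exp_entry_sums[of A i j y] by (auto simp: c_def sums_iff)
  then have D: "((\<lambda>t. mat_exp (t *\<^sub>R A) $ i $ j) has_real_derivative (\<Sum>k. diffs c k * t ^ k)) (at t)"
    unfolding E by (rule termdiffs_strong_converges_everywhere)
  have c': "diffs c k = mpow A (Suc k) $ i $ j / fact k" for k
    by (simp add: diffs_def c_def fact_Suc del: of_nat_Suc)
  have "(\<lambda>k. \<Sum>l\<in>UNIV. A $ i $ l * ((mpow A k $ l $ j / fact k) * t ^ k)) sums
      (\<Sum>l\<in>UNIV. A $ i $ l * mat_exp (t *\<^sub>R A) $ l $ j)"
    by (intro sums_sum sums_mult mat_exp_entry_sums)
  then have "(\<lambda>k. diffs c k * t ^ k) sums ((A ** mat_exp (t *\<^sub>R A)) $ i $ j)"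
    by (simp add: c' mpow_Suc matrix_matrix_mult_def sum_divide_distrib sum_distrib_right mult.assoc)
  with D show ?A by (simp add: sums_iff)
  have "(\<lambda>k. \<Sum>l\<in>UNIV. ((mpow A k $ i $ l / fact k) * t ^ k) * A $ l $ j) sums
      (\<Sum>l\<in>UNIV. mat_exp (t *\<^sub>R A) $ i $ l * A $ l $ j)"
    by (intro sums_sum sums_mult2 mat_exp_entry_sums)
  then have "(\<lambda>k. diffs c k * t ^ k) sums ((mat_exp (t *\<^sub>R A) ** A) $ i $ j)"
    by (simp add: c' mpow_Suc2 matrix_matrix_mult_def sum_divide_distrib sum_distrib_right sum_distrib_left mult_ac)
  with D show ?B by (simp add: sums_iff)
qed

lemma has_vector_derivative_cart:
  fixes f :: "real \<Rightarrow> real^'n"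
  assumes "\<And>i. ((\<lambda>t. f t $ i) has_real_derivative f' $ i) (at t)"
  shows "(f has_vector_derivative f') (at t)"
  unfolding has_vector_derivative_def
  by (subst has_derivative_componentwise_within)
    (use assms in \<open>auto simp: Basis_vec_def inner_axis has_field_derivative_def mult_commute_abs\<close>)

definition flow :: "real^'n^'n \<Rightarrow> real \<Rightarrow> real^'n \<Rightarrow> real^'n" where
  "flow A t x = mat_exp (t *\<^sub>R A) *v x"

lemma linear_flow: "linear (flow A t)"
  unfolding flow_def by (rule matrix_vector_mul_linear)

lemmas flow_linear_simps = linear_add[OF linear_flow] linear_diff[OF linear_flow]
  linear_neg[OF linear_flow] linear_0[OF linear_flow] linear_scale[OF linear_flow]

lemma mat_exp_0 [simp]: "mat_exp (0 :: real^'n^'n) = mat 1"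
proof -
  have "(\<lambda>k. (1 / fact k) *\<^sub>R mpow (0 *\<^sub>R 0 :: real^'n^'n) k) sums mat 1"
    unfolding mpow_scaleR using sums_single[of 0 "\<lambda>_. mat 1 :: real^'n^'n"]
    by (rule sums_cong[THEN iffD1, rotated]) auto
  from sums_unique2[OF this mat_exp_sums] show ?thesis by simp
qed

lemma flow_0 [simp]: "flow A 0 x = x"
  by (simp add: flow_def)

lemma mat_exp_vec_deriv:
  assumes "(x has_vector_derivative x') (at t)"
  shows "((\<lambda>t. mat_exp (t *\<^sub>R A) *v x t) has_vector_derivative
    (mat_exp (t *\<^sub>R A) *v (A *v x t) + mat_exp (t *\<^sub>R A) *v x')) (at t)"
proof (rule has_vector_derivative_cart)
  fix i
  have x: "((\<lambda>t. x t $ j) has_real_derivative x' $ j) (at t)" for j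
    using bounded_linear.has_vector_derivative[OF bounded_linear_vec_nth[of j] assms]
    by (simp add: has_real_derivative_iff_has_vector_derivative)
  have "((\<lambda>t. \<Sum>j\<in>UNIV. mat_exp (t *\<^sub>R A) $ i $ j * x t $ j) has_real_derivative
      (\<Sum>j\<in>UNIV. (mat_exp (t *\<^sub>R A) ** A) $ i $ j * x t $ j + x' $ j * mat_exp (t *\<^sub>R A) $ i $ j)) (at t)"
    by (intro DERIV_sum DERIV_mult mat_exp_entry_deriv x)
  then show "((\<lambda>t. (mat_exp (t *\<^sub>R A) *v x t) $ i) has_real_derivative
     (mat_exp (t *\<^sub>R A) *v (A *v x t) + mat_exp (t *\<^sub>R A) *v x') $ i) (at t)"
    unfolding matrix_vector_mul_assoc
    by (simp add: matrix_vector_mult_def sum.distrib mult.commute)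
qed

lemma flow_deriv: "((\<lambda>t. flow A t x) has_vector_derivative A *v flow A t x) (at t)"
  "((\<lambda>t. flow A t x) has_vector_derivative flow A t (A *v x)) (at t)"
proof -
  show 1: "((\<lambda>t. flow A t x) has_vector_derivative A *v flow A t x) (at t)"
  proof (rule has_vector_derivative_cart)
    fix i
    have "((\<lambda>t. \<Sum>j\<in>UNIV. mat_exp (t *\<^sub>R A) $ i $ j * x $ j) has_real_derivative
        (\<Sum>j\<in>UNIV. (A ** mat_exp (t *\<^sub>R A)) $ i $ j * x $ j)) (at t)"
      by (intro DERIV_sum DERIV_cmult_right mat_exp_entry_deriv)
    then show "((\<lambda>t. flow A t x $ i) has_real_derivative (A *v flow A t x) $ i) (at t)"
      unfolding matrix_vector_mul_assoc flow_def by (simp add: matrix_vector_mult_def)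
  qed
  show "((\<lambda>t. flow A t x) has_vector_derivative flow A t (A *v x)) (at t)"
    using mat_exp_vec_deriv[of "\<lambda>_. x" 0 t A] by (simp add: flow_def)
qed

text \<open>Both sides are the derivative of the same curve.\<close>

lemma flow_commute: "A *v flow A t x = flow A t (A *v x)"
  using flow_deriv by (rule vector_derivative_unique_at)

lemma has_vector_derivative_uminus: "(uminus has_vector_derivative - 1) (at (t::real))"
  unfolding has_real_derivative_iff_has_vector_derivative[symmetric]
  by (auto intro!: derivative_eq_intros)

lemma has_vector_derivative_shift: "((\<lambda>s. s + c) has_vector_derivative 1) (at (t::real))"
  unfolding has_real_derivative_iff_has_vector_derivative[symmetric]
  by (auto intro!: derivative_eq_intros)

text \<open>The curve e^{-tA} x(t) has derivative zero. Since the product rule is stated for e^{tA},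
  it is applied at -t to the time-reversed solution.\<close>

lemma flow_inverse_solution:
  assumes x: "\<And>t. (x has_vector_derivative A *v x t) (at t)"
  shows "flow A (- t) (x t) = x 0"
proof -
  have "((\<lambda>t. flow A (- t) (x t)) has_vector_derivative 0) (at t)" for t
  proof -
    have "((\<lambda>t. x (- t)) has_vector_derivative - (A *v x t)) (at (- t))"
      using vector_diff_chain_at[OF has_vector_derivative_uminus x, of "- t"] by (simp add: o_def)
    from mat_exp_vec_deriv[OF this, of A]
    have "((\<lambda>s. flow A s (x (- s))) has_vector_derivative 0) (at (- t))"
      by (simp add: flow_def linear_neg[OF matrix_vector_mul_linear])
    from vector_diff_chain_at[OF has_vector_derivative_uminus this] show ?thesis
      by (simp add: o_def)
  qed
  then obtain c where c: "\<And>s. s \<in> UNIV \<Longrightarrow> flow A (- s) (x s) = c"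
    by (rule has_vector_derivative_zero_constant[OF convex_UNIV]) blast
  show ?thesis using c[of t] c[of 0] by simp
qed

text \<open>The preceding fact, used for x and for the orbit of x(t), shows that e^{tA} inverts
  e^{-tA}. The group law is then a consequence of uniqueness.\<close>

lemma flow_unique:
  assumes "\<And>t. (x has_vector_derivative A *v x t) (at t)"
  shows "x t = flow A t (x 0)"
proof -
  have 1: "flow A (- t) (x t) = x 0" by (rule flow_inverse_solution[OF assms])
  have "flow A t (flow A (- t) (x t)) = x t"
    using flow_inverse_solution[of "\<lambda>s. flow A s (x t)" A "- t", OF flow_deriv(1)] by simp
  then show ?thesis by (simp add: 1)
qed

lemma flow_add: "flow A (s + t) x = flow A s (flow A t x)"
proof -
  have "((\<lambda>s. flow A (s + t) x) has_vector_derivative A *v flow A (s + t) x) (at s)" for s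
    using vector_diff_chain_at[OF has_vector_derivative_shift flow_deriv(1)] by (simp add: o_def)
  from flow_unique[of "\<lambda>s. flow A (s + t) x", OF this] show ?thesis by simp
qed

lemma flow_minus [simp]: "flow A (- t) (flow A t x) = x" "flow A t (flow A (- t) x) = x"
  using flow_add[of A "- t" t x] flow_add[of A t "- t" x] by simp_all

lemma flow_eq_0_iff [simp]: "flow A t x = 0 \<longleftrightarrow> x = 0"
  by (metis flow_minus(1) linear_0 linear_flow)

lemma continuous_on_flow [continuous_intros]:
  assumes "continuous_on S f" "continuous_on S g"
  shows "continuous_on S (\<lambda>p. flow A (f p) (g p))"
proof -
  have "continuous_on UNIV (\<lambda>t. mat_exp (t *\<^sub>R A) $ i $ j)" for i j
    by (rule DERIV_continuous_on[OF has_field_derivative_at_within[OF mat_exp_entry_deriv(1)]])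
  from continuous_on_compose2[OF this assms(1)]
  have "continuous_on S (\<lambda>p. mat_exp (f p *\<^sub>R A) $ i $ j)" for i j by simp
  moreover have "continuous_on S (\<lambda>p. g p $ j)" for j using assms(2) by (intro continuous_intros)
  ultimately show ?thesis
    unfolding flow_def matrix_vector_mult_def
    by (intro continuous_on_vec_lambda continuous_on_sum continuous_on_mult)
qed

text \<open>The partial sums of the exponential series stay in S, and a subspace is closed.\<close>

lemma subspace_flow:
  fixes A :: "real^'n^'n"
  assumes "subspace S" "\<And>x. x \<in> S \<Longrightarrow> A *v x \<in> S" "x \<in> S"
  shows "flow A t x \<in> S"
proof -
  have mp: "mpow A k *v x \<in> S" for k
    using assms by (induction k) (simp_all add: mpow_Suc matrix_vector_mul_assoc[symmetric])
  have lin: "bounded_linear (\<lambda>X :: real^'n^'n. X *v x)"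
    by (intro linear_conv_bounded_linear[THEN iffD1] linearI)
      (simp_all add: matrix_vector_mult_add_rdistrib scaleR_matrix_vector_assoc)
  have lim: "(\<lambda>n. \<Sum>k<n. ((1 / fact k) *\<^sub>R mpow (t *\<^sub>R A) k) *v x) \<longlonglongrightarrow> flow A t x"
    using bounded_linear.sums[OF lin mat_exp_sums[of "t *\<^sub>R A"]] by (simp add: sums_def flow_def)
  have inS: "(\<Sum>k<n. ((1 / fact k) *\<^sub>R mpow (t *\<^sub>R A) k) *v x) \<in> S" for n
    using assms(1) mp
    by (intro subspace_sum) (simp_all add: mpow_scaleR scaleR_matrix_vector_assoc[symmetric] subspace_scale)
  show ?thesis
    by (rule closed_sequentially[OF closed_subspace[OF assms(1)] inS lim])
qed

section \<open>Generalized eigenspaces\<close>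

context
  fixes C :: "complex^'n^'n"
begin

definition eig_op :: "complex \<Rightarrow> complex^'n \<Rightarrow> complex^'n" where
  "eig_op \<mu> w = C *v w - \<mu> *s w"

text \<open>The union of the increasing kernels of the powers. It is \<open>{0}\<close> unless \<mu>
  is an eigenvalue, so unions may run over all complex numbers.\<close>

definition gev :: "complex \<Rightarrow> (complex^'n) set" where
  "gev \<mu> = {z. \<exists>k. (eig_op \<mu> ^^ k) z = 0}"

lemma eig_op_simps:
  "eig_op \<mu> (x + y) = eig_op \<mu> x + eig_op \<mu> y" "eig_op \<mu> (x - y) = eig_op \<mu> x - eig_op \<mu> y"
  "eig_op \<mu> (c *s x) = c *s eig_op \<mu> x" "eig_op \<mu> (a *\<^sub>R x) = a *\<^sub>R eig_op \<mu> x"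
  "eig_op \<mu> 0 = 0"
  by (simp_all add: eig_op_def vec_eq_iff matrix_vector_mult_def algebra_simps sum_distrib_left
      sum.distrib sum_subtractf scaleR_sum_right scaleR_diff_right)

lemma eig_op_pow_simps:
  "(eig_op \<mu> ^^ k) (x + y) = (eig_op \<mu> ^^ k) x + (eig_op \<mu> ^^ k) y"
  "(eig_op \<mu> ^^ k) (x - y) = (eig_op \<mu> ^^ k) x - (eig_op \<mu> ^^ k) y"
  "(eig_op \<mu> ^^ k) (c *s x) = c *s (eig_op \<mu> ^^ k) x"
  "(eig_op \<mu> ^^ k) (a *\<^sub>R x) = a *\<^sub>R (eig_op \<mu> ^^ k) x" "(eig_op \<mu> ^^ k) 0 = 0"
  by (induction k) (simp_all add: eig_op_simps)

lemma eig_op_pow_mono: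
  assumes "(eig_op \<mu> ^^ k) z = 0" "k \<le> m"
  shows "(eig_op \<mu> ^^ m) z = 0"
proof -
  obtain d where m: "m = d + k" using assms(2) by (metis add.commute le_Suc_ex)
  show ?thesis by (simp add: m funpow_add assms eig_op_pow_simps)
qed

lemma gev_add: "x \<in> gev \<mu> \<Longrightarrow> y \<in> gev \<mu> \<Longrightarrow> x + y \<in> gev \<mu>"
proof -
  assume "x \<in> gev \<mu>" "y \<in> gev \<mu>"
  then obtain j k where "(eig_op \<mu> ^^ j) x = 0" "(eig_op \<mu> ^^ k) y = 0" by (auto simp: gev_def)
  then have "(eig_op \<mu> ^^ max j k) (x + y) = 0"
    using eig_op_pow_mono[where \<mu> = \<mu> and k = j and z = x and m = "max j k"]
      eig_op_pow_mono[where \<mu> = \<mu> and k = k and z = y and m = "max j k"]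
    by (simp add: eig_op_pow_simps)
  then show ?thesis by (auto simp: gev_def)
qed

lemma gev_scale: "x \<in> gev \<mu> \<Longrightarrow> c *s x \<in> gev \<mu>" "x \<in> gev \<mu> \<Longrightarrow> a *\<^sub>R x \<in> gev \<mu>"
  by (auto simp: gev_def eig_op_pow_simps)

lemma gev_0: "0 \<in> gev \<mu>"
  by (auto simp: gev_def eig_op_pow_simps)

lemma gev_diff: "x \<in> gev \<mu> \<Longrightarrow> y \<in> gev \<mu> \<Longrightarrow> x - y \<in> gev \<mu>"
  using gev_add[of x \<mu> "(- 1) *\<^sub>R y"] gev_scale(2)[of y \<mu> "- 1"] by simp

lemma gev_eig_op: "eig_op \<mu> z \<in> gev \<mu> \<Longrightarrow> z \<in> gev \<mu>" "z \<in> gev \<mu> \<Longrightarrow> eig_op \<mu> z \<in> gev \<mu>"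
proof -
  show "z \<in> gev \<mu>" if asm: "eig_op \<mu> z \<in> gev \<mu>"
  proof -
    obtain k where "(eig_op \<mu> ^^ k) (eig_op \<mu> z) = 0" using asm by (auto simp: gev_def)
    then have "(eig_op \<mu> ^^ Suc k) z = 0" by (simp only: funpow_Suc_right o_apply)
    then show ?thesis unfolding gev_def by blast
  qed
  assume "z \<in> gev \<mu>"
  then obtain k where "(eig_op \<mu> ^^ k) z = 0" by (auto simp: gev_def)
  then have "(eig_op \<mu> ^^ k) (eig_op \<mu> z) = 0" by (simp add: funpow_swap1[symmetric] eig_op_simps)
  then show "eig_op \<mu> z \<in> gev \<mu>" by (auto simp: gev_def)
qed

lemma gev_mult: "z \<in> gev \<mu> \<Longrightarrow> C *v z \<in> gev \<mu>"
proof -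
  assume z: "z \<in> gev \<mu>"
  have "C *v z = eig_op \<mu> z + \<mu> *s z" by (simp add: eig_op_def)
  then show ?thesis using z gev_eig_op(2) gev_scale(1) gev_add by metis
qed

text \<open>Induction on the order of nilpotency: if v solves (C - \<mu>) v = (C - \<nu>) w, then (C
  - \<mu>)(v - w) = (\<mu> - \<nu>) w.\<close>

lemma eig_op_surj_gev:
  assumes "\<mu> \<noteq> \<nu>" "w \<in> gev \<nu>"
  shows "\<exists>v\<in>gev \<nu>. eig_op \<mu> v = w"
proof -
  obtain k where "(eig_op \<nu> ^^ k) w = 0" using assms by (auto simp: gev_def)
  then show ?thesis using assms(2)
  proof (induction k arbitrary: w)
    case 0
    then show ?case by (auto intro!: bexI[of _ 0] simp: gev_0 eig_op_simps)
  next
    case (Suc k)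
    then have "(eig_op \<nu> ^^ k) (eig_op \<nu> w) = 0" by (simp add: funpow_swap1[symmetric])
    then obtain v where v: "v \<in> gev \<nu>" "eig_op \<mu> v = eig_op \<nu> w"
      using Suc.IH Suc.prems gev_eig_op(2) by blast
    have "eig_op \<nu> w = eig_op \<mu> w + (\<mu> - \<nu>) *s w"
      by (simp add: eig_op_def vec_eq_iff algebra_simps)
    then have "eig_op \<mu> (inverse (\<mu> - \<nu>) *s (v - w)) = inverse (\<mu> - \<nu>) *s ((\<mu> - \<nu>) *s w)"
      using v by (simp add: eig_op_simps)
    also have "\<dots> = w" using assms(1) unfolding vector_smult_assoc by simp
    finally show ?case using gev_scale(1)[OF gev_diff[OF v(1) Suc.prems(2)]] by blast
  qed
qed

text \<open>In a decomposition of (C - \<mu>) z, the parts from the other eigenvalues have preimages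
  under C - \<mu> in their own spaces. Subtracting these from z leaves a vector that C - \<mu> maps
  into \<open>gev \<mu>\<close>, hence an element of \<open>gev \<mu>\<close>.\<close>

lemma span_gev_eig_op:
  assumes "eig_op \<mu> z \<in> span (\<Union>\<nu>. gev \<nu>)"
  shows "z \<in> span (\<Union>\<nu>. gev \<nu>)"
proof -
  have "\<exists>v\<in>span (\<Union>\<nu>. gev \<nu>). \<exists>w'\<in>gev \<mu>. eig_op \<mu> z = eig_op \<mu> v + w'"
    using assms
  proof (induction rule: span_induct_alt)
    case base
    then show ?case by (auto intro!: bexI[of _ 0] simp: gev_0 eig_op_simps span_0)
  next
    case (step c x y)
    then obtain v w' where 1: "v \<in> span (\<Union>\<nu>. gev \<nu>)" "w' \<in> gev \<mu>" "y = eig_op \<mu> v + w'" by blast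
    obtain \<nu> where \<nu>: "x \<in> gev \<nu>" using step by auto
    show ?case
    proof (cases "\<nu> = \<mu>")
      case True
      then show ?thesis using 1 \<nu>
        by (intro bexI[of _ v] bexI[of _ "c *\<^sub>R x + w'"]) (auto intro: gev_add gev_scale)
    next
      case False
      then obtain u where u: "u \<in> gev \<nu>" "eig_op \<mu> u = x" using eig_op_surj_gev \<nu> by metis
      then show ?thesis using 1
        by (intro bexI[of _ "c *\<^sub>R u + v"] bexI[of _ w'])
          (auto simp: eig_op_simps intro!: span_add span_scale intro: span_base)
    qed
  qed
  then obtain v w' where v: "v \<in> span (\<Union>\<nu>. gev \<nu>)" "w' \<in> gev \<mu>" "eig_op \<mu> z = eig_op \<mu> v + w'"
    by blast
  have "eig_op \<mu> (z - v) \<in> gev \<mu>" using v(2,3) by (simp add: eig_op_simps)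
  then have "z - v \<in> gev \<mu>" by (rule gev_eig_op(1))
  then have "(z - v) + v \<in> span (\<Union>\<nu>. gev \<nu>)" using v(1) by (intro span_add) (auto intro: span_base)
  then show ?thesis by simp
qed

text \<open>The value p(C) z, summed up to an explicit bound n; any bound not below the degree gives
  the same vector, which makes it easy to follow degrees when factors are split off.\<close>

definition poly_op :: "nat \<Rightarrow> complex poly \<Rightarrow> complex^'n \<Rightarrow> complex^'n" where
  "poly_op n p z = (\<Sum>i\<le>n. coeff p i *s (((*v) C ^^ i) z))"

lemma pow_mult_simps:
  "((*v) C ^^ i) (x - y) = ((*v) C ^^ i) x - ((*v) C ^^ i) y"
  "((*v) C ^^ i) (c *s x) = c *s ((*v) C ^^ i) x"
proof (induction i)
  case (Suc i)
  {
    case 1 show ?case by (simp add: Suc.IH matrix_vector_mult_diff_distrib)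
  next
    case 2 show ?case
      by (simp add: Suc.IH vector_scalar_commute)
  }
qed simp_all

lemma poly_op_root_factor:
  assumes "degree q \<le> n"
  shows "poly_op (Suc n) ([:- \<mu>, 1:] * q) z = poly_op n q (eig_op \<mu> z)"
proof -
  have q0: "coeff q (Suc n) = 0" using assms by (simp add: coeff_eq_0)
  have "[:- \<mu>, 1:] * q = pCons 0 q - smult \<mu> q" by simp
  then have "poly_op (Suc n) ([:- \<mu>, 1:] * q) z =
      (\<Sum>i\<le>Suc n. coeff (pCons 0 q) i *s ((*v) C ^^ i) z) - (\<Sum>i\<le>Suc n. (\<mu> * coeff q i) *s ((*v) C ^^ i) z)"
    by (simp only: poly_op_def coeff_diff coeff_smult vector_sub_rdistrib sum_subtractf)
  also have "(\<Sum>i\<le>Suc n. coeff (pCons 0 q) i *s ((*v) C ^^ i) z) = (\<Sum>i\<le>n. coeff q i *s ((*v) C ^^ i) (C *v z))"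
    by (subst sum.atMost_Suc_shift) (simp add: funpow_swap1)
  also have "(\<Sum>i\<le>Suc n. (\<mu> * coeff q i) *s ((*v) C ^^ i) z) = (\<Sum>i\<le>n. coeff q i *s ((*v) C ^^ i) (\<mu> *s z))"
    by (simp add: q0 pow_mult_simps vector_smult_assoc mult.commute)
  finally show ?thesis
    by (simp add: poly_op_def eig_op_def pow_mult_simps vector_ssub_ldistrib sum_subtractf)
qed

lemma poly_op_roots:
  "poly_op (size M) (smult a (\<Prod>x\<in>#M. [:- x, 1:])) z = 0 \<Longrightarrow> a \<noteq> 0 \<Longrightarrow> z \<in> span (\<Union>\<nu>. gev \<nu>)"
proof (induction M arbitrary: z)
  case empty
  then have "a *s z = 0" by (simp add: poly_op_def)
  then have "z = 0" using empty by simp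
  then show ?case by (simp add: span_0)
next
  case (add \<mu> M)
  have deg: "degree (smult a (\<Prod>x\<in>#M. [:- x, 1:])) \<le> size M"
  proof (induction M)
    case (add x M)
    have "degree ([:- x, 1:] * smult a (\<Prod>x\<in>#M. [:- x, 1:])) \<le> 1 + size M"
      using degree_mult_le[of "[:- x, 1:]" "smult a (\<Prod>x\<in>#M. [:- x, 1:])"] add by auto
    then show ?case by (simp only: image_mset_add_mset prod_mset.add_mset size_add_mset mult_smult_right)
  qed simp
  have "smult a (\<Prod>x\<in>#add_mset \<mu> M. [:- x, 1:]) = [:- \<mu>, 1:] * smult a (\<Prod>x\<in>#M. [:- x, 1:])"
    by (simp only: image_mset_add_mset prod_mset.add_mset mult_smult_right)
  then have "poly_op (size M) (smult a (\<Prod>x\<in>#M. [:- x, 1:])) (eig_op \<mu> z) = 0"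
    using add.prems(1) poly_op_root_factor[OF deg, of \<mu> z] by simp
  then show ?case using add.IH add.prems(2) span_gev_eig_op by blast
qed

text \<open>The iterates z, Cz, ..., C^d z are linearly dependent over the reals when d is the real
  dimension of the space, so a polynomial with real coefficients suffices.\<close>

lemma ex_annihilating_poly: "\<exists>n p. p \<noteq> 0 \<and> degree p \<le> n \<and> poly_op n p z = 0"
proof -
  define d where "d = DIM(complex^'n)"
  define f where "f i = ((*v) C ^^ i) z" for i
  have "\<exists>c::nat \<Rightarrow> real. (\<exists>i\<le>d. c i \<noteq> 0) \<and> (\<Sum>i\<le>d. c i *\<^sub>R f i) = 0"
  \<comment> \<open>\<open>dependent\<close> speaks of sets, so a repetition among the iterates
    needs a relation of its own.\<close>
  proof (cases "inj_on f {..d}")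
    case False
    then obtain i j where ij: "i \<le> d" "j \<le> d" "i \<noteq> j" "f i = f j" by (auto simp: inj_on_def)
    define c where "c k = (if k = i then 1 else if k = j then - 1 else 0 :: real)" for k
    have "(\<Sum>k\<le>d. c k *\<^sub>R f k) = (\<Sum>k\<in>{i, j}. c k *\<^sub>R f k)"
      using ij by (intro sum.mono_neutral_right) (auto simp: c_def)
    also have "\<dots> = 0" using ij by (simp add: c_def)
    finally show ?thesis using ij by (intro exI[of _ c]) (auto simp: c_def)
  next
    case True
    have "dependent (f ` {..d})"
    proof (rule ccontr)
      assume "independent (f ` {..d})"
      then have "card (f ` {..d}) \<le> d" unfolding d_def using independent_bound by blast
      then show False using True by (simp add: card_image)
    qed
    then obtain X u v where X: "finite X" "X \<subseteq> f ` {..d}" "(\<Sum>x\<in>X. u x *\<^sub>R x) = 0" "v \<in> X" "u v \<noteq> 0"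
      unfolding dependent_explicit by blast
    define c where "c i = (if f i \<in> X then u (f i) else 0)" for i
    have "(\<Sum>i\<le>d. c i *\<^sub>R f i) = (\<Sum>x\<in>f ` {..d}. (if x \<in> X then u x else 0) *\<^sub>R x)"
      using True by (simp add: sum.reindex c_def)
    also have "\<dots> = (\<Sum>x\<in>X. u x *\<^sub>R x)"
      using X by (intro sum.mono_neutral_cong_right) auto
    finally show ?thesis using X by (intro exI[of _ c]) (auto simp: c_def)
  qed
  then obtain c :: "nat \<Rightarrow> real" and i0 where c: "i0 \<le> d" "c i0 \<noteq> 0" "(\<Sum>i\<le>d. c i *\<^sub>R f i) = 0" by blast
  define p where "p = (\<Sum>i\<le>d. monom (complex_of_real (c i)) i)"
  have cp: "coeff p i = (if i \<le> d then complex_of_real (c i) else 0)" for i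
    by (simp add: p_def coeff_sum)
  have "poly_op d p z = (\<Sum>i\<le>d. c i *\<^sub>R f i)"
    unfolding poly_op_def f_def by (intro sum.cong) (auto simp: cp vec_eq_iff complex_eq_iff)
  moreover have "p \<noteq> 0" using c cp[of i0] by auto
  moreover have "degree p \<le> d" by (rule degree_le) (simp add: cp)
  ultimately show ?thesis using c by auto
qed

lemma poly_op_mono_bound:
  assumes "degree p \<le> m" "m \<le> n"
  shows "poly_op n p z = poly_op m p z"
  unfolding poly_op_def using assms
  by (intro sum.mono_neutral_right) (auto simp: coeff_eq_0)

text \<open>An annihilating polynomial of z splits into linear factors over the complex numbers.
  They are stripped off one at a time, each by the closure property of the span under
  preimages.\<close>

lemma span_gev: "span (\<Union>\<nu>. gev \<nu>) = UNIV"
proof -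
  have "z \<in> span (\<Union>\<nu>. gev \<nu>)" for z
  proof -
    obtain n p where p: "p \<noteq> 0" "degree p \<le> n" "poly_op n p z = 0"
      using ex_annihilating_poly by blast
    obtain M where M: "size M = degree p" "p = smult (lead_coeff p) (\<Prod>x\<in>#M. [:- x, 1:])"
      using alg_closed_imp_factorization[OF p(1)] by blast
    have "poly_op (size M) p z = 0" using p poly_op_mono_bound[of p "size M" n z] M(1) by simp
    then show ?thesis
      using poly_op_roots[of M "lead_coeff p" z] M(2) p(1) by simp
  qed
  then show ?thesis by auto
qed

lemma gev_imp_eigenvector:
  assumes "z \<in> gev \<mu>" "z \<noteq> 0"
  shows "\<exists>w. w \<noteq> 0 \<and> C *v w = \<mu> *s w"
proof -
  obtain k where "(eig_op \<mu> ^^ k) z = 0" using assms by (auto simp: gev_def)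
  then show ?thesis using assms(2)
  proof (induction k arbitrary: z)
    case (Suc k)
    show ?case
    proof (cases "eig_op \<mu> z = 0")
      case True
      then show ?thesis using Suc by (auto simp: eig_op_def)
    next
      case False
      then show ?thesis using Suc by (metis funpow_Suc_right o_apply)
    qed
  qed simp
qed

end

section \<open>Growth on Lyapunov spaces\<close>

definition re_vec :: "complex^'n \<Rightarrow> real^'n" where
  "re_vec z = (\<chi> i. Re (z $ i))"

lemma linear_re_vec: "linear re_vec"
  by (rule linearI) (simp_all add: re_vec_def vec_eq_iff)

lemma re_vec_mult: "re_vec (complexify A *v z) = A *v re_vec z"
  by (simp add: re_vec_def complexify_def vec_eq_iff matrix_vector_mult_def)

lemma norm_re_vec_le: "norm (re_vec z) \<le> norm z"
  unfolding norm_vec_def re_vec_def by (intro L2_set_mono) (auto simp: abs_Re_le_cmod)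

lemma norm_smult_vec: "norm (c *s z) = cmod c * norm (z :: complex^'n)"
  by (simp add: norm_vec_def norm_mult L2_set_right_distrib)

lemma power_div_fact_le_exp:
  assumes "0 \<le> (x::real)"
  shows "x ^ n / fact n \<le> exp x"
proof -
  have s: "(\<lambda>k. x ^ k / fact k) sums exp x"
    using exp_converges[of x] by (simp add: field_simps)
  have "(\<Sum>k\<in>{n}. x ^ k / fact k) \<le> (\<Sum>k. x ^ k / fact k)"
    using s assms by (intro sum_le_suminf) (auto simp: sums_iff)
  then show ?thesis using s by (simp add: sums_iff)
qed

lemma eig_op_eq: "eig_op C \<mu> = (\<lambda>w. C *v w - \<mu> *s w)"
  by (simp add: eig_op_def fun_eq_iff)

lemma real_gen_eigenspace_eq: "real_gen_eigenspace A \<mu> = re_vec ` gev (complexify A) \<mu>"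
  by (auto simp: real_gen_eigenspace_def gev_def re_vec_def eig_op_eq)

text \<open>With the nilpotent part (C - \<mu>), the complex solution is e^{\<mu>t} times a
  polynomial in t, and its real part solves the real system. The polynomial is absorbed by
  e^{\<epsilon>|t|}, which works in both time directions.\<close>

lemma flow_gev_growth:
  fixes A :: "real^'a^'a"
  assumes z: "z \<in> gev (complexify A) \<mu>" and e: "\<epsilon> > 0"
  shows "\<exists>K. \<forall>t. norm (flow A t (re_vec z)) \<le> K * exp (Re \<mu> * t + \<epsilon> * \<bar>t\<bar>)"
proof -
  define N where "N = eig_op (complexify A) \<mu>"
  define c where "c j = (N ^^ j) z" for j
  obtain k0 where "c k0 = 0" using z by (auto simp: gev_def c_def N_def)
  \<comment> \<open>The vanishing of the next iterate lets the differentiated sum be shifted by one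
    index without a boundary term.\<close>
  then have ck: "c (Suc k0) = 0" by (simp add: c_def N_def eig_op_simps)
  have cS: "c (Suc j) = complexify A *v c j - \<mu> *s c j" for j
    by (simp add: c_def N_def eig_op_def)
  define h where "h t = (\<Sum>j\<le>k0. (t ^ j / fact j) *\<^sub>R c j)" for t :: real
  define g where "g t = exp (t *\<^sub>R \<mu>) *s h t" for t :: real
  have lin: "linear (\<lambda>x :: complex^'a. \<mu> *s x)"
    by (rule linearI) (simp_all add: vec_eq_iff algebra_simps)
  have hN: "(\<Sum>j\<le>k0. (t ^ j / fact j) *\<^sub>R c (Suc j)) = complexify A *v h t - \<mu> *s h t" for t
    unfolding h_def by (simp add: cS scaleR_diff_right sum_subtractf linear_sum[OF matrix_vector_mul_linear]
        linear_scale[OF matrix_vector_mul_linear] linear_sum[OF lin] linear_scale[OF lin])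
  have dh: "((\<lambda>t. h t $ i) has_vector_derivative (complexify A *v h t - \<mu> *s h t) $ i) (at t)" for i t
  proof -
    have dp: "((\<lambda>t. t ^ j / fact j) has_real_derivative (if j = 0 then 0 else t ^ (j - 1) / fact (j - 1))) (at t)" for j
    proof (cases j)
      case (Suc m)
      have "((\<lambda>t. t ^ Suc m / fact (Suc m)) has_real_derivative real (Suc m) * t ^ (Suc m - Suc 0) / fact (Suc m)) (at t)"
        by (intro DERIV_cdivide DERIV_pow)
      then show ?thesis by (simp add: Suc fact_Suc del: of_nat_Suc)
    qed simp
    have "((\<lambda>t. \<Sum>j\<le>k0. (t ^ j / fact j) *\<^sub>R (c j $ i)) has_vector_derivative
        (\<Sum>j\<le>k0. (if j = 0 then 0 else t ^ (j - 1) / fact (j - 1)) *\<^sub>R (c j $ i))) (at t)"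
      by (intro has_vector_derivative_sum has_vector_derivative_scaleR[OF dp has_vector_derivative_const, simplified])
    also have "(\<Sum>j\<le>k0. (if j = 0 then 0 else t ^ (j - 1) / fact (j - 1)) *\<^sub>R (c j $ i)) =
        (\<Sum>j\<le>Suc k0. (if j = 0 then 0 else t ^ (j - 1) / fact (j - 1)) *\<^sub>R (c j $ i))"
      using ck by simp
    also have "\<dots> = (\<Sum>j\<le>k0. (t ^ j / fact j) *\<^sub>R (c (Suc j) $ i))"
      by (subst sum.atMost_Suc_shift) simp
    also have "\<dots> = (complexify A *v h t - \<mu> *s h t) $ i"
      unfolding hN[symmetric] by simp
    finally show ?thesis by (simp add: h_def)
  qed
  have dg: "((\<lambda>t. re_vec (g t)) has_vector_derivative A *v re_vec (g t)) (at t)" for t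
  proof (rule has_vector_derivative_cart)
    fix i
    have "((\<lambda>t. exp (t *\<^sub>R \<mu>) * h t $ i) has_vector_derivative
       (exp (t *\<^sub>R \<mu>) * (complexify A *v h t - \<mu> *s h t) $ i + exp (t *\<^sub>R \<mu>) * \<mu> * h t $ i)) (at t)"
      by (intro has_vector_derivative_mult dh exp_scaleR_has_vector_derivative_right)
    also have "exp (t *\<^sub>R \<mu>) * (complexify A *v h t - \<mu> *s h t) $ i + exp (t *\<^sub>R \<mu>) * \<mu> * h t $ i =
       (complexify A *v g t) $ i"
      unfolding g_def vector_scalar_commute by (simp add: algebra_simps)
    finally have "((\<lambda>t. Re (exp (t *\<^sub>R \<mu>) * h t $ i)) has_vector_derivative Re ((complexify A *v g t) $ i)) (at t)"
      by (rule bounded_linear.has_vector_derivative[OF bounded_linear_Re])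
    then show "((\<lambda>t. re_vec (g t) $ i) has_real_derivative (A *v re_vec (g t)) $ i) (at t)"
      unfolding re_vec_mult[symmetric] has_real_derivative_iff_has_vector_derivative
      by (simp add: re_vec_def g_def)
  qed
  have g0: "g 0 = z"
  proof -
    have "h 0 = (\<Sum>j\<in>{0}. (0 ^ j / fact j) *\<^sub>R c j)"
      unfolding h_def by (intro sum.mono_neutral_right) (auto simp: power_0_left)
    then show ?thesis by (simp add: g_def c_def)
  qed
  have fl: "flow A t (re_vec z) = re_vec (g t)" for t
    using flow_unique[of "\<lambda>t. re_vec (g t)" A t, OF dg] g0 by simp
  \<comment> \<open>The weights come from |t|^j / j! \<le> e^{\<epsilon>|t|} / \<epsilon>^j.\<close>
  define K where "K = (\<Sum>j\<le>k0. norm (c j) / \<epsilon> ^ j)"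
  have "norm (flow A t (re_vec z)) \<le> K * exp (Re \<mu> * t + \<epsilon> * \<bar>t\<bar>)" for t
  proof -
    have "norm (h t) \<le> (\<Sum>j\<le>k0. \<bar>t\<bar> ^ j / fact j * norm (c j))"
      unfolding h_def by (rule order_trans[OF norm_sum]) (simp add: power_abs)
    also have "\<dots> \<le> (\<Sum>j\<le>k0. exp (\<epsilon> * \<bar>t\<bar>) / \<epsilon> ^ j * norm (c j))"
    proof (intro sum_mono mult_right_mono)
      fix j
      have "(\<epsilon> * \<bar>t\<bar>) ^ j / fact j \<le> exp (\<epsilon> * \<bar>t\<bar>)" using e by (intro power_div_fact_le_exp) auto
      then show "\<bar>t\<bar> ^ j / fact j \<le> exp (\<epsilon> * \<bar>t\<bar>) / \<epsilon> ^ j"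
        using e by (simp add: field_simps power_mult_distrib)
    qed auto
    also have "\<dots> = K * exp (\<epsilon> * \<bar>t\<bar>)" by (simp add: K_def sum_distrib_left mult_ac)
    finally have "norm (h t) \<le> K * exp (\<epsilon> * \<bar>t\<bar>)" .
    then have "exp (Re \<mu> * t) * norm (h t) \<le> exp (Re \<mu> * t) * (K * exp (\<epsilon> * \<bar>t\<bar>))"
      by (rule mult_left_mono) simp
    moreover have "norm (flow A t (re_vec z)) \<le> norm (g t)" unfolding fl by (rule norm_re_vec_le)
    moreover have "norm (g t) = exp (Re \<mu> * t) * norm (h t)"
      by (simp add: g_def norm_smult_vec norm_exp_eq_Re mult.commute)
    ultimately have "norm (flow A t (re_vec z)) \<le> exp (Re \<mu> * t) * (K * exp (\<epsilon> * \<bar>t\<bar>))" by linarith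
    then show ?thesis by (simp add: exp_add mult_ac)
  qed
  then show ?thesis by blast
qed

lemma lyapunov_space_growth:
  assumes "x \<in> lyapunov_space A l" "\<epsilon> > 0"
  shows "\<exists>K. \<forall>t. norm (flow A t x) \<le> K * exp (l * t + \<epsilon> * \<bar>t\<bar>)"
  using assms(1) unfolding lyapunov_space_def
proof (induction rule: span_induct_alt)
  case base
  then show ?case by (auto simp: flow_linear_simps intro!: exI[of _ 0])
next
  case (step c x y)
  then obtain z \<mu> where "z \<in> gev (complexify A) \<mu>" "x = re_vec z" "l = Re \<mu>"
    by (auto simp: real_gen_eigenspace_eq)
  then obtain K1 where K1: "\<And>t. norm (flow A t x) \<le> K1 * exp (l * t + \<epsilon> * \<bar>t\<bar>)"
    using flow_gev_growth[of z A \<mu>, OF _ assms(2)] by blast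
  obtain K2 where K2: "\<And>t. norm (flow A t y) \<le> K2 * exp (l * t + \<epsilon> * \<bar>t\<bar>)"
    using step by blast
  have "norm (flow A t (c *\<^sub>R x + y)) \<le> (\<bar>c\<bar> * K1 + K2) * exp (l * t + \<epsilon> * \<bar>t\<bar>)" for t
  proof -
    have "norm (flow A t (c *\<^sub>R x + y)) \<le> \<bar>c\<bar> * norm (flow A t x) + norm (flow A t y)"
      unfolding flow_linear_simps by (rule order_trans[OF norm_triangle_ineq]) simp
    also have "\<dots> \<le> \<bar>c\<bar> * (K1 * exp (l * t + \<epsilon> * \<bar>t\<bar>)) + K2 * exp (l * t + \<epsilon> * \<bar>t\<bar>)"
      by (intro add_mono mult_left_mono K1 K2) auto
    finally show ?thesis by (simp add: algebra_simps)
  qed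
  then show ?case by blast
qed

lemma lyapunov_space_mult:
  assumes "x \<in> lyapunov_space A l"
  shows "A *v x \<in> lyapunov_space A l"
  using assms unfolding lyapunov_space_def
proof (induction rule: span_induct_alt)
  case base
  then show ?case by (simp add: span_0)
next
  case (step c x y)
  then obtain z \<mu> where z: "z \<in> gev (complexify A) \<mu>" "x = re_vec z" "l = Re \<mu>" "\<mu> \<in> eigenvalues A"
    by (auto simp: real_gen_eigenspace_eq)
  then have "A *v x \<in> real_gen_eigenspace A \<mu>"
    by (simp add: real_gen_eigenspace_eq re_vec_mult[symmetric] gev_mult)
  then have "A *v x \<in> span (\<Union>\<mu>\<in>{\<mu> \<in> eigenvalues A. Re \<mu> = l}. real_gen_eigenspace A \<mu>)"
    using z by (intro span_base UN_I[of \<mu>]) auto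
  then show ?case using step.IH
    by (simp add: matrix_vector_right_distrib linear_scale[OF matrix_vector_mul_linear] span_add span_scale)
qed

section \<open>Lyapunov spaces, their sums, and uniform growth bounds\<close>

lemma subspace_lyapunov_space: "subspace (lyapunov_space A l)"
  by (simp add: lyapunov_space_def)

lemma lyapunov_space_eq_0: "l \<notin> lyapunov_exponents A \<Longrightarrow> lyapunov_space A l = {0}"
proof -
  assume "l \<notin> lyapunov_exponents A"
  then have eq: "{\<mu> \<in> eigenvalues A. Re \<mu> = l} = {}" by (auto simp: lyapunov_exponents_def)
  show ?thesis unfolding lyapunov_space_def eq by simp
qed

text \<open>The real part of a complex eigenvector z may vanish, but then that of
  \<open>\<i> *s z\<close> does not.\<close>

lemma lyapunov_space_nontrivial:
  assumes "l \<in> lyapunov_exponents A"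
  shows "\<exists>x\<in>lyapunov_space A l. x \<noteq> 0"
proof -
  obtain \<mu> z where \<mu>: "\<mu> \<in> eigenvalues A" "Re \<mu> = l" "z \<noteq> 0" "complexify A *v z = \<mu> *s z"
    using assms by (auto simp: lyapunov_exponents_def eigenvalues_def)
  then have "eig_op (complexify A) \<mu> z = 0" by (simp add: eig_op_def)
  then have "(eig_op (complexify A) \<mu> ^^ 1) z = 0" by simp
  then have z: "z \<in> gev (complexify A) \<mu>" unfolding gev_def by blast
  have in_sp: "re_vec w \<in> lyapunov_space A l" if "w \<in> gev (complexify A) \<mu>" for w
    unfolding lyapunov_space_def real_gen_eigenspace_eq using that \<mu> by (intro span_base) auto
  obtain i where "z $ i \<noteq> 0" using \<mu> by (auto simp: vec_eq_iff)
  then have "re_vec z $ i \<noteq> 0 \<or> re_vec (\<i> *s z) $ i \<noteq> 0"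
    by (simp add: re_vec_def complex_eq_iff)
  then have "re_vec z \<noteq> 0 \<or> re_vec (\<i> *s z) \<noteq> 0" by auto
  then show ?thesis using in_sp z gev_scale(1) by metis
qed

text \<open>Indexed by an arbitrary set of reals, of which only the exponents matter. Thus slow,
  fast and hyperbolic parts are given by rays and complements, and relations between the sums by set
  operations.\<close>

definition lsum :: "real^'n^'n \<Rightarrow> real set \<Rightarrow> (real^'n) set" where
  "lsum A I = span (\<Union>l\<in>{l \<in> lyapunov_exponents A. l \<in> I}. lyapunov_space A l)"

lemma subspace_lsum [simp]: "subspace (lsum A I)"
  by (simp add: lsum_def)

lemma lyapunov_space_subset_lsum: "l \<in> I \<Longrightarrow> lyapunov_space A l \<subseteq> lsum A I"
  unfolding lsum_def
  by (cases "l \<in> lyapunov_exponents A") (auto simp: lyapunov_space_eq_0 span_0 intro: span_base)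

lemma lsum_mono: "I \<subseteq> J \<Longrightarrow> lsum A I \<subseteq> lsum A J"
  unfolding lsum_def by (intro span_mono) auto

lemma lsum_singleton: "lsum A {l} = lyapunov_space A l"
proof
  show "lsum A {l} \<subseteq> lyapunov_space A l"
    unfolding lsum_def by (intro span_minimal subspace_lyapunov_space) auto
qed (simp add: lyapunov_space_subset_lsum)

lemma lsum_induct [consumes 1, case_names zero step]:
  assumes "x \<in> lsum A I" "P 0"
    and "\<And>l c x y. l \<in> lyapunov_exponents A \<Longrightarrow> l \<in> I \<Longrightarrow> x \<in> lyapunov_space A l \<Longrightarrow> P y \<Longrightarrow> P (c *\<^sub>R x + y)"
  shows "P x"
  using assms(1) unfolding lsum_def
  by (induction rule: span_induct_alt) (use assms in auto)

lemma lsum_mult: "x \<in> lsum A I \<Longrightarrow> A *v x \<in> lsum A I"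
proof (induction rule: lsum_induct)
  case (step l c x y)
  then have "A *v x \<in> lsum A I"
    using lyapunov_space_mult lyapunov_space_subset_lsum by blast
  then show ?case using step
    by (auto simp: matrix_vector_right_distrib matrix_scaleR_vector_ac scaleR_matrix_vector_assoc[symmetric]
        intro!: subspace_add subspace_scale)
qed (simp add: subspace_0)

lemma lsum_flow: "x \<in> lsum A I \<Longrightarrow> flow A t x \<in> lsum A I"
  by (rule subspace_flow) (auto intro: lsum_mult)

text \<open>A real vector is the real part of its complexification, which is a combination of
  generalized eigenvectors, and their real parts lie in Lyapunov spaces.\<close>

lemma lsum_UNIV: "lsum A UNIV = UNIV"
proof -
  have "x \<in> lsum A UNIV" for x
  proof -
    define z where "z = (\<chi> i. complex_of_real (x $ i))"
    have "z \<in> span (\<Union>\<nu>. gev (complexify A) \<nu>)" by (simp add: span_gev)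
    then have "re_vec z \<in> span (re_vec ` (\<Union>\<nu>. gev (complexify A) \<nu>))"
      by (simp add: linear_span_image[OF linear_re_vec])
    also have "\<dots> \<subseteq> lsum A UNIV"
    proof (intro span_minimal subspace_lsum subsetI)
      fix y assume "y \<in> re_vec ` (\<Union>\<nu>. gev (complexify A) \<nu>)"
      then obtain \<nu> w where w: "w \<in> gev (complexify A) \<nu>" "y = re_vec w" by auto
      show "y \<in> lsum A UNIV"
      proof (cases "w = 0")
        case True
        then show ?thesis using w by (simp add: linear_0[OF linear_re_vec] subspace_0)
      next
        case False
        then have "\<nu> \<in> eigenvalues A"
          using gev_imp_eigenvector[OF w(1)] by (auto simp: eigenvalues_def)
        then have "y \<in> lyapunov_space A (Re \<nu>)"
          unfolding lyapunov_space_def real_gen_eigenspace_eq using w by (intro span_base) auto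
        then show ?thesis using lyapunov_space_subset_lsum by blast
      qed
    qed
    also have "re_vec z = x" by (simp add: re_vec_def z_def vec_eq_iff)
    finally show ?thesis .
  qed
  then show ?thesis by auto
qed

lemma lsum_Un: "x \<in> lsum A (I \<union> J) \<Longrightarrow> \<exists>y\<in>lsum A I. \<exists>z\<in>lsum A J. x = y + z"
proof (induction rule: lsum_induct)
  case zero
  then show ?case by (intro bexI[of _ 0]) (auto simp: subspace_0)
next
  case (step l c x w)
  then obtain y z where yz: "y \<in> lsum A I" "z \<in> lsum A J" "w = y + z" by blast
  show ?case
  proof (cases "l \<in> I")
    case True
    then have "c *\<^sub>R x + y \<in> lsum A I" using step yz lyapunov_space_subset_lsum
      by (intro subspace_add subspace_scale) auto
    then show ?thesis using yz by (intro bexI[of _ "c *\<^sub>R x + y"] bexI[of _ z]) auto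
  next
    case False
    then have "l \<in> J" using step by auto
    then have "c *\<^sub>R x + z \<in> lsum A J" using step yz lyapunov_space_subset_lsum
      by (intro subspace_add subspace_scale) auto
    then show ?thesis using yz by (intro bexI[of _ y] bexI[of _ "c *\<^sub>R x + z"]) auto
  qed
qed

text \<open>The uniform boundedness principle in finite dimension: pointwise bounds are needed only
  on an orthonormal basis of S.\<close>

lemma uniform_linear_bound:
  fixes F :: "'i \<Rightarrow> 'a::euclidean_space \<Rightarrow> 'b::real_normed_vector"
  assumes "subspace S" "\<And>i. linear (F i)" "\<And>x. x \<in> S \<Longrightarrow> \<exists>K. \<forall>i\<in>T. norm (F i x) \<le> K"
  shows "\<exists>K>0. \<forall>i\<in>T. \<forall>x\<in>S. norm (F i x) \<le> K * norm x"
proof -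
  obtain B where B: "B \<subseteq> S" "pairwise orthogonal B" "\<And>x. x \<in> B \<Longrightarrow> norm x = 1"
    "independent B" "span B = S"
    using orthonormal_basis_subspace[OF assms(1)] by metis
  have finB: "finite B" using B independent_imp_finite by blast
  obtain K where K: "\<And>b i. b \<in> B \<Longrightarrow> i \<in> T \<Longrightarrow> norm (F i b) \<le> K b"
    using assms(3) B(1) by (metis subsetD)
  have "norm (F i x) \<le> (1 + (\<Sum>b\<in>B. \<bar>K b\<bar>)) * norm x" if "i \<in> T" "x \<in> S" for i x
  proof -
    have x: "(\<Sum>b\<in>B. (x \<bullet> b) *\<^sub>R b) = x"
      using B finB that by (intro orthonormal_basis_expand) auto
    have "norm (F i x) = norm (\<Sum>b\<in>B. (x \<bullet> b) *\<^sub>R F i b)"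
      by (subst x[symmetric]) (simp add: linear_sum[OF assms(2)] linear_scale[OF assms(2)])
    also have "\<dots> \<le> (\<Sum>b\<in>B. \<bar>x \<bullet> b\<bar> * norm (F i b))"
      by (rule order_trans[OF norm_sum]) simp
    also have "\<dots> \<le> (\<Sum>b\<in>B. norm x * \<bar>K b\<bar>)"
    proof (intro sum_mono mult_mono)
      fix b assume b: "b \<in> B"
      show "\<bar>x \<bullet> b\<bar> \<le> norm x" using Cauchy_Schwarz_ineq2[of x b] B(3)[OF b] by simp
      show "norm (F i b) \<le> \<bar>K b\<bar>" using K[OF b that(1)] by linarith
    qed auto
    also have "\<dots> \<le> (1 + (\<Sum>b\<in>B. \<bar>K b\<bar>)) * norm x"
      by (simp add: sum_distrib_left[symmetric] algebra_simps)
    finally show ?thesis .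
  qed
  then show ?thesis by (intro exI[of _ "1 + (\<Sum>b\<in>B. \<bar>K b\<bar>)"]) (auto simp: add_pos_nonneg sum_nonneg)
qed

text \<open>The sign s treats both time directions at once; backward in time an exponent k acts as
  -k.\<close>

lemma lsum_growth:
  assumes "\<And>k. k \<in> lyapunov_exponents A \<Longrightarrow> k \<in> I \<Longrightarrow> s * k < b" and s: "\<bar>s\<bar> = 1"
  shows "\<exists>K>0. \<forall>t\<ge>0. \<forall>x\<in>lsum A I. norm (flow A (s * t) x) \<le> K * exp (b * t) * norm x"
proof -
  have "\<exists>K. \<forall>t\<in>{0..}. norm (exp (- b * t) *\<^sub>R flow A (s * t) x) \<le> K" if "x \<in> lsum A I" for x
    using that
  proof (induction rule: lsum_induct)
    case zero
    then show ?case by (auto simp: flow_linear_simps intro: exI[of _ 0])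
  next
    case (step l c x y)
    \<comment> \<open>With this margin as \<epsilon>, the growth bound for x is exactly a multiple
      of e^{bt}.\<close>
    then have "b - s * l > 0" using assms by simp
    from lyapunov_space_growth[OF step(3) this] obtain K1 where
      K1: "\<And>t. norm (flow A t x) \<le> K1 * exp (l * t + (b - s * l) * \<bar>t\<bar>)" by blast
    obtain K2 where K2: "\<And>t. t \<ge> 0 \<Longrightarrow> norm (exp (- b * t) *\<^sub>R flow A (s * t) y) \<le> K2"
      using step by auto
    have "norm (exp (- b * t) *\<^sub>R flow A (s * t) (c *\<^sub>R x + y)) \<le> \<bar>c\<bar> * K1 + K2" if t: "t \<ge> 0" for t
    proof -
      have "norm (flow A (s * t) x) \<le> K1 * exp (b * t)"
        using K1[of "s * t"] t s by (simp add: abs_mult algebra_simps)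
      then have "exp (- b * t) * norm (flow A (s * t) x) \<le> exp (- b * t) * (K1 * exp (b * t))"
        by (rule mult_left_mono) simp
      then have 1: "exp (- b * t) * norm (flow A (s * t) x) \<le> K1"
        by (simp add: exp_minus field_simps)
      have "norm (exp (- b * t) *\<^sub>R flow A (s * t) (c *\<^sub>R x + y)) =
          norm (c *\<^sub>R (exp (- b * t) *\<^sub>R flow A (s * t) x) + exp (- b * t) *\<^sub>R flow A (s * t) y)"
        by (simp add: flow_linear_simps scaleR_add_right mult.commute)
      also have "\<dots> \<le> \<bar>c\<bar> * (exp (- b * t) * norm (flow A (s * t) x)) + norm (exp (- b * t) *\<^sub>R flow A (s * t) y)"
        by (rule order_trans[OF norm_triangle_ineq]) (simp add: abs_mult mult.assoc)
      also have "\<dots> \<le> \<bar>c\<bar> * K1 + K2"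
        by (intro add_mono mult_left_mono 1 K2 t) auto
      finally show ?thesis .
    qed
    then show ?case by auto
  qed
  then have "\<exists>K>0. \<forall>t\<in>{0..}. \<forall>x\<in>lsum A I. norm (exp (- b * t) *\<^sub>R flow A (s * t) x) \<le> K * norm x"
    by (intro uniform_linear_bound) (auto intro: linear_compose_scale_right linear_flow)
  then obtain K where K: "K > 0"
    "\<And>t x. t \<ge> 0 \<Longrightarrow> x \<in> lsum A I \<Longrightarrow> norm (exp (- b * t) *\<^sub>R flow A (s * t) x) \<le> K * norm x" by auto
  have "norm (flow A (s * t) x) \<le> K * exp (b * t) * norm x" if "t \<ge> 0" "x \<in> lsum A I" for t x
    using K(2)[OF that] by (simp add: exp_minus field_simps)
  then show ?thesis using K(1) by blast
qed

lemma lsum_growth_forward: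
  assumes "\<And>k. k \<in> lyapunov_exponents A \<Longrightarrow> k \<in> I \<Longrightarrow> k < \<beta>"
  shows "\<exists>K>0. \<forall>t\<ge>0. \<forall>x\<in>lsum A I. norm (flow A t x) \<le> K * exp (\<beta> * t) * norm x"
  using lsum_growth[of A I 1 \<beta>] assms by simp

lemma lsum_growth_backward:
  assumes "\<And>k. k \<in> lyapunov_exponents A \<Longrightarrow> k \<in> I \<Longrightarrow> \<gamma> < k"
  shows "\<exists>K>0. \<forall>t\<ge>0. \<forall>x\<in>lsum A I. norm (flow A (- t) x) \<le> K * exp (- \<gamma> * t) * norm x"
  using lsum_growth[of A I "- 1" "- \<gamma>"] assms by simp

text \<open>The projection along the complementary sum. That the description determines a vector is
  derived below from the orthogonality of the Lyapunov spaces.\<close>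

definition lproj :: "real^'n^'n \<Rightarrow> real set \<Rightarrow> real^'n \<Rightarrow> real^'n" where
  "lproj A I x = (THE y. y \<in> lsum A I \<and> x - y \<in> lsum A (- I))"

section \<open>Projections onto sums of Lyapunov spaces, and spectral gaps\<close>

locale lyapunov_scalar_product =
  fixes A :: "real^'n^'n" and ip :: "real^'n \<Rightarrow> real^'n \<Rightarrow> real"
  assumes sp: "is_scalar_product ip" and orth: "lyapunov_orthogonal ip A"
begin

lemma bil_ip: "bilinear ip" using sp by (simp add: is_scalar_product_def)

lemma ip_pos: "x \<noteq> 0 \<Longrightarrow> ip x x > 0" using sp by (simp add: is_scalar_product_def)

lemmas ip_simps = bilinear_ladd[OF bil_ip] bilinear_radd[OF bil_ip] bilinear_lmul[OF bil_ip]
  bilinear_rmul[OF bil_ip] bilinear_lzero[OF bil_ip] bilinear_rzero[OF bil_ip]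
  bilinear_lsub[OF bil_ip] bilinear_rsub[OF bil_ip]

lemma lsum_orthogonal:
  assumes "x \<in> lsum A I" "y \<in> lsum A J" "I \<inter> J = {}"
  shows "ip x y = 0"
  using assms(1)
proof (induction rule: lsum_induct)
  case zero
  then show ?case by (simp add: ip_simps)
next
  case (step l c x x')
  have "ip x y = 0"
    using assms(2)
  proof (induction rule: lsum_induct)
    case zero
    then show ?case by (simp add: ip_simps)
  next
    case (step k d z z')
    have "l \<noteq> k" using \<open>l \<in> I\<close> \<open>k \<in> J\<close> assms(3) by auto
    then have "ip x z = 0"
      using orth \<open>l \<in> lyapunov_exponents A\<close> \<open>x \<in> lyapunov_space A l\<close>
        \<open>k \<in> lyapunov_exponents A\<close> \<open>z \<in> lyapunov_space A k\<close>
      unfolding lyapunov_orthogonal_def by blast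
    then show ?case using step by (simp add: ip_simps)
  qed
  then show ?case using step by (simp add: ip_simps)
qed

lemma lsum_Int_0: "x \<in> lsum A I \<Longrightarrow> x \<in> lsum A J \<Longrightarrow> I \<inter> J = {} \<Longrightarrow> x = 0"
  using lsum_orthogonal[of x I x J] ip_pos[of x] by fastforce

text \<open>Nonzero vectors chosen from the Lyapunov spaces are mutually orthogonal, hence
  independent, so there are only finitely many.\<close>

lemma finite_lyapunov_exponents: "finite (lyapunov_exponents A)"
proof -
  obtain v where v: "\<And>l. l \<in> lyapunov_exponents A \<Longrightarrow> v l \<in> lyapunov_space A l \<and> v l \<noteq> 0"
    using lyapunov_space_nontrivial by metis
  have o: "ip (v k) (v l) = 0" if "k \<in> lyapunov_exponents A" "l \<in> lyapunov_exponents A" "k \<noteq> l" for k l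
    using orth that v by (auto simp: lyapunov_orthogonal_def)
  have inj: "inj_on v (lyapunov_exponents A)"
  proof (rule inj_onI, rule ccontr)
    fix k l assume "k \<in> lyapunov_exponents A" "l \<in> lyapunov_exponents A" "v k = v l" "k \<noteq> l"
    then show False using o[of k l] ip_pos[of "v k"] v[of k] by simp
  qed
  have "independent (v ` lyapunov_exponents A)"
    unfolding dependent_explicit
  proof clarify
    fix T u w assume T: "finite T" "T \<subseteq> v ` lyapunov_exponents A" "(\<Sum>x\<in>T. u x *\<^sub>R x) = 0" "w \<in> T" "u w \<noteq> 0"
    have w0: "ip w w > 0" using T v ip_pos by auto
    have "0 = ip (\<Sum>x\<in>T. u x *\<^sub>R x) w" using T by (simp add: ip_simps)
    also have "\<dots> = (\<Sum>x\<in>T. u x * ip x w)"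
      using bil_ip by (simp add: linear_sum[of "\<lambda>x. ip x w"] bilinear_def ip_simps)
    also have "\<dots> = (\<Sum>x\<in>T. if x = w then u w * ip w w else 0)"
    proof (intro sum.cong refl)
      fix x assume "x \<in> T"
      then obtain k l where "x = v k" "w = v l" "k \<in> lyapunov_exponents A" "l \<in> lyapunov_exponents A"
        using T by blast
      then show "u x * ip x w = (if x = w then u w * ip w w else 0)" using o[of k l] by auto
    qed
    also have "\<dots> = u w * ip w w" using T by simp
    finally show False using T w0 by simp
  qed
  then have "finite (v ` lyapunov_exponents A)" by (rule independent_imp_finite)
  then show ?thesis using inj finite_imageD by blast
qed

lemma lproj_ex: "\<exists>y. y \<in> lsum A I \<and> x - y \<in> lsum A (- I)"
proof -
  have "x \<in> lsum A (I \<union> - I)" by (simp add: lsum_UNIV)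
  then obtain y z where "y \<in> lsum A I" "z \<in> lsum A (- I)" "x = y + z" using lsum_Un by blast
  then show ?thesis by auto
qed

lemma lproj_eq:
  assumes "y \<in> lsum A I" "x - y \<in> lsum A (- I)"
  shows "lproj A I x = y"
  unfolding lproj_def
proof (rule the_equality)
  fix z assume z: "z \<in> lsum A I \<and> x - z \<in> lsum A (- I)"
  have "z - y \<in> lsum A I" using z assms by (simp add: subspace_diff)
  moreover have "(x - y) - (x - z) \<in> lsum A (- I)" using z assms by (blast intro: subspace_diff subspace_lsum)
  then have "z - y \<in> lsum A (- I)" by simp
  ultimately show "z = y" using lsum_Int_0[of "z - y" I "- I"] by simp
qed (use assms in auto)

lemma lproj_in: "lproj A I x \<in> lsum A I" and lproj_compl: "x - lproj A I x \<in> lsum A (- I)"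
  using lproj_ex[of I x] lproj_eq by auto

lemma lproj_add: "lproj A I (x + y) = lproj A I x + lproj A I y"
proof (rule lproj_eq)
  show "lproj A I x + lproj A I y \<in> lsum A I" by (intro subspace_add subspace_lsum lproj_in)
  have "(x - lproj A I x) + (y - lproj A I y) \<in> lsum A (- I)"
    by (intro subspace_add subspace_lsum lproj_compl)
  then show "x + y - (lproj A I x + lproj A I y) \<in> lsum A (- I)" by (simp add: algebra_simps)
qed

lemma lproj_scale: "lproj A I (c *\<^sub>R x) = c *\<^sub>R lproj A I x"
proof (rule lproj_eq)
  show "c *\<^sub>R lproj A I x \<in> lsum A I" by (intro subspace_scale subspace_lsum lproj_in)
  have "c *\<^sub>R (x - lproj A I x) \<in> lsum A (- I)" by (intro subspace_scale subspace_lsum lproj_compl)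
  then show "c *\<^sub>R x - c *\<^sub>R lproj A I x \<in> lsum A (- I)" by (simp add: algebra_simps)
qed

lemma linear_lproj: "linear (lproj A I)"
  by (rule linearI) (simp_all add: lproj_add lproj_scale)

lemma lproj_diff: "lproj A I (x - y) = lproj A I x - lproj A I y"
  and lproj_0: "lproj A I 0 = 0"
  by (simp_all add: linear_diff[OF linear_lproj] linear_0[OF linear_lproj])

lemma bounded_linear_lproj: "bounded_linear (lproj A I)"
  using linear_lproj linear_conv_bounded_linear by blast

lemma continuous_on_lproj [continuous_intros]:
  "continuous_on S f \<Longrightarrow> continuous_on S (\<lambda>x. lproj A I (f x))"
  using bounded_linear.continuous_on[OF bounded_linear_lproj] .

lemma lproj_id: "x \<in> lsum A I \<Longrightarrow> lproj A I x = x"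
  by (rule lproj_eq) (simp_all add: subspace_0)

lemma lproj_disjoint: "x \<in> lsum A J \<Longrightarrow> I \<inter> J = {} \<Longrightarrow> lproj A I x = 0"
  using lsum_mono[of J "- I" A] by (intro lproj_eq) (auto simp: subspace_0)

lemma lproj_flow: "lproj A I (flow A t x) = flow A t (lproj A I x)"
proof (rule lproj_eq)
  show "flow A t (lproj A I x) \<in> lsum A I" by (intro lsum_flow lproj_in)
  have "flow A t (x - lproj A I x) \<in> lsum A (- I)" by (intro lsum_flow lproj_compl)
  then show "flow A t x - flow A t (lproj A I x) \<in> lsum A (- I)" by (simp add: flow_linear_simps)
qed

lemma lproj_Un:
  assumes "I \<inter> J = {}"
  shows "lproj A (I \<union> J) x = lproj A I x + lproj A J x"
proof -
  have "x \<in> lsum A (I \<union> (J \<union> - (I \<union> J)))" 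
  proof -
    have "I \<union> (J \<union> - (I \<union> J)) = UNIV" by auto
    then show ?thesis by (simp only: lsum_UNIV UNIV_I)
  qed
  then obtain a y where a: "a \<in> lsum A I" "y \<in> lsum A (J \<union> - (I \<union> J))" "x = a + y" using lsum_Un by blast
  then obtain b c where b: "b \<in> lsum A J" "c \<in> lsum A (- (I \<union> J))" "y = b + c" using lsum_Un by blast
  have "lproj A I a = a" "lproj A J b = b" "lproj A (I \<union> J) a = a" "lproj A (I \<union> J) b = b"
    using a b lsum_mono[of I "I \<union> J" A] lsum_mono[of J "I \<union> J" A] by (auto intro!: lproj_id)
  moreover have "lproj A I b = 0" "lproj A J a = 0" "lproj A I c = 0" "lproj A J c = 0" "lproj A (I \<union> J) c = 0"
    using a b assms by (blast intro: lproj_disjoint)+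
  ultimately show ?thesis by (simp add: a(3) b(3) lproj_add)
qed

lemma lproj_UNIV: "lproj A I x + lproj A (- I) x = x"
  using lproj_Un[of I "- I" x] lproj_id[of x UNIV] by (simp add: lsum_UNIV)

lemma L_zero_eq: "L_zero A = lsum A {0}"
  by (simp add: L_zero_def lsum_singleton)

lemma L_hyp_eq: "L_hyp A = lsum A (- {0})"
proof
  have *: "L_plus A = lsum A {0<..}" "L_minus A = lsum A {..<0}"
    by (simp_all add: L_plus_def L_minus_def lsum_def)
  show "L_hyp A \<subseteq> lsum A (- {0})"
    using lsum_mono[of "{0<..}" "- {0}" A] lsum_mono[of "{..<0}" "- {0}" A]
    by (auto simp: L_hyp_def * intro!: subspace_add)
  have eq: "- {0} = {0<..} \<union> {..<0::real}" by auto
  show "lsum A (- {0}) \<subseteq> L_hyp A"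
    unfolding L_hyp_def * eq using lsum_Un[of _ A "{0<..}" "{..<0}"] by blast
qed

lemma proj_hyp_eq: "proj_hyp A = lproj A (- {0})"
  by (simp add: fun_eq_iff proj_hyp_def lproj_def L_hyp_eq L_zero_eq)

text \<open>The two rates cut the gap below l into thirds. For positive l the gap is measured from 0
  as well, because the last coordinate of the lifted system has exponent 0 and must count as slow;
  this makes \<beta> positive.\<close>

lemma exponent_gap:
  "\<exists>\<beta> \<gamma>. (\<forall>k\<in>lyapunov_exponents A. k < l \<longrightarrow> k < \<beta>) \<and> \<beta> < \<gamma> \<and> \<gamma> < l \<and> (0 < l \<longrightarrow> 0 < \<beta>)"
proof -
  \<comment> \<open>The inserted element keeps the set nonempty and, for \<open>0 < l\<close>,
    forces m to be nonnegative.\<close>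
  define m where "m = Max (insert (if 0 < l then 0 else l - 1) {k \<in> lyapunov_exponents A. k < l})"
  have fin: "finite (insert (if 0 < l then 0 else l - 1) {k \<in> lyapunov_exponents A. k < l})"
    using finite_lyapunov_exponents by simp
  have 1: "m < l" unfolding m_def using fin by (subst Max_less_iff) auto
  have 2: "k \<le> m" if "k \<in> lyapunov_exponents A" "k < l" for k
    unfolding m_def using that fin by (intro Max_ge) auto
  have 3: "0 < l \<longrightarrow> 0 \<le> m"
    unfolding m_def using fin by (auto intro: Max_ge)
  show ?thesis
    using 1 2 3 by (intro exI[of _ "(2 * m + l) / 3"] exI[of _ "(m + 2 * l) / 3"]) fastforce
qed

lemma hyperbolic_gap: "\<exists>a>0. \<forall>k\<in>lyapunov_exponents A. k \<noteq> 0 \<longrightarrow> a < \<bar>k\<bar>"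
proof -
  \<comment> \<open>The entry 1 covers the case without nonzero exponents; halving the minimum makes
    the inequality strict.\<close>
  define m where "m = Min (insert 1 (abs ` (lyapunov_exponents A - {0})))"
  have fin: "finite (insert 1 (abs ` (lyapunov_exponents A - {0})))"
    using finite_lyapunov_exponents by simp
  have "m > 0" unfolding m_def using fin by (subst Min_gr_iff) auto
  moreover have "m \<le> \<bar>k\<bar>" if "k \<in> lyapunov_exponents A" "k \<noteq> 0" for k
    unfolding m_def using that fin by (intro Min_le) auto
  ultimately show ?thesis by (intro exI[of _ "m / 2"]) fastforce
qed

end

section \<open>Bounded solutions\<close>

lemma flow_bounded_on_interval: "\<exists>C>0. \<forall>\<sigma>\<in>{a..b}. \<forall>x. norm (flow A \<sigma> x) \<le> C * norm x"
proof -
  have "\<exists>K. \<forall>\<sigma>\<in>{a..b}. norm (flow A \<sigma> x) \<le> K" for x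
  proof -
    have "compact ((\<lambda>\<sigma>. flow A \<sigma> x) ` {a..b})"
      by (intro compact_continuous_image continuous_intros) auto
    then show ?thesis by (auto dest!: compact_imp_bounded simp: bounded_iff)
  qed
  then show ?thesis
    using uniform_linear_bound[of UNIV "flow A" "{a..b}", OF subspace_UNIV linear_flow] by auto
qed

lemma measurable_flow [measurable]:
  fixes A :: "real^'n^'n"
  assumes [measurable]: "h \<in> borel_measurable M" "f \<in> borel_measurable M"
  shows "(\<lambda>\<sigma>. flow A (h \<sigma>) (f \<sigma>)) \<in> borel_measurable M"
  by (rule borel_measurable_continuous_Pair[OF assms]) (intro continuous_intros)

lemma measurable_matrix_vector_mult [measurable]:
  fixes A :: "real^'n^'m"
  assumes "f \<in> borel_measurable M"
  shows "(\<lambda>\<sigma>. A *v f \<sigma>) \<in> borel_measurable M"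
proof -
  have "continuous_on UNIV (\<lambda>x. A *v x)" by (simp add: linear_continuous_on linear_conv_bounded_linear[symmetric])
  then show ?thesis using assms borel_measurable_continuous_onI measurable_compose by blast
qed

lemma bounded_linear_flow: "bounded_linear (flow A t)"
  using linear_flow linear_conv_bounded_linear by blast

lemma bounded_linear_mult: "bounded_linear (\<lambda>x. (A :: real^'n^'m) *v x)"
  by (simp add: linear_conv_bounded_linear[symmetric])

lemma flow_FTC:
  assumes "a \<le> b"
  shows "has_bochner_integral lborel (\<lambda>\<tau>. indicator {a..b} \<tau> *\<^sub>R (A *v flow A \<tau> y)) (flow A b y - flow A a y)"
proof (rule has_bochner_integral_FTC_Icc[OF assms])
  show "((\<lambda>\<tau>. flow A \<tau> y) has_vector_derivative A *v flow A x y) (at x within {a..b})" for x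
    by (rule has_vector_derivative_at_within[OF flow_deriv(1)])
  show "continuous_on {a..b} (\<lambda>x. A *v flow A x y)"
    unfolding flow_commute by (intro continuous_intros)
qed

lemma set_integrable_AE_bounded:
  fixes f :: "real \<Rightarrow> 'a::{banach, second_countable_topology}"
  assumes [measurable]: "f \<in> borel_measurable lborel" and "AE t in lborel. t \<in> {a..b} \<longrightarrow> norm (f t) \<le> M"
  shows "set_integrable lborel {a..b} f"
  unfolding set_integrable_def
proof (rule integrableI_bounded_set[of "{a..b}" _ _ M])
  show "AE x in lborel. x \<in> {a..b} \<longrightarrow> norm (indicat_real {a..b} x *\<^sub>R f x) \<le> M"
    using assms(2) by eventually_elim (auto simp: indicator_def)
  show "AE x in lborel. x \<notin> {a..b} \<longrightarrow> indicat_real {a..b} x *\<^sub>R f x = 0" by simp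
  show "emeasure lborel {a..b} < \<infinity>" by (simp add: emeasure_lborel_Icc_eq)
qed simp_all

text \<open>The inputs are only measurable, so Fubini's theorem on a triangle replaces the product rule
  in the verification of the variation of constants formula.\<close>

lemma flow_fubini:
  fixes A :: "real^'n^'n"
  assumes [measurable]: "g \<in> borel_measurable lborel" and g: "\<And>\<sigma>. norm (g \<sigma>) \<le> M" and ab: "a \<le> b"
  shows "(LINT \<tau>:{a..b}|lborel. A *v flow A \<tau> (LINT \<sigma>:{a..\<tau>}|lborel. g \<sigma>)) =
    (LINT \<sigma>:{a..b}|lborel. flow A b (g \<sigma>) - flow A \<sigma> (g \<sigma>))"
proof -
  define S where "S = {p :: real \<times> real. a \<le> snd p \<and> snd p \<le> fst p \<and> fst p \<le> b}"
  define F where "F \<tau> \<sigma> = indicator S (\<tau>, \<sigma>) *\<^sub>R (A *v flow A \<tau> (g \<sigma>))" for \<tau> \<sigma>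
  have Sm [measurable]: "S \<in> sets (borel \<Otimes>\<^sub>M borel)"
  proof -
    have "closed S" unfolding S_def
      by (intro closed_Collect_conj closed_Collect_le continuous_intros)
    then show ?thesis unfolding borel_prod by (rule borel_closed)
  qed
  obtain C where C: "C > 0" "\<And>\<sigma> x. \<sigma> \<in> {a..b} \<Longrightarrow> norm (flow A \<sigma> x) \<le> C * norm x"
    using flow_bounded_on_interval by metis
  obtain C' where C': "C' > 0" "\<And>x. norm (A *v x) \<le> C' * norm x"
    using linear_bounded_pos[of "\<lambda>x. A *v x"] by (auto simp: mult.commute)
  have M: "M \<ge> 0" using g[of 0] norm_ge_zero order_trans by blast
  have int: "integrable (lborel \<Otimes>\<^sub>M lborel) (\<lambda>(\<tau>, \<sigma>). F \<tau> \<sigma>)"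
  proof (rule integrableI_bounded_set)
    show "{a..b} \<times> {a..b} \<in> sets (lborel \<Otimes>\<^sub>M (lborel :: real measure))" by simp
    show "(\<lambda>(\<tau>, \<sigma>). F \<tau> \<sigma>) \<in> borel_measurable (lborel \<Otimes>\<^sub>M lborel)"
      unfolding F_def by measurable
    show "emeasure (lborel \<Otimes>\<^sub>M lborel) ({a..b} \<times> {a..b}) < \<infinity>"
      using ab by (simp add: lborel.emeasure_pair_measure_Times ennreal_mult[symmetric])
    show "AE x in lborel \<Otimes>\<^sub>M lborel. x \<in> {a..b} \<times> {a..b} \<longrightarrow> norm (case x of (\<tau>, \<sigma>) \<Rightarrow> F \<tau> \<sigma>) \<le> C' * (C * M)"
    proof (rule AE_I2, clarify)
      fix \<tau> \<sigma> assume \<tau>: "\<tau> \<in> {a..b}"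
      have "norm (A *v flow A \<tau> (g \<sigma>)) \<le> C' * norm (flow A \<tau> (g \<sigma>))" by (rule C')
      also have "\<dots> \<le> C' * (C * norm (g \<sigma>))" using C C' \<tau> by (intro mult_left_mono) auto
      also have "\<dots> \<le> C' * (C * M)" using C C' g by (intro mult_left_mono) auto
      finally have "norm (A *v flow A \<tau> (g \<sigma>)) \<le> C' * (C * M)" .
      moreover have "0 \<le> C' * (C * M)" using C C' M by simp
      ultimately show "norm (F \<tau> \<sigma>) \<le> C' * (C * M)" by (simp add: F_def indicator_def)
    qed
    show "AE x in lborel \<Otimes>\<^sub>M lborel. x \<notin> {a..b} \<times> {a..b} \<longrightarrow> (case x of (\<tau>, \<sigma>) \<Rightarrow> F \<tau> \<sigma>) = 0"
      by (rule AE_I2) (auto simp: F_def S_def indicator_def)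
  qed
  have 1: "(\<integral>\<sigma>. F \<tau> \<sigma> \<partial>lborel) = indicator {a..b} \<tau> *\<^sub>R (A *v flow A \<tau> (LINT \<sigma>:{a..\<tau>}|lborel. g \<sigma>))" for \<tau>
  proof (cases "\<tau> \<in> {a..b}")
    case True
    have "set_integrable lborel {a..\<tau>} g"
      by (rule set_integrable_AE_bounded[of _ _ _ M]) (simp_all add: g)
    then have "(LINT \<sigma>:{a..\<tau>}|lborel. A *v flow A \<tau> (g \<sigma>)) = A *v flow A \<tau> (LINT \<sigma>:{a..\<tau>}|lborel. g \<sigma>)"
      unfolding set_lebesgue_integral_def set_integrable_def
      by (subst integral_bounded_linear[OF bounded_linear_compose[OF bounded_linear_mult bounded_linear_flow], symmetric])
        (auto simp: flow_linear_simps linear_scale[OF matrix_vector_mul_linear])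
    moreover have "F \<tau> \<sigma> = indicator {a..\<tau>} \<sigma> *\<^sub>R (A *v flow A \<tau> (g \<sigma>))" for \<sigma>
      using True by (auto simp: F_def S_def indicator_def)
    ultimately show ?thesis using True by (simp add: set_lebesgue_integral_def)
  next
    case False
    then have "F \<tau> \<sigma> = 0" for \<sigma> by (auto simp: F_def S_def indicator_def)
    then show ?thesis using False by simp
  qed
  \<comment> \<open>Integrating over \<tau> first leaves the derivative of a single orbit on
    [\<sigma>, b], to which the fundamental theorem of calculus applies.\<close>
  have 2: "(\<integral>\<tau>. F \<tau> \<sigma> \<partial>lborel) = indicator {a..b} \<sigma> *\<^sub>R (flow A b (g \<sigma>) - flow A \<sigma> (g \<sigma>))" for \<sigma>
  proof (cases "\<sigma> \<in> {a..b}")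
    case True
    have "F \<tau> \<sigma> = indicator {\<sigma>..b} \<tau> *\<^sub>R (A *v flow A \<tau> (g \<sigma>))" for \<tau>
      using True by (auto simp: F_def S_def indicator_def)
    then show ?thesis using True has_bochner_integral_integral_eq[OF flow_FTC, of \<sigma> b A "g \<sigma>"] by simp
  next
    case False
    then have "F \<tau> \<sigma> = 0" for \<tau> by (auto simp: F_def S_def indicator_def)
    then show ?thesis using False by simp
  qed
  show ?thesis
    using lborel_pair.Fubini_integral[OF int] by (simp add: 1 2 set_lebesgue_integral_def)
qed

text \<open>Transported back by e^{-\<tau>A}, z is a constant plus the integral p of the transported
  input. The part of the integral of A z that comes from p is a double integral over a triangle,
  evaluated by the exchange of integrals above.\<close>

lemma voc_integral_equation:
  fixes A :: "real^'n^'n"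
  assumes [measurable]: "f \<in> borel_measurable lborel" and f: "AE t in lborel. norm (f t) \<le> M"
    and ab: "a \<le> b"
    and voc: "\<And>\<tau>. \<tau> \<in> {a..b} \<Longrightarrow>
      flow A (- \<tau>) (z \<tau>) = flow A (- a) (z a) + (LINT \<sigma>:{a..\<tau>}|lborel. flow A (- \<sigma>) (f \<sigma>))"
  shows "continuous_on {a..b} z"
    and "z b = z a + (LINT \<sigma>:{a..b}|lborel. A *v z \<sigma> + f \<sigma>)"
proof -
  obtain C where C: "C > 0" "\<And>\<sigma> x. \<sigma> \<in> {- b..- a} \<Longrightarrow> norm (flow A \<sigma> x) \<le> C * norm x"
    using flow_bounded_on_interval by metis
  define M' where "M' = max M 0"
  \<comment> \<open>The transported input, cut off on the null set where the bound fails, since the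
    exchange of integrals asks for a bound everywhere.\<close>
  define g where "g \<sigma> = (if \<sigma> \<in> {a..b} \<and> norm (f \<sigma>) \<le> M' then flow A (- \<sigma>) (f \<sigma>) else 0)" for \<sigma>
  have [measurable]: "g \<in> borel_measurable lborel" unfolding g_def by measurable
  have gb: "norm (g \<sigma>) \<le> C * M'" for \<sigma>
  proof (cases "\<sigma> \<in> {a..b} \<and> norm (f \<sigma>) \<le> M'")
    case True
    then have "norm (flow A (- \<sigma>) (f \<sigma>)) \<le> C * norm (f \<sigma>)" by (intro C) auto
    also have "\<dots> \<le> C * M'" using True C by (intro mult_left_mono) auto
    finally show ?thesis using True by (simp add: g_def)
  next
    case False
    then show ?thesis using C by (auto simp: g_def M'_def)
  qed
  have gf: "AE \<sigma> in lborel. \<sigma> \<in> {a..b} \<longrightarrow> g \<sigma> = flow A (- \<sigma>) (f \<sigma>)"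
    using f by eventually_elim (auto simp: g_def M'_def)
  define p where "p \<tau> = (LINT \<sigma>:{a..\<tau>}|lborel. g \<sigma>)" for \<tau>
  define c where "c = flow A (- a) (z a)"
  have ig: "set_integrable lborel {a..\<tau>} g" for \<tau>
    by (rule set_integrable_AE_bounded[of _ _ _ "C * M'"]) (simp_all add: gb)
  have pz: "z \<tau> = flow A \<tau> (c + p \<tau>)" if "\<tau> \<in> {a..b}" for \<tau>
  proof -
    have "(LINT \<sigma>:{a..\<tau>}|lborel. flow A (- \<sigma>) (f \<sigma>)) = p \<tau>"
      unfolding p_def set_lebesgue_integral_def
    proof (rule integral_cong_AE)
      show "AE x in lborel. indicat_real {a..\<tau>} x *\<^sub>R flow A (- x) (f x) = indicat_real {a..\<tau>} x *\<^sub>R g x"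
        using gf by eventually_elim (use that in \<open>auto simp: indicator_def\<close>)
    qed measurable
    then have "flow A (- \<tau>) (z \<tau>) = c + p \<tau>" using voc[OF that] by (simp add: c_def)
    then show ?thesis by (metis flow_minus(2))
  qed
  have cp: "continuous_on {a..b} p"
  proof -
    have "p \<tau> = integral {a..\<tau>} g" for \<tau>
      unfolding p_def by (rule set_borel_integral_eq_integral(2)[OF ig])
    then have "p = (\<lambda>\<tau>. integral {a..\<tau>} g)" by auto
    then show ?thesis
      using indefinite_integral_continuous_1[OF set_borel_integral_eq_integral(1)[OF ig]] by simp
  qed
  have cz: "continuous_on {a..b} (\<lambda>\<tau>. flow A \<tau> (c + p \<tau>))" by (intro continuous_intros cp)
  then show "continuous_on {a..b} z" by (rule continuous_on_eq) (simp add: pz)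
  have i1: "set_integrable lborel {a..b} (\<lambda>\<tau>. A *v flow A \<tau> c)"
    "set_integrable lborel {a..b} (\<lambda>\<tau>. A *v flow A \<tau> (p \<tau>))"
    unfolding flow_commute
    by (intro borel_integrable_atLeastAtMost' continuous_intros
        bounded_linear.continuous_on[OF bounded_linear_mult] cp)+
  have i2: "set_integrable lborel {a..b} f"
    by (rule set_integrable_AE_bounded[of _ _ _ M]) (use f in auto)
  have z_a: "flow A a c = z a" by (simp add: c_def)
  have "(LINT \<sigma>:{a..b}|lborel. A *v z \<sigma> + f \<sigma>) =
      (LINT \<sigma>:{a..b}|lborel. (A *v flow A \<sigma> c + A *v flow A \<sigma> (p \<sigma>)) + f \<sigma>)"
    by (rule set_lebesgue_integral_cong) (auto simp: pz flow_linear_simps matrix_vector_right_distrib)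
  also have "\<dots> = (LINT \<sigma>:{a..b}|lborel. A *v flow A \<sigma> c) + (LINT \<sigma>:{a..b}|lborel. A *v flow A \<sigma> (p \<sigma>))
      + (LINT \<sigma>:{a..b}|lborel. f \<sigma>)"
    using i1 i2 by (simp add: set_integral_add)
  also have "(LINT \<sigma>:{a..b}|lborel. A *v flow A \<sigma> c) = flow A b c - z a"
    using has_bochner_integral_integral_eq[OF flow_FTC[OF ab, of A c]] z_a by (simp add: set_lebesgue_integral_def)
  also have "(LINT \<sigma>:{a..b}|lborel. A *v flow A \<sigma> (p \<sigma>)) =
      (LINT \<sigma>:{a..b}|lborel. flow A b (g \<sigma>) - flow A \<sigma> (g \<sigma>))"
    unfolding p_def by (rule flow_fubini[OF _ gb ab]) measurable
  also have "\<dots> = (LINT \<sigma>:{a..b}|lborel. flow A b (g \<sigma>) - f \<sigma>)"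
    unfolding set_lebesgue_integral_def
  proof (rule integral_cong_AE)
    show "AE x in lborel. indicat_real {a..b} x *\<^sub>R (flow A b (g x) - flow A x (g x)) =
       indicat_real {a..b} x *\<^sub>R (flow A b (g x) - f x)"
      using gf by eventually_elim (auto simp: indicator_def)
  qed measurable
  also have "\<dots> = (LINT \<sigma>:{a..b}|lborel. flow A b (g \<sigma>)) - (LINT \<sigma>:{a..b}|lborel. f \<sigma>)"
  proof (intro set_integral_diff i2)
    show "set_integrable lborel {a..b} (\<lambda>\<sigma>. flow A b (g \<sigma>))"
      using integrable_bounded_linear[OF bounded_linear_flow ig[unfolded set_integrable_def], of A b b]
      by (simp add: set_integrable_def flow_linear_simps)
  qed
  also have "(LINT \<sigma>:{a..b}|lborel. flow A b (g \<sigma>)) = flow A b (p b)"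
    using integral_bounded_linear[OF bounded_linear_flow ig[unfolded set_integrable_def], of A b b]
    by (simp add: set_lebesgue_integral_def p_def flow_linear_simps)
  finally show "z b = z a + (LINT \<sigma>:{a..b}|lborel. A *v z \<sigma> + f \<sigma>)"
    using pz[of b] ab by (simp add: flow_linear_simps)
qed


lemma integrable_exp_abs:
  assumes "a > 0"
  shows "integrable lborel (\<lambda>x::real. exp (- a * \<bar>x\<bar>))"
proof -
  have 1: "integrable lborel (\<lambda>x. indicator {0..} x *\<^sub>R exp (- a * x))"
  proof -
    have "(\<integral>\<^sup>+x. ennreal (exp (- a * x)) * indicator {0..} x \<partial>lborel) = ennreal (0 - - exp (- a * 0) / a)"
    proof (rule nn_integral_FTC_atLeast[where F = "\<lambda>x. - exp (- a * x) / a"])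
      show "((\<lambda>x. - exp (- a * x) / a) has_real_derivative exp (- a * x)) (at x)" for x
        using assms by (auto intro!: derivative_eq_intros)
      show "((\<lambda>x. - exp (- a * x) / a) \<longlongrightarrow> 0) at_top"
        using assms by real_asymp
    qed auto
    moreover have "(\<integral>\<^sup>+x. ennreal (indicator {0..} x *\<^sub>R exp (- a * x)) \<partial>lborel) =
        (\<integral>\<^sup>+x. ennreal (exp (- a * x)) * indicator {0..} x \<partial>lborel)"
      by (intro nn_integral_cong) (simp add: indicator_def)
    ultimately show ?thesis by (intro integrableI_nonneg) simp_all
  qed
  have 2: "integrable lborel (\<lambda>x. indicator {0..} (0 + - 1 * x) *\<^sub>R exp (- a * (0 + - 1 * x)))"
    using lborel_integrable_real_affine[OF 1, of "- 1" 0] by simp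
  show ?thesis
    by (rule Bochner_Integration.integrable_bound[OF Bochner_Integration.integrable_add[OF 1 2]])
      (auto simp: indicator_def abs_if)
qed

section \<open>The bounded solution as a convolution\<close>

context lyapunov_scalar_product
begin

text \<open>Green's function of the hyperbolic part: convolution with it yields the bounded
  solution.\<close>

definition green :: "real \<Rightarrow> real^'n \<Rightarrow> real^'n" where
  "green \<tau> x = (if 0 \<le> \<tau> then flow A \<tau> (lproj A {..<0} x) else - flow A \<tau> (lproj A {0<..} x))"

lemma measurable_lproj [measurable]:
  "f \<in> borel_measurable M \<Longrightarrow> (\<lambda>x. lproj A I (f x)) \<in> borel_measurable M"
  using borel_measurable_continuous_onI[OF continuous_on_lproj[OF continuous_on_id]] measurable_compose by blast

lemma measurable_green [measurable]:
  assumes [measurable]: "h \<in> borel_measurable M" "f \<in> borel_measurable M"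
  shows "(\<lambda>x. green (h x) (f x)) \<in> borel_measurable M"
  unfolding green_def by measurable

lemma linear_green: "linear (green \<tau>)"
  by (rule linearI) (auto simp: green_def lproj_add lproj_scale flow_linear_simps)

text \<open>Negative exponents are followed forward and positive ones backward in time, so both
  branches decay at a rate below the smallest nonzero modulus of an exponent.\<close>

lemma green_bound: "\<exists>K>0. \<exists>a>0. \<forall>\<tau> x. norm (green \<tau> x) \<le> K * exp (- a * \<bar>\<tau>\<bar>) * norm x"
proof -
  obtain a where a: "a > 0" "\<And>k. k \<in> lyapunov_exponents A \<Longrightarrow> k \<noteq> 0 \<Longrightarrow> a < \<bar>k\<bar>"
    using hyperbolic_gap by blast
  have "\<exists>K>0. \<forall>t\<ge>0. \<forall>x\<in>lsum A {..<0}. norm (flow A t x) \<le> K * exp (- a * t) * norm x"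
    using a(2) by (intro lsum_growth_forward) force
  then obtain K1 where K1: "K1 > 0"
    "\<And>t x. t \<ge> 0 \<Longrightarrow> x \<in> lsum A {..<0} \<Longrightarrow> norm (flow A t x) \<le> K1 * exp (- a * t) * norm x" by blast
  have "\<exists>K>0. \<forall>t\<ge>0. \<forall>x\<in>lsum A {0<..}. norm (flow A (- t) x) \<le> K * exp (- a * t) * norm x"
    using a(2) by (intro lsum_growth_backward) force
  then obtain K2 where K2: "K2 > 0"
    "\<And>t x. t \<ge> 0 \<Longrightarrow> x \<in> lsum A {0<..} \<Longrightarrow> norm (flow A (- t) x) \<le> K2 * exp (- a * t) * norm x" by blast
  obtain P where P: "P > 0" "\<And>x. norm (lproj A {..<0} x) \<le> P * norm x"
    using linear_bounded_pos[OF linear_lproj] by (metis mult.commute)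
  obtain Q where Q: "Q > 0" "\<And>x. norm (lproj A {0<..} x) \<le> Q * norm x"
    using linear_bounded_pos[OF linear_lproj] by (metis mult.commute)
  have "norm (green \<tau> x) \<le> (K1 * P + K2 * Q) * exp (- a * \<bar>\<tau>\<bar>) * norm x" for \<tau> x
  proof (cases "0 \<le> \<tau>")
    case True
    have "norm (green \<tau> x) \<le> K1 * exp (- a * \<tau>) * norm (lproj A {..<0} x)"
      using True K1(2)[OF True lproj_in] by (simp add: green_def)
    also have "\<dots> \<le> K1 * exp (- a * \<tau>) * (P * norm x)" using K1 P by (intro mult_left_mono) auto
    also have "\<dots> = (K1 * P) * (exp (- a * \<bar>\<tau>\<bar>) * norm x)" using True by simp
    also have "\<dots> \<le> (K1 * P + K2 * Q) * (exp (- a * \<bar>\<tau>\<bar>) * norm x)"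
      using K2 Q by (intro mult_right_mono) auto
    finally show ?thesis by (simp add: mult.assoc)
  next
    case False
    have "norm (green \<tau> x) \<le> K2 * exp (a * \<tau>) * norm (lproj A {0<..} x)"
      using False K2(2)[OF _ lproj_in, of "- \<tau>"] by (simp add: green_def)
    also have "\<dots> \<le> K2 * exp (a * \<tau>) * (Q * norm x)" using K2 Q by (intro mult_left_mono) auto
    also have "\<dots> = (K2 * Q) * (exp (- a * \<bar>\<tau>\<bar>) * norm x)" using False by simp
    also have "\<dots> \<le> (K1 * P + K2 * Q) * (exp (- a * \<bar>\<tau>\<bar>) * norm x)"
      using K1 P by (intro mult_right_mono) auto
    finally show ?thesis by (simp add: mult.assoc)
  qed
  moreover have "K1 * P + K2 * Q > 0" using K1 K2 P Q by (simp add: add_pos_pos)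
  ultimately show ?thesis using a(1) by blast
qed

lemma green_bound_integrable:
  obtains k where "integrable lborel k" "\<And>\<tau>. 0 \<le> k \<tau>" "\<And>\<tau> x. norm (green \<tau> x) \<le> k \<tau> * norm x"
proof -
  obtain K a where K: "K > 0" "a > 0" "\<And>\<tau> x. norm (green \<tau> x) \<le> K * exp (- a * \<bar>\<tau>\<bar>) * norm x"
    using green_bound by blast
  show ?thesis
    by (rule that[of "\<lambda>\<tau>. K * exp (- a * \<bar>\<tau>\<bar>)"])
      (use K integrable_exp_abs[OF K(2)] in \<open>auto simp: less_imp_le\<close>)
qed

definition gsol :: "(real \<Rightarrow> real^'n) \<Rightarrow> real \<Rightarrow> real^'n" where
  "gsol f t = (LINT \<sigma>|lborel. green (t - \<sigma>) (f \<sigma>))"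

text \<open>The constant is the integral of a majorant of the kernel and does not depend on the
  input, its bound or the time; this later gives a bound uniform over all controls.\<close>

lemma gsol_bound:
  shows "\<exists>c. \<forall>f M t. f \<in> borel_measurable lborel \<longrightarrow> (AE \<sigma> in lborel. norm (f \<sigma>) \<le> M) \<longrightarrow>
     integrable lborel (\<lambda>\<sigma>. green (t - \<sigma>) (f \<sigma>)) \<and> norm (gsol f t) \<le> c * M"
proof -
  obtain k where k: "integrable lborel k" "\<And>\<tau>. 0 \<le> k \<tau>" "\<And>\<tau> x. norm (green \<tau> x) \<le> k \<tau> * norm x"
    using green_bound_integrable by blast
  have "integrable lborel (\<lambda>\<sigma>. green (t - \<sigma>) (f \<sigma>)) \<and> norm (gsol f t) \<le> (LINT \<tau>|lborel. k \<tau>) * M"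
    if [measurable]: "f \<in> borel_measurable lborel" and f: "AE \<sigma> in lborel. norm (f \<sigma>) \<le> M" for f M t
  proof -
    have kt: "integrable lborel (\<lambda>\<sigma>. k (t + - 1 * \<sigma>))"
      by (rule lborel_integrable_real_affine[OF k(1)]) simp
    have k_int: "(LINT \<sigma>|lborel. k (t - \<sigma>)) = (LINT \<tau>|lborel. k \<tau>)"
      using lborel_integral_real_affine[of "- 1" k t] by simp
    have bd: "AE \<sigma> in lborel. norm (green (t - \<sigma>) (f \<sigma>)) \<le> k (t - \<sigma>) * M"
      using f
    proof eventually_elim
      case (elim \<sigma>)
      have "norm (green (t - \<sigma>) (f \<sigma>)) \<le> k (t - \<sigma>) * norm (f \<sigma>)" by (rule k)
      also have "\<dots> \<le> k (t - \<sigma>) * M" by (rule mult_left_mono[OF elim k(2)])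
      finally show ?case .
    qed
    have ikM: "integrable lborel (\<lambda>\<sigma>. k (t - \<sigma>) * M)" using kt by simp
    have int: "integrable lborel (\<lambda>\<sigma>. green (t - \<sigma>) (f \<sigma>))"
      by (rule Bochner_Integration.integrable_bound[OF ikM]) (use bd in \<open>auto elim!: eventually_mono\<close>)
    have "norm (gsol f t) \<le> (LINT \<sigma>|lborel. norm (green (t - \<sigma>) (f \<sigma>)))"
      unfolding gsol_def by (rule integral_norm_bound)
    also have "\<dots> \<le> (LINT \<sigma>|lborel. k (t - \<sigma>) * M)"
      by (rule integral_mono_AE[OF integrable_norm[OF int] ikM bd])
    also have "\<dots> = (LINT \<tau>|lborel. k \<tau>) * M" by (simp add: k_int)
    finally show ?thesis using int by simp
  qed
  then show ?thesis by blast
qed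

lemma green_in_lsum: "green \<tau> x \<in> lsum A (- {0})"
proof -
  have "lproj A {..<0} x \<in> lsum A (- {0})" "lproj A {0<..} x \<in> lsum A (- {0})"
    using lproj_in[of "{..<0}" x] lproj_in[of "{0<..}" x] lsum_mono[of "{..<0}" "- {0}" A]
      lsum_mono[of "{0<..}" "- {0}" A] by auto
  then show ?thesis by (auto simp: green_def intro: lsum_flow subspace_neg)
qed

context
  fixes f :: "real \<Rightarrow> real^'n" and M :: real
  assumes f_meas [measurable]: "f \<in> borel_measurable lborel"
    and f_bd: "AE \<sigma> in lborel. norm (f \<sigma>) \<le> M"
begin

lemma integrable_green: "integrable lborel (\<lambda>\<sigma>. green (t - \<sigma>) (f \<sigma>))"
  using gsol_bound f_meas f_bd by blast

lemma gsol_in_lsum: "gsol f t \<in> lsum A (- {0})"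
proof -
  have "lproj A (- {0}) (gsol f t) = (LINT \<sigma>|lborel. lproj A (- {0}) (green (t - \<sigma>) (f \<sigma>)))"
    unfolding gsol_def by (rule integral_bounded_linear[OF bounded_linear_lproj integrable_green, symmetric])
  also have "\<dots> = gsol f t" unfolding gsol_def by (simp add: lproj_id green_in_lsum)
  finally show ?thesis using lproj_in[of "- {0}" "gsol f t"] by simp
qed

text \<open>Transported to time 0, the kernels for the times t and a coincide for \<sigma> \<le> a
  and for \<sigma> > t. In between they differ by the sum of the stable and the unstable projection,
  that is by the hyperbolic one.\<close>

lemma gsol_voc:
  assumes "a \<le> t"
  shows "flow A (- t) (gsol f t) =
    flow A (- a) (gsol f a) + (LINT \<sigma>:{a..t}|lborel. flow A (- \<sigma>) (lproj A (- {0}) (f \<sigma>)))"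
proof -
  have g: "flow A (- t) (green (t - \<sigma>) x) - flow A (- a) (green (a - \<sigma>) x) =
      indicator {a<..t} \<sigma> *\<^sub>R flow A (- \<sigma>) (lproj A (- {0}) x)" for \<sigma> x
  proof -
    have 1: "flow A (- t) (flow A (t - \<sigma>) y) = flow A (- \<sigma>) y" "flow A (- a) (flow A (a - \<sigma>) y) = flow A (- \<sigma>) y" for y
      by (simp_all flip: flow_add)
    have eq: "- {0} = {..<0} \<union> {0::real<..}" and dis: "{..<0} \<inter> {0::real<..} = {}" by auto
    have "lproj A (- {0}) x = lproj A {..<0} x + lproj A {0<..} x"
      unfolding eq by (rule lproj_Un[OF dis])
    then show ?thesis
      using assms 1 by (auto simp: green_def indicator_def flow_linear_simps)
  qed
  have i: "integrable lborel (\<lambda>\<sigma>. flow A (- s) (green (s - \<sigma>) (f \<sigma>)))" for s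
    by (rule integrable_bounded_linear[OF bounded_linear_flow integrable_green])
  have "flow A (- t) (gsol f t) - flow A (- a) (gsol f a) =
      (LINT \<sigma>|lborel. flow A (- t) (green (t - \<sigma>) (f \<sigma>)) - flow A (- a) (green (a - \<sigma>) (f \<sigma>)))"
    unfolding gsol_def
    by (simp add: i integral_bounded_linear[OF bounded_linear_flow integrable_green, symmetric])
  also have "\<dots> = (LINT \<sigma>|lborel. indicator {a<..t} \<sigma> *\<^sub>R flow A (- \<sigma>) (lproj A (- {0}) (f \<sigma>)))"
    by (simp add: g)
  also have "\<dots> = (LINT \<sigma>:{a..t}|lborel. flow A (- \<sigma>) (lproj A (- {0}) (f \<sigma>)))"
    unfolding set_lebesgue_integral_def
  proof (rule integral_cong_AE)
    show "AE \<sigma> in lborel. indicat_real {a<..t} \<sigma> *\<^sub>R flow A (- \<sigma>) (lproj A (- {0}) (f \<sigma>)) =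
      indicat_real {a..t} \<sigma> *\<^sub>R flow A (- \<sigma>) (lproj A (- {0}) (f \<sigma>))"
      using AE_lborel_singleton[of a] by eventually_elim (auto simp: indicator_def)
  qed measurable
  finally show ?thesis by (simp add: algebra_simps)
qed

lemma lproj_f_bound: "\<exists>M'. AE \<sigma> in lborel. norm (lproj A I (f \<sigma>)) \<le> M'"
proof -
  obtain P where P: "P > 0" "\<And>x. norm (lproj A I x) \<le> P * norm x"
    using linear_bounded_pos[OF linear_lproj] by (metis mult.commute)
  have "AE \<sigma> in lborel. norm (lproj A I (f \<sigma>)) \<le> P * M"
    using f_bd
  proof eventually_elim
    case (elim \<sigma>)
    then have "P * norm (f \<sigma>) \<le> P * M" using P by (intro mult_left_mono) auto
    then show ?case using P(2)[of "f \<sigma>"] by linarith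
  qed
  then show ?thesis by blast
qed

lemma gsol_integral_equation:
  shows "continuous_on UNIV (gsol f)"
    and "gsol f t = gsol f 0 + (LBINT \<sigma>=0..ereal t. A *v lproj A (- {0}) (gsol f \<sigma>) + lproj A (- {0}) (f \<sigma>))"
proof -
  obtain M' where M': "AE \<sigma> in lborel. norm (lproj A (- {0}) (f \<sigma>)) \<le> M'" using lproj_f_bound by blast
  have voc: "continuous_on {a..b} (gsol f) \<and>
      gsol f b = gsol f a + (LINT \<sigma>:{a..b}|lborel. A *v gsol f \<sigma> + lproj A (- {0}) (f \<sigma>))" if "a \<le> b" for a b
    using voc_integral_equation[OF _ M' that, where A = A and z = "gsol f"] gsol_voc by simp
  have "isCont (gsol f) t" for t
  proof -
    have "continuous_on {t - 1..t + 1} (gsol f)" using voc by simp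
    then show ?thesis by (rule continuous_on_interior) auto
  qed
  then show "continuous_on UNIV (gsol f)" by (simp add: continuous_on_eq_continuous_at)
  have p: "lproj A (- {0}) (gsol f \<sigma>) = gsol f \<sigma>" for \<sigma> by (rule lproj_id[OF gsol_in_lsum])
  show "gsol f t = gsol f 0 + (LBINT \<sigma>=0..ereal t. A *v lproj A (- {0}) (gsol f \<sigma>) + lproj A (- {0}) (f \<sigma>))"
  proof (cases "0 \<le> t")
    case True
    then show ?thesis using voc[OF True]
      by (simp add: p interval_integral_Icc zero_ereal_def)
  next
    case False
    \<comment> \<open>For negative t the equation on [t, 0] is read backwards.\<close>
    then have "t \<le> 0" by simp
    from voc[OF this] show ?thesis using False
      by (subst interval_integral_endpoints_reverse) (simp add: p interval_integral_Icc zero_ereal_def)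
  qed
qed

end

text \<open>Translation invariance of Lebesgue measure. Equality almost everywhere is the right
  hypothesis because shifted controls are equivalence classes.\<close>

lemma gsol_shift:
  assumes [measurable]: "f \<in> borel_measurable lborel" "g \<in> borel_measurable lborel"
    and "AE \<sigma> in lborel. g \<sigma> = f (t + \<sigma>)"
  shows "gsol g 0 = gsol f t"
proof -
  have "gsol g 0 = (LINT \<sigma>|lborel. green (0 - \<sigma>) (f (t + \<sigma>)))"
    unfolding gsol_def by (rule integral_cong_AE) (use assms(3) in \<open>auto elim!: eventually_mono\<close>)
  also have "\<dots> = gsol f t"
    unfolding gsol_def using lborel_integral_real_affine[of 1 "\<lambda>\<sigma>. green (t - \<sigma>) (f \<sigma>)" t] by simp
  finally show ?thesis .
qed

end

section \<open>The Poincare sphere\<close>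

text \<open>A weak form of Jordan's inequality, from the cubic Taylor remainder and x^2 \<le> 3 on
  the interval. It bounds an arc of a great circle by twice its chord.\<close>

lemma sin_ge_half:
  assumes "0 \<le> x" "x \<le> pi / 2"
  shows "x / 2 \<le> sin (x::real)"
proof -
  have "\<bar>sin x - (\<Sum>m<3. sin_coeff m * x ^ m)\<bar> \<le> inverse (fact 3) * \<bar>x\<bar> ^ 3"
    by (rule Maclaurin_sin_bound)
  then have "\<bar>sin x - x\<bar> * 6 \<le> x * (x * x)"
    using assms by (simp add: sin_coeff_def eval_nat_numeral)
  have "x \<le> 1.6" using assms pi_approx by simp
  then have "x * x \<le> 1.6 * 1.6" using assms by (intro mult_mono) auto
  then have "x * (x * x) \<le> x * 3" using assms by (intro mult_left_mono) auto
  with \<open>\<bar>sin x - x\<bar> * 6 \<le> x * (x * x)\<close> have "\<bar>sin x - x\<bar> * 6 \<le> x * 3" by (rule order_trans)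
  then have "\<bar>sin x - x\<bar> \<le> x / 2" by simp
  from abs_le_D2[OF this] show ?thesis by simp
qed

locale scalar_product =
  fixes ip :: "real^'n \<Rightarrow> real^'n \<Rightarrow> real"
  assumes is_sp: "is_scalar_product ip"
begin

lemma bilinear_lift: "bilinear (ip_lift ip)"
proof -
  have b: "bilinear ip" using is_sp by (simp add: is_scalar_product_def)
  show ?thesis
    unfolding bilinear_def
    by (auto intro!: linearI simp: ip_lift_def bilinear_ladd[OF b] bilinear_radd[OF b] bilinear_lmul[OF b]
        bilinear_rmul[OF b] algebra_simps)
qed

lemmas lift_simps = bilinear_ladd[OF bilinear_lift] bilinear_radd[OF bilinear_lift]
  bilinear_lmul[OF bilinear_lift] bilinear_rmul[OF bilinear_lift] bilinear_lzero[OF bilinear_lift]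
  bilinear_rzero[OF bilinear_lift] bilinear_lsub[OF bilinear_lift] bilinear_rsub[OF bilinear_lift]
  bilinear_lneg[OF bilinear_lift] bilinear_rneg[OF bilinear_lift]

lemma lift_sym: "ip_lift ip p q = ip_lift ip q p"
  using is_sp by (simp add: ip_lift_def is_scalar_product_def mult.commute)

lemma lift_pos: "p \<noteq> 0 \<Longrightarrow> ip_lift ip p p > 0"
proof -
  assume "p \<noteq> 0"
  have b: "bilinear ip" using is_sp by (simp add: is_scalar_product_def)
  show ?thesis
  proof (cases "fst p = 0")
    case True
    then have "snd p \<noteq> 0" using \<open>p \<noteq> 0\<close> by (simp add: prod_eq_iff)
    then show ?thesis using True by (simp add: ip_lift_def bilinear_lzero[OF b] flip: power2_eq_square)
  next
    case False
    then have "ip (fst p) (fst p) > 0" using is_sp by (simp add: is_scalar_product_def)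
    then show ?thesis by (simp add: ip_lift_def add_pos_nonneg)
  qed
qed

lemma lift_nonneg: "ip_lift ip p p \<ge> 0"
  using lift_pos[of p] by (cases "p = 0") (auto simp: lift_simps)

lemma nrm_square: "(nrm ip p)\<^sup>2 = ip_lift ip p p"
  by (simp add: nrm_def lift_nonneg)

lemma nrm_nonneg [simp]: "0 \<le> nrm ip p" by (simp add: nrm_def lift_nonneg)

lemma nrm_eq_0_iff [simp]: "nrm ip p = 0 \<longleftrightarrow> p = 0"
  using lift_pos[of p] by (cases "p = 0") (auto simp: nrm_def lift_simps)

lemma nrm_0 [simp]: "nrm ip 0 = 0" by simp

lemma nrm_pos: "p \<noteq> 0 \<Longrightarrow> 0 < nrm ip p"
  using nrm_nonneg[of p] nrm_eq_0_iff[of p] by linarith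

lemma nrm_scale: "nrm ip (c *\<^sub>R p) = \<bar>c\<bar> * nrm ip p"
  by (simp add: nrm_def lift_simps real_sqrt_mult mult.assoc[symmetric])

lemma nrm_minus: "nrm ip (- p) = nrm ip p"
  using nrm_scale[of "- 1" p] by simp

lemma lift_CS: "\<bar>ip_lift ip p q\<bar> \<le> nrm ip p * nrm ip q"
proof (cases "q = 0")
  case False
  define a where "a = ip_lift ip p q / ip_lift ip q q"
  have q: "ip_lift ip q q > 0" by (rule lift_pos[OF False])
  have "0 \<le> ip_lift ip (p - a *\<^sub>R q) (p - a *\<^sub>R q)" by (rule lift_nonneg)
  also have "\<dots> = ip_lift ip p p - a * ip_lift ip p q"
    using q by (simp add: lift_simps lift_sym[of q p] a_def field_simps)
  finally have "(ip_lift ip p q)\<^sup>2 \<le> ip_lift ip p p * ip_lift ip q q"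
    using q by (simp add: a_def field_simps power2_eq_square)
  also have "\<dots> = (nrm ip p * nrm ip q)\<^sup>2" by (simp add: power_mult_distrib nrm_square)
  finally show ?thesis
    using abs_le_square_iff[of "ip_lift ip p q" "nrm ip p * nrm ip q"] by simp
qed (simp add: lift_simps)

lemma nrm_triangle: "nrm ip (p + q) \<le> nrm ip p + nrm ip q"
proof (rule power2_le_imp_le)
  have "(nrm ip (p + q))\<^sup>2 = (nrm ip p)\<^sup>2 + 2 * ip_lift ip p q + (nrm ip q)\<^sup>2"
    by (simp add: nrm_square lift_simps lift_sym[of q p])
  also have "\<dots> \<le> (nrm ip p)\<^sup>2 + 2 * (nrm ip p * nrm ip q) + (nrm ip q)\<^sup>2"
    using lift_CS[of p q] by simp
  finally show "(nrm ip (p + q))\<^sup>2 \<le> (nrm ip p + nrm ip q)\<^sup>2" by (simp add: power2_sum)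
qed simp

lemma bounded_bilinear_lift: "bounded_bilinear (ip_lift ip)"
  using bilinear_lift bilinear_conv_bounded_bilinear by blast

lemma continuous_on_lift [continuous_intros]:
  "continuous_on S f \<Longrightarrow> continuous_on S g \<Longrightarrow> continuous_on S (\<lambda>x. ip_lift ip (f x) (g x))"
  by (rule bounded_bilinear.continuous_on[OF bounded_bilinear_lift])

lemma continuous_on_nrm [continuous_intros]:
  "continuous_on S f \<Longrightarrow> continuous_on S (\<lambda>x. nrm ip (f x))"
  unfolding nrm_def by (intro continuous_intros)

lemma nrm_norm_equiv:
  obtains c C where "c > 0" "C > 0" "\<And>p. c * norm p \<le> nrm ip p" "\<And>p. nrm ip p \<le> C * norm p"
proof -
  define S where "S = sphere (0 :: (real^'n) \<times> real) 1"
  have S: "compact S" "S \<noteq> {}" by (auto simp: S_def)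
  have cont: "continuous_on S (nrm ip)" by (intro continuous_intros)
  obtain m where m: "m \<in> S" "\<And>p. p \<in> S \<Longrightarrow> nrm ip m \<le> nrm ip p"
    using continuous_attains_inf[OF S cont] by blast
  obtain k where k: "k \<in> S" "\<And>p. p \<in> S \<Longrightarrow> nrm ip p \<le> nrm ip k"
    using continuous_attains_sup[OF S cont] by blast
  have eq: "nrm ip p = norm p * nrm ip (p /\<^sub>R norm p)" if "p \<noteq> 0" for p
    using that by (simp add: nrm_scale)
  have in_S: "p /\<^sub>R norm p \<in> S" if "p \<noteq> 0" for p using that by (simp add: S_def)
  have "nrm ip m * norm p \<le> nrm ip p" for p
    using m(2)[OF in_S, of p] eq[of p] by (cases "p = 0") (auto simp: mult.commute mult_left_mono)
  moreover have "nrm ip p \<le> nrm ip k * norm p" for p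
    using k(2)[OF in_S, of p] eq[of p] by (cases "p = 0") (auto simp: mult.commute mult_left_mono)
  moreover have "m \<noteq> 0" "k \<noteq> 0" using m k by (auto simp: S_def)
  ultimately show ?thesis using nrm_pos that by blast
qed

lemma psphere_nonzero: "p \<in> psphere ip \<Longrightarrow> p \<noteq> 0"
  using nrm_eq_0_iff[of p] by (auto simp: psphere_def)

lemma lift_psphere: "p \<in> psphere ip \<Longrightarrow> ip_lift ip p p = 1"
  using nrm_square[of p] by (simp add: psphere_def)

lemma sproj_in_psphere: "p \<noteq> 0 \<Longrightarrow> sproj ip p \<in> psphere ip"
  using nrm_pos[of p] by (simp add: sproj_def psphere_def nrm_scale)

lemma sproj_scale: "c > 0 \<Longrightarrow> sproj ip (c *\<^sub>R p) = sproj ip p"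
  by (simp add: sproj_def nrm_scale)

lemma linear_tproj: "linear (tproj ip s)"
  by (rule linearI) (simp_all add: tproj_def lift_simps algebra_simps)

lemma tproj_self: "s \<in> psphere ip \<Longrightarrow> tproj ip s s = 0"
  by (simp add: tproj_def lift_psphere)

text \<open>Normalizing s + w moves it by the difference of its length from 1, which is at most the
  length of w; w itself contributes the other half.\<close>

lemma nrm_sproj_diff_le:
  assumes "s \<in> psphere ip" "s + w \<noteq> 0"
  shows "nrm ip (sproj ip (s + w) - s) \<le> 2 * nrm ip w"
proof -
  define m where "m = nrm ip (s + w)"
  have m: "m > 0" using nrm_pos assms by (simp add: m_def)
  have s: "nrm ip s = 1" using assms by (simp add: psphere_def)
  have "m \<le> 1 + nrm ip w" unfolding m_def s[symmetric] by (rule nrm_triangle)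
  moreover have "1 \<le> m + nrm ip w"
    using nrm_triangle[of "s + w" "- w"] s by (simp add: m_def nrm_minus)
  ultimately have 1: "\<bar>1 - m\<bar> \<le> nrm ip w" by simp
  have "sproj ip (s + w) - s = ((1 - m) / m) *\<^sub>R (s + w) + w"
    using m by (simp add: sproj_def m_def[symmetric] divide_inverse left_diff_distrib scaleR_diff_left)
  then have "nrm ip (sproj ip (s + w) - s) \<le> \<bar>(1 - m) / m\<bar> * m + nrm ip w"
    using nrm_triangle[of "((1 - m) / m) *\<^sub>R (s + w)" w] by (simp add: nrm_scale m_def)
  also have "\<bar>(1 - m) / m\<bar> * m = \<bar>1 - m\<bar>" using m by (simp add: abs_divide)
  finally show ?thesis using 1 by simp
qed

lemma has_derivative_sproj:
  assumes "q \<noteq> 0"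
  shows "(sproj ip has_derivative (\<lambda>v. tproj ip (sproj ip q) v /\<^sub>R nrm ip q)) (at q)"
proof -
  define m where "m = nrm ip q"
  have m: "m > 0" using assms nrm_pos by (simp add: m_def)
  have 1: "((\<lambda>p. ip_lift ip p p) has_derivative (\<lambda>v. 2 * ip_lift ip q v)) (at q)"
  proof -
    have "ip_lift ip q v + ip_lift ip v q = 2 * ip_lift ip q v" for v using lift_sym[of v q] by simp
    moreover have "((\<lambda>p. ip_lift ip p p) has_derivative (\<lambda>v. ip_lift ip q v + ip_lift ip v q)) (at q)"
      by (rule bounded_bilinear.FDERIV[OF bounded_bilinear_lift has_derivative_ident has_derivative_ident])
    ultimately show ?thesis by (simp only:)
  qed
  have "((\<lambda>p. sqrt (ip_lift ip p p)) has_derivative (\<lambda>v. (inverse (sqrt (ip_lift ip q q)) / 2) * (2 * ip_lift ip q v))) (at q)"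
    using has_derivative_compose[OF 1 DERIV_real_sqrt[OF lift_pos[OF assms], THEN has_field_derivative_imp_has_derivative]]
    by simp
  note d0 = this
  have 2: "(nrm ip has_derivative (\<lambda>v. ip_lift ip q v / m)) (at q)"
  proof -
    have "inverse (sqrt (ip_lift ip q q)) / 2 * (2 * ip_lift ip q v) = ip_lift ip q v / m" for v
      by (simp add: m_def nrm_def inverse_eq_divide)
    moreover have "nrm ip = (\<lambda>p. sqrt (ip_lift ip p p))" by (simp add: nrm_def fun_eq_iff)
    ultimately show ?thesis
      using d0 by (simp only:)
  qed
  have 3: "((\<lambda>p. inverse (nrm ip p)) has_derivative (\<lambda>v. - (inverse m * (ip_lift ip q v / m) * inverse m))) (at q)"
    using Deriv.has_derivative_inverse[OF _ 2] assms by (simp add: m_def)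
  have 4: "((\<lambda>p. inverse (nrm ip p) *\<^sub>R p) has_derivative
      (\<lambda>v. inverse m *\<^sub>R v + (- (inverse m * (ip_lift ip q v / m) * inverse m)) *\<^sub>R q)) (at q)"
    using has_derivative_scaleR[OF 3 has_derivative_ident] by (simp add: m_def)
  have "inverse m *\<^sub>R v + (- (inverse m * (ip_lift ip q v / m) * inverse m)) *\<^sub>R q =
     tproj ip (sproj ip q) v /\<^sub>R nrm ip q" for v
    using m by (simp add: tproj_def sproj_def m_def[symmetric] lift_simps lift_sym[of v q]
        scaleR_diff_right field_simps)
  then show ?thesis using 4 by (simp add: sproj_def[abs_def])
qed

text \<open>The velocity is integrated against the fixed direction w = q - p, and Cauchy-Schwarz
  bounds the integrand by speed times the length of w. This avoids norm estimates for integrals in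
  the nonstandard norm.\<close>

lemma riem_dist_bound_below_length:
  assumes c: "c piecewise_C1_differentiable_on {0..1}" "c 0 = p" "c 1 = q"
    and i: "(\<lambda>t. nrm ip (vector_derivative c (at t))) integrable_on {0..1}"
  shows "nrm ip (p - q) \<le> integral {0..1} (\<lambda>t. nrm ip (vector_derivative c (at t)))" (is "_ \<le> ?I")
proof -
  define w where "w = q - p"
  obtain S where S: "continuous_on {0..1} c" "finite S" "c C1_differentiable_on ({0..1} - S)"
    using c unfolding piecewise_C1_differentiable_on_def by blast
  obtain D where D: "\<And>x. x \<in> {0..1} - S \<Longrightarrow> (c has_vector_derivative D x) (at x)"
    using S(3) unfolding C1_differentiable_on_def by blast
  have "((\<lambda>t. vector_derivative c (at t)) has_integral (c 1 - c 0)) {0..1}"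
  proof (rule fundamental_theorem_of_calculus_interior_strong[OF S(2) _ _ S(1)])
    fix x assume "x \<in> {0<..<1} - S"
    then have "(c has_vector_derivative D x) (at x)" using D by auto
    then show "(c has_vector_derivative vector_derivative c (at x)) (at x)"
      by (simp add: vector_derivative_at)
  qed simp
  then have "((\<lambda>t. ip_lift ip (vector_derivative c (at t)) w) has_integral ip_lift ip w w) {0..1}"
    using has_integral_linear[OF _ bounded_bilinear.bounded_linear_left[OF bounded_bilinear_lift, of w]]
    by (simp add: o_def w_def c)
  moreover have "((\<lambda>t. nrm ip (vector_derivative c (at t)) * nrm ip w) has_integral ?I * nrm ip w) {0..1}"
    using has_integral_mult_left[OF integrable_integral[OF i]] by simp
  ultimately have "ip_lift ip w w \<le> ?I * nrm ip w"
    by (rule has_integral_le) (rule order_trans[OF abs_ge_self lift_CS])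
  then have "nrm ip w * nrm ip w \<le> ?I * nrm ip w"
    by (simp add: nrm_square[symmetric] power2_eq_square)
  then have "nrm ip w \<le> ?I"
  proof (cases "w = 0")
    case True
    have "0 \<le> ?I" by (rule integral_nonneg[OF i]) simp
    then show ?thesis using True by (simp add: nrm_eq_0_iff[THEN iffD2])
  next
    case False
    then show ?thesis using \<open>nrm ip w * nrm ip w \<le> _\<close> nrm_pos by simp
  qed
  then show ?thesis using nrm_minus[of w] by (simp add: w_def)
qed

lemma ex_great_circle:
  assumes p: "p \<in> psphere ip" and q: "q \<in> psphere ip"
  shows "\<exists>e. ip_lift ip e p = 0 \<and> ip_lift ip e e = 1 \<and>
    q = ip_lift ip p q *\<^sub>R p + sqrt (1 - (ip_lift ip p q)\<^sup>2) *\<^sub>R e"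
proof -
  define a where "a = ip_lift ip p q"
  define d where "d = q - a *\<^sub>R p"
  have dp: "ip_lift ip d p = 0"
    using p by (simp add: d_def lift_simps lift_psphere a_def lift_sym)
  have dd: "ip_lift ip d d = 1 - a\<^sup>2"
    using p q by (simp add: d_def lift_simps lift_psphere a_def[symmetric] lift_sym[of q p] power2_eq_square)
  show ?thesis
  proof (cases "d = 0")
    case False
    then have pos: "1 - a\<^sup>2 > 0" using lift_pos dd by metis
    have s: "sqrt (1 - a\<^sup>2) > 0" "sqrt (1 - a\<^sup>2) * sqrt (1 - a\<^sup>2) = 1 - a\<^sup>2" using pos by auto
    define e where "e = d /\<^sub>R sqrt (1 - a\<^sup>2)"
    have "ip_lift ip e p = 0" by (simp add: e_def lift_simps dp)
    moreover have "ip_lift ip e e = 1"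
      using s by (simp add: e_def lift_simps dd field_simps)
    moreover have "q = a *\<^sub>R p + sqrt (1 - a\<^sup>2) *\<^sub>R e" using s by (simp add: e_def d_def)
    ultimately show ?thesis unfolding a_def by blast
  next
    case True
    then have a1: "a\<^sup>2 = 1" using dd by (simp add: lift_simps)
    \<comment> \<open>Here q = p or q = -p, and every unit vector orthogonal to p will do; one
      exists because the lifted space has dimension at least 2.\<close>
    have "\<exists>b. b - ip_lift ip b p *\<^sub>R p \<noteq> 0"
    proof (rule ccontr)
      assume "\<nexists>b. b - ip_lift ip b p *\<^sub>R p \<noteq> 0"
      then have "b \<in> span {p}" for b :: "(real^'n) \<times> real"
        by (metis eq_iff_diff_eq_0 span_base span_scale singletonI)
      then have "span {p} = (UNIV :: ((real^'n) \<times> real) set)" by auto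
      then have "DIM((real^'n) \<times> real) \<le> card {p}"
        by (metis dim_UNIV dim_le_card finite.emptyI finite.insertI subset_refl)
      then show False by simp
    qed
    then obtain b where b: "b - ip_lift ip b p *\<^sub>R p \<noteq> 0" by blast
    define f where "f = b - ip_lift ip b p *\<^sub>R p"
    have fp: "ip_lift ip f p = 0" using p by (simp add: f_def lift_simps lift_psphere)
    have fn: "nrm ip f > 0" using b nrm_pos by (simp add: f_def)
    have "ip_lift ip (sproj ip f) (sproj ip f) = 1"
      using sproj_in_psphere[of f] lift_psphere b by (simp add: f_def)
    moreover have "ip_lift ip (sproj ip f) p = 0" using fp by (simp add: sproj_def lift_simps)
    moreover have "q = a *\<^sub>R p + sqrt (1 - a\<^sup>2) *\<^sub>R sproj ip f" using True a1 by (simp add: d_def)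
    ultimately show ?thesis unfolding a_def by blast
  qed
qed

text \<open>A curve is at least as long as its chord, and the great circle arc of angle \<theta> has
  chord 2 sin(\<theta>/2) \<ge> \<theta>/2. Through this comparison all estimates of the Riemannian
  distance reduce to the norm.\<close>

lemma riem_dist_bounds:
  assumes p: "p \<in> psphere ip" and q: "q \<in> psphere ip"
  shows "nrm ip (p - q) \<le> riem_dist ip p q" "riem_dist ip p q \<le> 2 * nrm ip (p - q)"
proof -
  define a where "a = ip_lift ip p q"
  obtain e where e: "ip_lift ip e p = 0" "ip_lift ip e e = 1" "q = a *\<^sub>R p + sqrt (1 - a\<^sup>2) *\<^sub>R e"
    using ex_great_circle[OF p q] unfolding a_def by blast
  have pp: "ip_lift ip p p = 1" and qq: "ip_lift ip q q = 1" using p q lift_psphere by auto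
  have "\<bar>a\<bar> \<le> 1" using lift_CS[of p q] p q by (simp add: a_def psphere_def)
  then have a: "- 1 \<le> a" "a \<le> 1" by auto
  define \<theta> where "\<theta> = arccos a"
  have \<theta>: "0 \<le> \<theta>" "\<theta> \<le> pi" "cos \<theta> = a" "sin \<theta> = sqrt (1 - a\<^sup>2)"
    using a by (auto simp: \<theta>_def arccos_lbound arccos_ubound sin_arccos)
  define c where "c t = cos (\<theta> * t) *\<^sub>R p + sin (\<theta> * t) *\<^sub>R e" for t
  define c' where "c' t = \<theta> *\<^sub>R (cos (\<theta> * t) *\<^sub>R e - sin (\<theta> * t) *\<^sub>R p)" for t
  have d: "(c has_vector_derivative c' t) (at t)" for t
    unfolding c_def c'_def has_vector_derivative_def
    by (auto intro!: derivative_eq_intros simp: algebra_simps)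
  have C1: "c piecewise_C1_differentiable_on {0..1}"
  proof (rule C1_differentiable_imp_piecewise)
    show "c C1_differentiable_on {0..1}"
      unfolding C1_differentiable_on_def
      by (intro exI[of _ c'] conjI ballI d) (auto simp: c'_def intro!: continuous_intros)
  qed
  have "ip_lift ip (c t) (c t) = 1" for t
    by (simp add: c_def lift_simps e pp lift_sym[of p e] power2_eq_square[symmetric])
  then have c_in: "c ` {0..1} \<subseteq> psphere ip" by (auto simp: psphere_def nrm_def)
  have "ip_lift ip (c' t) (c' t) = \<theta>\<^sup>2" for t
  proof -
    have "ip_lift ip (c' t) (c' t) = \<theta> * \<theta> * (cos (\<theta> * t) * cos (\<theta> * t) + sin (\<theta> * t) * sin (\<theta> * t))"
      by (simp add: c'_def lift_simps e pp lift_sym[of p e] algebra_simps del: sin_cos_squared_add3)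
    then show ?thesis by (simp add: power2_eq_square)
  qed
  then have "nrm ip (c' t) = \<theta>" for t using \<theta> by (simp add: nrm_def)
  then have sp: "(\<lambda>t. nrm ip (vector_derivative c (at t))) = (\<lambda>_. \<theta>)"
    using vector_derivative_at[OF d] by auto
  define L where "L = {integral {0..1} (\<lambda>t. nrm ip (vector_derivative c (at t))) | c.
            c piecewise_C1_differentiable_on {0..1} \<and> c ` {0..1} \<subseteq> psphere ip \<and>
            c 0 = p \<and> c 1 = q \<and>
            (\<lambda>t. nrm ip (vector_derivative c (at t))) integrable_on {0..1}}"
  have lower: "nrm ip (p - q) \<le> x" if "x \<in> L" for x
    using that riem_dist_bound_below_length unfolding L_def by blast
  have "c 0 = p" "c 1 = q" using e(3) \<theta> by (auto simp: c_def)
  then have "integral {0..1} (\<lambda>t. nrm ip (vector_derivative c (at t))) \<in> L"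
    unfolding L_def using C1 c_in by (intro CollectI exI[of _ c] conjI refl) (auto simp: sp)
  then have L: "\<theta> \<in> L" unfolding sp by simp
  show "nrm ip (p - q) \<le> riem_dist ip p q"
    unfolding riem_dist_def L_def[symmetric] using L lower by (intro cInf_greatest) auto
  have "riem_dist ip p q \<le> \<theta>"
    unfolding riem_dist_def L_def[symmetric] using L lower by (intro cInf_lower bdd_belowI) auto
  also have "\<theta> \<le> 2 * nrm ip (p - q)"
  proof -
    have "(nrm ip (p - q))\<^sup>2 = 2 - 2 * a"
      by (simp add: nrm_square lift_simps pp qq a_def lift_sym[of q p])
    also have "\<dots> = (2 * sin (\<theta> / 2))\<^sup>2"
      using cos_double_sin[of "\<theta> / 2"] \<theta> by (simp add: power_mult_distrib)
    finally have "nrm ip (p - q) = 2 * sin (\<theta> / 2)"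
      using \<theta> by (intro power2_eq_imp_eq[of "nrm ip (p - q)"]) (auto intro!: sin_ge_zero)
    then show ?thesis using sin_ge_half[of "\<theta> / 2"] \<theta> by simp
  qed
  finally show "riem_dist ip p q \<le> 2 * nrm ip (p - q)" .
qed

end

section \<open>Invariance of chain transitive sets\<close>

sublocale lyapunov_scalar_product \<subseteq> scalar_product ip
  by unfold_locales (rule sp)

lemma has_chain_trans:
  assumes "has_chain X d \<psi> \<epsilon> T x y" "has_chain X d \<psi> \<epsilon> T y z"
  shows "has_chain X d \<psi> \<epsilon> T x z"
proof -
  obtain k xs ts where 1: "k \<ge> 1" "xs 0 = x" "xs k = y" "\<forall>i\<le>k. xs i \<in> X"
      "\<forall>i<k. ts i \<ge> T \<and> d (\<psi> (ts i) (xs i)) (xs (Suc i)) < \<epsilon>"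
    using assms(1) unfolding has_chain_def by blast
  obtain m ys rs where 2: "m \<ge> 1" "ys 0 = y" "ys m = z" "\<forall>i\<le>m. ys i \<in> X"
      "\<forall>i<m. rs i \<ge> T \<and> d (\<psi> (rs i) (ys i)) (ys (Suc i)) < \<epsilon>"
    using assms(2) unfolding has_chain_def by blast
  define xs' where "xs' i = (if i \<le> k then xs i else ys (i - k))" for i
  define ts' where "ts' i = (if i < k then ts i else rs (i - k))" for i
  have "ts' i \<ge> T \<and> d (\<psi> (ts' i) (xs' i)) (xs' (Suc i)) < \<epsilon>" if "i < k + m" for i
  proof (cases "i < k")
    case True
    then show ?thesis using 1 by (simp add: xs'_def ts'_def)
  next
    case False
    then have "i - k < m" "xs' i = ys (i - k)" "xs' (Suc i) = ys (Suc (i - k))" "ts' i = rs (i - k)"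
      using that 1 2 by (auto simp: xs'_def ts'_def Suc_diff_le)
    then show ?thesis using 2 by simp
  qed
  moreover have "xs' i \<in> X" if "i \<le> k + m" for i
    using that 1 2 by (auto simp: xs'_def)
  ultimately show ?thesis
    unfolding has_chain_def using 1 2
    by (intro exI[of _ "k + m"] exI[of _ xs'] exI[of _ ts']) (auto simp: xs'_def)
qed

text \<open>A chain with times at least T + t can afford to have its first time shortened by
  t.\<close>

lemma has_chain_shift_start:
  assumes "has_chain X d \<psi> \<epsilon> (T + t) x y" "t \<ge> 0" "x \<in> X"
    and "\<And>s z. z \<in> X \<Longrightarrow> \<psi> s z \<in> X"
    and add: "\<And>r s z. z \<in> X \<Longrightarrow> \<psi> r (\<psi> s z) = \<psi> (r + s) z"
  shows "has_chain X d \<psi> \<epsilon> T (\<psi> t x) y"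
proof -
  obtain k xs ts where 1: "k \<ge> 1" "xs 0 = x" "xs k = y" "\<And>i. i \<le> k \<Longrightarrow> xs i \<in> X"
      "\<And>i. i < k \<Longrightarrow> ts i \<ge> T + t" "\<And>i. i < k \<Longrightarrow> d (\<psi> (ts i) (xs i)) (xs (Suc i)) < \<epsilon>"
    using assms(1) unfolding has_chain_def by blast
  define xs' where "xs' i = (if i = 0 then \<psi> t x else xs i)" for i
  define ts' where "ts' i = (if i = 0 then ts 0 - t else ts i)" for i
  have "ts' i \<ge> T \<and> d (\<psi> (ts' i) (xs' i)) (xs' (Suc i)) < \<epsilon>" if "i < k" for i
  proof (cases "i = 0")
    case True
    have "\<psi> (ts 0 - t) (\<psi> t x) = \<psi> (ts 0) x" using add[OF assms(3), of "ts 0 - t" t] by simp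
    then show ?thesis using True 1(2) 1(5)[OF that] 1(6)[OF that] by (simp add: xs'_def ts'_def)
  next
    case False
    then show ?thesis using 1(5)[OF that] 1(6)[OF that] assms(2) by (simp add: xs'_def ts'_def)
  qed
  moreover have "xs' i \<in> X" if "i \<le> k" for i
    using that 1 assms by (simp add: xs'_def)
  ultimately show ?thesis
    unfolding has_chain_def using 1
    by (intro exI[of _ k] exI[of _ xs'] exI[of _ ts']) (auto simp: xs'_def)
qed

text \<open>The last time is lengthened by t. The last jump is then controlled by continuity of the
  time-t map at y, for which the given chain is taken with a smaller tolerance.\<close>

lemma has_chain_shift_end:
  assumes chain: "\<And>\<epsilon> T. \<epsilon> > 0 \<Longrightarrow> T > 0 \<Longrightarrow> has_chain X d \<psi> \<epsilon> T x y"
    and t: "t \<ge> 0" and y: "y \<in> X" and inv: "\<And>s z. z \<in> X \<Longrightarrow> \<psi> s z \<in> X"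
    and add: "\<And>r s z. z \<in> X \<Longrightarrow> \<psi> r (\<psi> s z) = \<psi> (r + s) z"
    and cont: "\<And>\<epsilon>. \<epsilon> > 0 \<Longrightarrow> \<exists>\<delta>>0. \<forall>z\<in>X. d z y < \<delta> \<longrightarrow> d (\<psi> t z) (\<psi> t y) < \<epsilon>"
    and \<epsilon>: "\<epsilon> > (0::real)" and T: "T > (0::real)"
  shows "has_chain X d \<psi> \<epsilon> T x (\<psi> t y)"
proof -
  obtain \<delta> where \<delta>: "\<delta> > 0" "\<And>z. z \<in> X \<Longrightarrow> d z y < \<delta> \<Longrightarrow> d (\<psi> t z) (\<psi> t y) < \<epsilon>"
    using cont[OF \<epsilon>] by blast
  obtain k xs ts where 1: "k \<ge> 1" "xs 0 = x" "xs k = y" "\<And>i. i \<le> k \<Longrightarrow> xs i \<in> X"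
      "\<And>i. i < k \<Longrightarrow> ts i \<ge> T" "\<And>i. i < k \<Longrightarrow> d (\<psi> (ts i) (xs i)) (xs (Suc i)) < min \<delta> \<epsilon>"
  proof -
    have "has_chain X d \<psi> (min \<delta> \<epsilon>) T x y" using \<delta>(1) \<epsilon> T by (intro chain) simp_all
    then show ?thesis using that unfolding has_chain_def by blast
  qed
  define xs' where "xs' i = (if i = k then \<psi> t y else xs i)" for i
  define ts' where "ts' i = (if Suc i = k then ts i + t else ts i)" for i
  have "ts' i \<ge> T \<and> d (\<psi> (ts' i) (xs' i)) (xs' (Suc i)) < \<epsilon>" if "i < k" for i
  proof (cases "Suc i = k")
    case True
    have "\<psi> (ts i + t) (xs i) = \<psi> t (\<psi> (ts i) (xs i))"
      using add[of "xs i" t "ts i"] 1(4)[of i] that by (simp add: add.commute)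
    moreover have "d (\<psi> t (\<psi> (ts i) (xs i))) (\<psi> t y) < \<epsilon>"
      using \<delta>(2)[OF inv] 1(4)[of i] 1(6)[OF that] 1(3) True by auto
    ultimately show ?thesis using True t 1(5)[OF that] by (auto simp: xs'_def ts'_def)
  next
    case False
    then show ?thesis using 1(5,6)[OF that] that by (simp add: xs'_def ts'_def)
  qed
  moreover have "xs' i \<in> X" if "i \<le> k" for i
    using that 1 inv y by (simp add: xs'_def)
  ultimately show ?thesis
    unfolding has_chain_def using 1
    by (intro exI[of _ k] exI[of _ xs'] exI[of _ ts']) (auto simp: xs'_def)
qed

text \<open>Adding the image of x to M preserves chain transitivity, because chains from and to x
  can be redirected to it; maximality then puts the image into M.\<close>

lemma maximal_chain_transitive_invariant:
  assumes M: "maximal_chain_transitive X d \<psi> M" and x: "x \<in> M" and t: "t \<ge> 0"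
    and inv: "\<And>s z. z \<in> X \<Longrightarrow> \<psi> s z \<in> X"
    and add: "\<And>r s z. z \<in> X \<Longrightarrow> \<psi> r (\<psi> s z) = \<psi> (r + s) z"
    and cont: "\<And>y \<epsilon>. y \<in> X \<Longrightarrow> \<epsilon> > 0 \<Longrightarrow> \<exists>\<delta>>0. \<forall>z\<in>X. d z y < \<delta> \<longrightarrow> d (\<psi> t z) (\<psi> t y) < \<epsilon>"
  shows "\<psi> t x \<in> M"
proof -
  have MX: "M \<subseteq> X" and Mc: "\<And>y z \<epsilon> T. y \<in> M \<Longrightarrow> z \<in> M \<Longrightarrow> \<epsilon> > 0 \<Longrightarrow> T > 0 \<Longrightarrow> has_chain X d \<psi> \<epsilon> T y z"
    and max: "\<And>N. chain_transitive X d \<psi> N \<Longrightarrow> M \<subseteq> N \<Longrightarrow> N = M"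
    using M unfolding maximal_chain_transitive_def chain_transitive_def by blast+
  have xX: "x \<in> X" using x MX by blast
  have s: "has_chain X d \<psi> \<epsilon> T (\<psi> t x) y" if "y \<in> M" "\<epsilon> > 0" "T > 0" for y \<epsilon> T
    by (rule has_chain_shift_start[OF Mc t xX inv add]) (use that x t in auto)
  have e: "has_chain X d \<psi> \<epsilon> T y (\<psi> t x)" if "y \<in> M" "\<epsilon> > 0" "T > 0" for y \<epsilon> T
    by (rule has_chain_shift_end[OF Mc t xX inv add cont]) (use that x xX in auto)
  have "has_chain X d \<psi> \<epsilon> T y z" if "y \<in> insert (\<psi> t x) M" "z \<in> insert (\<psi> t x) M" "\<epsilon> > 0" "T > 0" for y z \<epsilon> T
    using that s e Mc has_chain_trans[OF s[OF x] e[OF x]] by auto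
  then have "chain_transitive X d \<psi> (insert (\<psi> t x) M)"
    unfolding chain_transitive_def using MX inv[OF xX] by blast
  from max[OF this] show ?thesis by blast
qed

context lyapunov_scalar_product
begin

lemma sflow0_eq: "sflow0 ip A t s = sproj ip (flow A t (fst s), 0)"
  by (simp add: sflow0_def flow_def)

lemma psphere0_fst_nonzero: "s \<in> psphere0 ip \<Longrightarrow> fst s \<noteq> 0"
  using psphere_nonzero[of s] by (auto simp: psphere0_def prod_eq_iff)

lemma sflow0_in_psphere0: "s \<in> psphere0 ip \<Longrightarrow> sflow0 ip A t s \<in> psphere0 ip"
  using sproj_in_psphere[of "(flow A t (fst s), 0)"] psphere0_fst_nonzero[of s]
  by (simp add: psphere0_def sflow0_eq sproj_def prod_eq_iff)

lemma sflow0_add: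
  assumes "z \<in> psphere0 ip"
  shows "sflow0 ip A r (sflow0 ip A s z) = sflow0 ip A (r + s) z"
proof -
  define c where "c = inverse (nrm ip (flow A s (fst z), 0))"
  have c: "c > 0" using nrm_pos[of "(flow A s (fst z), 0)"] psphere0_fst_nonzero[OF assms]
    by (simp add: c_def prod_eq_iff)
  have "sflow0 ip A r (sflow0 ip A s z) = sproj ip (c *\<^sub>R (flow A (r + s) (fst z), 0))"
    by (simp add: sflow0_eq sproj_def[of ip "(flow A s (fst z), 0)"] c_def flow_linear_simps flow_add)
  then show ?thesis by (simp only: sproj_scale[OF c] sflow0_eq)
qed

lemma sflow0_riem_continuous:
  assumes y: "y \<in> psphere0 ip" and "\<epsilon> > 0"
  shows "\<exists>\<delta>>0. \<forall>z\<in>psphere0 ip. riem_dist ip z y < \<delta> \<longrightarrow>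
    riem_dist ip (sflow0 ip A t z) (sflow0 ip A t y) < \<epsilon>"
proof -
  obtain c C where cC: "c > 0" "C > 0" "\<And>p. c * norm p \<le> nrm ip p" "\<And>p. nrm ip p \<le> C * norm p"
    using nrm_norm_equiv by blast
  have "continuous_on (psphere0 ip) (sflow0 ip A t)"
    unfolding sflow0_eq[abs_def] sproj_def
    using psphere0_fst_nonzero
    by (intro continuous_intros) (auto simp: prod_eq_iff)
  then have "\<forall>y\<in>psphere0 ip. \<forall>e>0. \<exists>d>0. \<forall>z\<in>psphere0 ip. dist z y < d \<longrightarrow> dist (sflow0 ip A t z) (sflow0 ip A t y) < e"
    unfolding continuous_on_iff .
  moreover have "\<epsilon> / (2 * C) > 0" using \<open>\<epsilon> > 0\<close> cC by simp
  ultimately obtain \<delta> where \<delta>: "\<delta> > 0"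
    "\<And>z. z \<in> psphere0 ip \<Longrightarrow> dist z y < \<delta> \<Longrightarrow> dist (sflow0 ip A t z) (sflow0 ip A t y) < \<epsilon> / (2 * C)"
    using y by blast
  show ?thesis
  proof (intro exI[of _ "c * \<delta>"] conjI ballI impI)
    show "c * \<delta> > 0" using cC \<delta> by simp
    fix z assume z: "z \<in> psphere0 ip" "riem_dist ip z y < c * \<delta>"
    have "c * norm (z - y) < c * \<delta>"
      using cC(3)[of "z - y"] riem_dist_bounds(1)[of z y] z y by (auto simp: psphere0_def)
    then have "dist z y < \<delta>" using cC by (simp add: dist_norm)
    then have 1: "C * norm (sflow0 ip A t z - sflow0 ip A t y) < \<epsilon> / 2"
      using \<delta>(2)[OF z(1)] cC by (simp add: dist_norm field_simps)
    have "riem_dist ip (sflow0 ip A t z) (sflow0 ip A t y) \<le> 2 * nrm ip (sflow0 ip A t z - sflow0 ip A t y)"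
      using sflow0_in_psphere0 z(1) y by (intro riem_dist_bounds(2)) (auto simp: psphere0_def)
    also have "\<dots> \<le> 2 * (C * norm (sflow0 ip A t z - sflow0 ip A t y))"
      using cC(4) by simp
    finally show "riem_dist ip (sflow0 ip A t z) (sflow0 ip A t y) < \<epsilon>" using 1 by simp
  qed
qed

text \<open>The base of the bundles is specified only as a maximal chain transitive set; this makes
  it a set on which the dynamics acts.\<close>

lemma SL_flow_invariant:
  assumes "is_SL ip A l SL" "s \<in> SL" "t \<ge> 0"
  shows "sflow0 ip A t s \<in> SL"
proof (rule maximal_chain_transitive_invariant[where \<psi> = "sflow0 ip A" and x = s and t = t
      and X = "psphere0 ip" and d = "riem_dist ip"])
  show "maximal_chain_transitive (psphere0 ip) (riem_dist ip) (sflow0 ip A) SL"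
    using assms(1) by (simp add: is_SL_def)
qed (assumption | rule assms sflow0_in_psphere0 sflow0_add sflow0_riem_continuous)+

end

section \<open>The control system\<close>

lemma rep_linf_ess_bounded: "ess_bounded (rep_linf u)"
  using Quotient3_rep_reflp[OF Quotient3_linf, of u] by (simp add: linf_rel_def)

lemma rep_linf_measurable [measurable]: "rep_linf u \<in> borel_measurable lborel"
  using rep_linf_ess_bounded[of u] by (simp add: ess_bounded_def)

lemma rep_abs_linf_AE:
  assumes "ess_bounded f"
  shows "AE t in lborel. rep_linf (abs_linf f) t = f t"
proof -
  have "linf_rel f f" using assms by (simp add: linf_rel_def)
  then have "linf_rel (rep_linf (abs_linf f)) f" by (rule Quotient3_rep_abs[OF Quotient3_linf])
  then show ?thesis by (simp add: linf_rel_def)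
qed

lemma AE_lborel_translate:
  assumes "AE x in lborel. P x"
  shows "AE x in lborel. P (t + x :: real)"
proof -
  obtain N where N: "{x \<in> space lborel. \<not> P x} \<subseteq> N" "emeasure lborel N = 0" "N \<in> sets lborel"
    using assms by (rule AE_E)
  show ?thesis
  proof (rule AE_I)
    show "{x \<in> space lborel. \<not> P (t + x)} \<subseteq> (+) t -` N" using N(1) by auto
    have "emeasure lborel N = emeasure (distr lborel borel ((+) t)) N" by (simp add: lborel_distr_plus)
    also have "\<dots> = emeasure lborel ((+) t -` N)"
      using N(3) by (subst emeasure_distr) auto
    finally show "emeasure lborel ((+) t -` N) = 0" using N(2) by simp
    show "(+) t -` N \<in> sets lborel" using N(3) measurable_sets[of "(+) t" lborel borel N] by simp
  qed
qed

lemma rep_shift_AE: "AE \<sigma> in lborel. rep_linf (shift t u) \<sigma> = rep_linf u (t + \<sigma>)"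
  unfolding shift_def
proof (rule rep_abs_linf_AE)
  obtain c where c: "AE \<sigma> in lborel. norm (rep_linf u \<sigma>) \<le> c"
    using rep_linf_ess_bounded[of u] by (auto simp: ess_bounded_def)
  show "ess_bounded (\<lambda>\<tau>. rep_linf u (t + \<tau>))"
    unfolding ess_bounded_def using AE_lborel_translate[OF c, of t] by auto
qed

lemma shift_controls: "u \<in> controls U \<Longrightarrow> shift t u \<in> controls U"
proof -
  assume "u \<in> controls U"
  then have "AE \<sigma> in lborel. rep_linf u (t + \<sigma>) \<in> U"
    using AE_lborel_translate[of "\<lambda>\<sigma>. rep_linf u \<sigma> \<in> U" t] by (simp add: controls_def)
  then show ?thesis
    unfolding controls_def using rep_shift_AE[of t u] by (auto elim: eventually_elim2)
qed

section \<open>Bounded solutions and Duhamel integrals of the controlled system\<close>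

locale linear_control = lyapunov_scalar_product A ip
  for A :: "real^'n^'n" and ip +
  fixes B :: "real^'m^'n" and U :: "(real^'m) set"
  assumes compact_U: "compact U"
begin

definition inp :: "(real^'m) linf \<Rightarrow> real \<Rightarrow> real^'n" where
  "inp u \<sigma> = B *v rep_linf u \<sigma>"

lemma inp_measurable [measurable]: "inp u \<in> borel_measurable lborel"
  unfolding inp_def by measurable

lemma inp_bound: "\<exists>M. AE \<sigma> in lborel. norm (inp u \<sigma>) \<le> M"
proof -
  obtain c where c: "AE \<sigma> in lborel. norm (rep_linf u \<sigma>) \<le> c"
    using rep_linf_ess_bounded[of u] by (auto simp: ess_bounded_def)
  obtain K where K: "K > 0" "\<And>x. norm (B *v x) \<le> K * norm x"
    using linear_bounded_pos[of "\<lambda>x. B *v x"] by (auto simp: mult.commute)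
  have "AE \<sigma> in lborel. norm (inp u \<sigma>) \<le> K * c"
    using c
  proof eventually_elim
    case (elim \<sigma>)
    then have "K * norm (rep_linf u \<sigma>) \<le> K * c" using K by simp
    then show ?case using K(2)[of "rep_linf u \<sigma>"] by (simp add: inp_def)
  qed
  then show ?thesis by blast
qed

lemma inp_uniform_bound: "\<exists>M>0. \<forall>u\<in>controls U. AE \<sigma> in lborel. norm (inp u \<sigma>) \<le> M"
proof -
  obtain c where c: "c > 0" "\<And>x. x \<in> U \<Longrightarrow> norm x \<le> c"
    using compact_imp_bounded[OF compact_U] bounded_pos by metis
  obtain K where K: "K > 0" "\<And>x. norm (B *v x) \<le> K * norm x"
    using linear_bounded_pos[of "\<lambda>x. B *v x"] by (auto simp: mult.commute)
  have "AE \<sigma> in lborel. norm (inp u \<sigma>) \<le> K * c" if "u \<in> controls U" for u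
  proof -
    have "AE \<sigma> in lborel. rep_linf u \<sigma> \<in> U" using that by (simp add: controls_def)
    then show ?thesis
    proof eventually_elim
      case (elim \<sigma>)
      then have "K * norm (rep_linf u \<sigma>) \<le> K * c" using K c by simp
      then show ?case using K(2)[of "rep_linf u \<sigma>"] by (simp add: inp_def)
    qed
  qed
  then show ?thesis using K c by (intro exI[of _ "K * c"]) auto
qed

lemma small_if_decaying:
  fixes x :: "real^'n"
  assumes "a > 0" "\<And>t. t > 0 \<Longrightarrow> norm x \<le> K * exp (- a * t) * D"
  shows "x = 0"
proof -
  have "((\<lambda>t. K * exp (- a * t) * D) \<longlongrightarrow> 0) at_top" using assms(1) by real_asymp
  moreover have "\<forall>\<^sub>F t in at_top. norm x \<le> K * exp (- a * t) * D"
    using eventually_gt_at_top[of 0] by eventually_elim (use assms in auto)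
  ultimately have "norm x \<le> 0" by (rule tendsto_lowerbound) simp
  then show ?thesis by simp
qed

text \<open>The stable part of x is the image of the stable part at time -t under a contraction that
  tends to 0 with growing t, and the orbit is bounded; the unstable part is treated with time
  reversed.\<close>

lemma bounded_hyp_flow_zero:
  assumes x: "x \<in> lsum A (- {0})" and b: "\<And>t. norm (flow A t x) \<le> D"
  shows "x = 0"
proof -
  obtain K a where K: "K > 0" "a > 0" "\<And>\<tau> x. norm (green \<tau> x) \<le> K * exp (- a * \<bar>\<tau>\<bar>) * norm x"
    using green_bound by blast
  have le: "norm (green \<tau> (flow A s x)) \<le> K * exp (- a * \<bar>\<tau>\<bar>) * D" for \<tau> s
    using K b[of s] by (intro order_trans[OF K(3)] mult_left_mono) auto
  have "lproj A {..<0} x = 0"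
  proof (rule small_if_decaying[OF K(2)])
    fix t :: real assume "t > 0"
    then show "norm (lproj A {..<0} x) \<le> K * exp (- a * t) * D"
      using le[of t "- t"] by (simp add: green_def lproj_flow)
  qed
  moreover have "lproj A {0<..} x = 0"
  proof (rule small_if_decaying[OF K(2)])
    fix t :: real assume "t > 0"
    then show "norm (lproj A {0<..} x) \<le> K * exp (- a * t) * D"
      using le[of "- t" t] by (simp add: green_def lproj_flow)
  qed
  moreover have "lproj A (- {0}) x = lproj A {..<0} x + lproj A {0<..} x"
  proof -
    have eq: "- {0} = {..<0} \<union> {0::real<..}" and dis: "{..<0} \<inter> {0::real<..} = {}" by auto
    show ?thesis unfolding eq by (rule lproj_Un[OF dis])
  qed
  ultimately show ?thesis using lproj_id[OF x] by simp
qed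

lemma interval_integrable_AE_bounded:
  fixes h :: "real \<Rightarrow> real^'n"
  assumes "h \<in> borel_measurable lborel" "AE \<sigma> in lborel. norm (h \<sigma>) \<le> K"
  shows "interval_lebesgue_integrable lborel 0 (ereal t) h"
proof -
  have i: "set_integrable lborel {a..b} h" for a b
    by (rule set_integrable_AE_bounded[of _ _ _ K]) (use assms in auto)
  have "set_integrable lborel (einterval (ereal a) (ereal b)) h" for a b
    by (rule set_integrable_subset[OF i[of a b]]) (auto simp: einterval_def)
  then show ?thesis by (simp add: interval_lebesgue_integrable_def zero_ereal_def)
qed

lemma bounded_hyp_solutionD:
  assumes "bounded_hyp_solution A B u y"
  shows "continuous_on UNIV y" "\<exists>D. \<forall>t. norm (y t) \<le> D" "y t \<in> lsum A (- {0})"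
    "y t = y 0 + (LBINT \<sigma>=0..ereal t. A *v lproj A (- {0}) (y \<sigma>) + lproj A (- {0}) (inp u \<sigma>))"
proof -
  note s = assms[unfolded bounded_hyp_solution_def L_hyp_eq proj_hyp_eq]
  show "continuous_on UNIV y" using s by (rule conjunct1)
  have "bounded (range y)" using s[THEN conjunct2] by (rule conjunct1)
  then show "\<exists>D. \<forall>t. norm (y t) \<le> D" unfolding bounded_iff by simp
  show "y t \<in> lsum A (- {0})" using s[THEN conjunct2, THEN conjunct2, THEN conjunct1] by auto
  show "y t = y 0 + (LBINT \<sigma>=0..ereal t. A *v lproj A (- {0}) (y \<sigma>) + lproj A (- {0}) (inp u \<sigma>))"
    using s[THEN conjunct2, THEN conjunct2, THEN conjunct2, rule_format, of t] unfolding inp_def .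
qed

text \<open>In the difference of two solutions the measurable input cancels, so the integral
  equation can be differentiated. The difference is a bounded orbit of the linear flow in the
  hyperbolic part, hence zero.\<close>

lemma bounded_hyp_solution_unique:
  assumes "bounded_hyp_solution A B u y1" "bounded_hyp_solution A B u y2"
  shows "y1 = y2"
proof -
  define d where "d t = y1 t - y2 t" for t
  note s1 = bounded_hyp_solutionD[OF assms(1)] and s2 = bounded_hyp_solutionD[OF assms(2)]
  obtain D1 where D1: "\<And>t. norm (y1 t) \<le> D1" using s1(2) by blast
  obtain D2 where D2: "\<And>t. norm (y2 t) \<le> D2" using s2(2) by blast
  obtain M where "AE \<sigma> in lborel. norm (inp u \<sigma>) \<le> M" using inp_bound by blast
  then obtain M' where M': "AE \<sigma> in lborel. norm (lproj A (- {0}) (inp u \<sigma>)) \<le> M'"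
    using lproj_f_bound[OF inp_measurable] by blast
  obtain K where K: "K > 0" "\<And>x. norm (A *v x) \<le> K * norm x"
    using linear_bounded_pos[of "\<lambda>x. A *v x"] by (auto simp: mult.commute)
  have int: "interval_lebesgue_integrable lborel 0 (ereal t) (\<lambda>\<sigma>. A *v lproj A (- {0}) (y \<sigma>) + lproj A (- {0}) (inp u \<sigma>))"
    if y: "\<And>t. y t \<in> lsum A (- {0})" "\<And>t. norm (y t) \<le> D0" "continuous_on UNIV y" for y D0 t
  proof (rule interval_integrable_AE_bounded[of _ "K * D0 + M'"])
    have [measurable]: "y \<in> borel_measurable lborel"
      using borel_measurable_continuous_onI[OF y(3)] by simp
    show "(\<lambda>\<sigma>. A *v lproj A (- {0}) (y \<sigma>) + lproj A (- {0}) (inp u \<sigma>)) \<in> borel_measurable lborel"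
      by measurable
    show "AE \<sigma> in lborel. norm (A *v lproj A (- {0}) (y \<sigma>) + lproj A (- {0}) (inp u \<sigma>)) \<le> K * D0 + M'"
      using M'
    proof eventually_elim
      case (elim \<sigma>)
      have "norm (A *v y \<sigma>) \<le> K * D0"
        using K(2)[of "y \<sigma>"] mult_left_mono[OF y(2), of K \<sigma>] K(1) by linarith
      then show ?case using elim by (intro order_trans[OF norm_triangle_ineq] add_mono) (simp_all add: lproj_id y(1))
    qed
  qed
  have d_eq: "d t = d 0 + (LBINT \<sigma>=0..ereal t. A *v d \<sigma>)" for t
  proof -
    have "d t = d 0 + (LBINT \<sigma>=0..ereal t. (A *v lproj A (- {0}) (y1 \<sigma>) + lproj A (- {0}) (inp u \<sigma>))
        - (A *v lproj A (- {0}) (y2 \<sigma>) + lproj A (- {0}) (inp u \<sigma>)))"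
      unfolding d_def by (subst s1(4)[of t], subst s2(4)[of t],
          subst interval_lebesgue_integral_diff(2)[OF int[OF s1(3) D1 s1(1)] int[OF s2(3) D2 s2(1)]]) simp
    then show ?thesis by (simp add: lproj_id s1(3) s2(3) d_def matrix_vector_mult_diff_distrib)
  qed
  have cd: "continuous_on UNIV d" unfolding d_def by (intro continuous_on_diff s1(1) s2(1))
  have cAd: "continuous_on S (\<lambda>\<sigma>. A *v d \<sigma>)" for S
    by (intro bounded_linear.continuous_on[OF bounded_linear_mult] continuous_on_subset[OF cd]) simp
  have "(d has_vector_derivative A *v d t) (at t)" for t
  proof -
    define R where "R = \<bar>t\<bar> + 1"
    have "((\<lambda>s. LBINT \<sigma>=0..s. A *v d \<sigma>) has_vector_derivative A *v d t) (at t within {- R..R})"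
      using interval_integral_FTC2[of "- R" 0 R "\<lambda>\<sigma>. A *v d \<sigma>" t] cAd by (auto simp: R_def zero_ereal_def)
    moreover have "at t within {- R..R} = at t"
      by (rule at_within_interior) (auto simp: R_def interior_atLeastAtMost_real)
    ultimately have "((\<lambda>s. LBINT \<sigma>=0..s. A *v d \<sigma>) has_vector_derivative A *v d t) (at t)"
      by (simp only:)
    then have "((\<lambda>s. d 0 + (LBINT \<sigma>=0..s. A *v d \<sigma>)) has_vector_derivative 0 + A *v d t) (at t)"
      by (intro has_vector_derivative_add has_vector_derivative_const)
    moreover have "(\<lambda>s. d 0 + (LBINT \<sigma>=0..s. A *v d \<sigma>)) = d" by (rule ext) (rule d_eq[symmetric])
    ultimately show ?thesis by (simp only: add_0)
  qed
  then have fl: "d t = flow A t (d 0)" for t by (rule flow_unique)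
  have "d 0 = 0"
  proof (rule bounded_hyp_flow_zero)
    show "d 0 \<in> lsum A (- {0})" unfolding d_def by (intro subspace_diff subspace_lsum s1(3) s2(3))
    show "norm (flow A t (d 0)) \<le> D1 + D2" for t
      unfolding fl[symmetric] unfolding d_def by (intro order_trans[OF norm_triangle_ineq4] add_mono D1 D2)
  qed
  then have "d t = 0" for t using fl[of t] by (simp add: flow_linear_simps)
  then show ?thesis by (simp add: d_def fun_eq_iff)
qed

text \<open>Replaces the definite description by an explicit integral, from which bounds, shifts and
  continuity in u can be read off.\<close>

lemma e_sol_eq: "e_sol A B u = gsol (inp u)"
  unfolding e_sol_def
proof (rule the_equality)
  obtain M where M: "AE \<sigma> in lborel. norm (inp u \<sigma>) \<le> M" using inp_bound by blast
  show sol: "bounded_hyp_solution A B u (gsol (inp u))"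
    unfolding bounded_hyp_solution_def
  proof (intro conjI allI)
    show "continuous_on UNIV (gsol (inp u))" by (rule gsol_integral_equation(1)[OF inp_measurable M])
    show "bounded (range (gsol (inp u)))"
      using gsol_bound inp_measurable M unfolding bounded_iff by blast
    show "range (gsol (inp u)) \<subseteq> L_hyp A"
      unfolding L_hyp_eq using gsol_in_lsum[OF inp_measurable M] by blast
    show "gsol (inp u) t = gsol (inp u) 0 +
       (LBINT \<sigma>=0..ereal t. A *v proj_hyp A (gsol (inp u) \<sigma>) + proj_hyp A (B *v rep_linf u \<sigma>))" for t
      using gsol_integral_equation(2)[OF inp_measurable M, of t] by (simp only: proj_hyp_eq inp_def[symmetric])
  qed
  show "y = gsol (inp u)" if "bounded_hyp_solution A B u y" for y
    using bounded_hyp_solution_unique that sol by blast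
qed

lemma e_sol_bound: "\<exists>c>0. \<forall>u\<in>controls U. norm (e_sol A B u 0) \<le> c"
proof -
  obtain M where M: "\<And>u. u \<in> controls U \<Longrightarrow> AE \<sigma> in lborel. norm (inp u \<sigma>) \<le> M"
    using inp_uniform_bound by blast
  obtain c where c: "\<And>u. u \<in> controls U \<Longrightarrow> norm (gsol (inp u) 0) \<le> c * M"
    using gsol_bound inp_measurable M by metis
  then show ?thesis by (intro exI[of _ "\<bar>c * M\<bar> + 1"]) (force simp: e_sol_eq)
qed

lemma e_sol_shift: "e_sol A B (shift t u) 0 = e_sol A B u t"
  unfolding e_sol_eq
proof (rule gsol_shift)
  show "AE \<sigma> in lborel. inp (shift t u) \<sigma> = inp u (t + \<sigma>)"
    using rep_shift_AE[of t u] by eventually_elim (simp add: inp_def)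
qed measurable

lemma phi1_eq:
  assumes "0 \<le> t"
  shows "phi1 A B t p u =
    (flow A t (fst p) + snd p *\<^sub>R (LINT \<sigma>:{0..t}|lborel. flow A (t - \<sigma>) (inp u \<sigma>)), snd p)"
  using assms by (simp add: phi1_def flow_def inp_def interval_integral_Icc zero_ereal_def)

lemma duhamel_integrable: "set_integrable lborel {0..t} (\<lambda>\<sigma>. flow A (t - \<sigma>) (lproj A I (inp u \<sigma>)))"
proof -
  obtain M where M: "AE \<sigma> in lborel. norm (inp u \<sigma>) \<le> M" using inp_bound by blast
  obtain M' where M': "AE \<sigma> in lborel. norm (lproj A I (inp u \<sigma>)) \<le> M'"
    using lproj_f_bound[OF inp_measurable M] by blast
  obtain C where C: "C > 0" "\<And>\<sigma> x. \<sigma> \<in> {0..t} \<Longrightarrow> norm (flow A \<sigma> x) \<le> C * norm x"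
    using flow_bounded_on_interval by metis
  have "AE \<sigma> in lborel. \<sigma> \<in> {0..t} \<longrightarrow> norm (flow A (t - \<sigma>) (lproj A I (inp u \<sigma>))) \<le> C * M'"
    using M'
  proof eventually_elim
    case (elim \<sigma>)
    show ?case
    proof
      assume "\<sigma> \<in> {0..t}"
      then have "norm (flow A (t - \<sigma>) (lproj A I (inp u \<sigma>))) \<le> C * norm (lproj A I (inp u \<sigma>))"
        by (intro C) auto
      also have "\<dots> \<le> C * M'" using elim C by simp
      finally show "norm (flow A (t - \<sigma>) (lproj A I (inp u \<sigma>))) \<le> C * M'" .
    qed
  qed
  then show ?thesis by (intro set_integrable_AE_bounded) measurable
qed

lemma duhamel_proj:
  "lproj A I (LINT \<sigma>:{0..t}|lborel. flow A (t - \<sigma>) (inp u \<sigma>)) =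
    (LINT \<sigma>:{0..t}|lborel. flow A (t - \<sigma>) (lproj A I (inp u \<sigma>)))"
proof -
  have i: "set_integrable lborel {0..t} (\<lambda>\<sigma>. flow A (t - \<sigma>) (inp u \<sigma>))"
    using duhamel_integrable[of t UNIV u] by (simp add: lproj_id lsum_UNIV)
  show ?thesis
    using integral_bounded_linear[OF bounded_linear_lproj i[unfolded set_integrable_def], of I]
    by (simp add: set_lebesgue_integral_def lproj_scale lproj_flow)
qed

text \<open>Up to the component in \<open>L_zero A\<close>, the lifted flow maps (e(u,0), 1) to
  (e(u,t), 1). This is the source of the invariance of the spaces \<open>V u\<close>.\<close>

lemma e_sol_duhamel:
  assumes "0 \<le> t"
  shows "e_sol A B u t = flow A t (e_sol A B u 0) +
    lproj A (- {0}) (LINT \<sigma>:{0..t}|lborel. flow A (t - \<sigma>) (inp u \<sigma>))"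
proof -
  obtain M where M: "AE \<sigma> in lborel. norm (inp u \<sigma>) \<le> M" using inp_bound by blast
  have i: "set_integrable lborel {0..t} (\<lambda>\<sigma>. flow A (- \<sigma>) (lproj A (- {0}) (inp u \<sigma>)))"
    using integrable_bounded_linear[OF bounded_linear_flow duhamel_integrable[unfolded set_integrable_def], of A "- t" t "- {0}" u]
    by (simp add: set_integrable_def flow_linear_simps flow_add[symmetric])
  have "flow A t (flow A (- t) (gsol (inp u) t)) = flow A t (gsol (inp u) 0 +
      (LINT \<sigma>:{0..t}|lborel. flow A (- \<sigma>) (lproj A (- {0}) (inp u \<sigma>))))"
    using gsol_voc[OF inp_measurable M assms] by simp
  also have "\<dots> = flow A t (gsol (inp u) 0) + flow A t (LINT \<sigma>:{0..t}|lborel. flow A (- \<sigma>) (lproj A (- {0}) (inp u \<sigma>)))"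
    by (simp add: flow_linear_simps)
  also have "flow A t (LINT \<sigma>:{0..t}|lborel. flow A (- \<sigma>) (lproj A (- {0}) (inp u \<sigma>))) =
      (LINT \<sigma>:{0..t}|lborel. flow A (t - \<sigma>) (lproj A (- {0}) (inp u \<sigma>)))"
    using integral_bounded_linear[OF bounded_linear_flow i[unfolded set_integrable_def], of A t]
    by (simp add: set_lebesgue_integral_def flow_linear_simps flow_add[symmetric])
  finally show ?thesis by (simp add: e_sol_eq duhamel_proj)
qed

lemma continuous_map_weak_star_pairing:
  fixes g :: "real \<Rightarrow> real^'m"
  assumes "integrable lborel g"
  shows "continuous_map weak_star euclidean (\<lambda>u. LINT t|lborel. g t \<bullet> rep_linf u t)"
  unfolding continuous_map_def
proof (intro conjI allI impI)
  fix W :: "real set" assume W: "openin euclidean W"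
  have top: "topspace weak_star = (UNIV :: (real^'m) linf set)"
  proof -
    have "openin weak_star {u :: (real^'m) linf. (LINT t|lborel. g t \<bullet> rep_linf u t) \<in> UNIV}"
      unfolding weak_star_def by (rule topology_generated_by_Basis) (use assms in auto)
    then show ?thesis using openin_subset by fastforce
  qed
  have "openin weak_star {u :: (real^'m) linf. (LINT t|lborel. g t \<bullet> rep_linf u t) \<in> W}"
    unfolding weak_star_def by (rule topology_generated_by_Basis) (use assms W in auto)
  then show "openin weak_star {x \<in> topspace weak_star. (LINT t|lborel. g t \<bullet> rep_linf x t) \<in> W}"
    by (simp add: top)
qed auto

text \<open>Each coordinate of e(u,0) is the pairing of u with an integrable function, and such
  pairings are continuous by the choice of the topology.\<close>

lemma e_sol_continuous: "continuous_map weak_star euclidean (\<lambda>u. e_sol A B u 0)"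
proof -
  obtain k where k: "integrable lborel k" "\<And>\<tau>. 0 \<le> k \<tau>" "\<And>\<tau> x. norm (green \<tau> x) \<le> k \<tau> * norm x"
    using green_bound_integrable by blast
  \<comment> \<open>The i-th row of the kernel composed with B, written as the vector that
    represents it under the inner product.\<close>
  define g where "g i \<sigma> = (\<Sum>b\<in>Basis. (green (- \<sigma>) (B *v b) $ i) *\<^sub>R b)" for i and \<sigma> :: real
  have g_pair: "g i \<sigma> \<bullet> x = green (- \<sigma>) (B *v x) $ i" for i \<sigma> x
  proof -
    have "green (- \<sigma>) (B *v x) = green (- \<sigma>) (B *v (\<Sum>b\<in>Basis. (x \<bullet> b) *\<^sub>R b))"
      by (simp add: euclidean_representation)
    also have "\<dots> = (\<Sum>b\<in>Basis. (x \<bullet> b) *\<^sub>R green (- \<sigma>) (B *v b))"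
      by (simp add: linear_sum[OF matrix_vector_mul_linear] linear_scale[OF matrix_vector_mul_linear]
          linear_sum[OF linear_green] linear_scale[OF linear_green])
    finally show ?thesis
      by (simp add: g_def inner_sum_left mult.commute inner_commute[of x])
  qed
  have g_int: "integrable lborel (g i)" for i
    unfolding g_def
  proof (intro Bochner_Integration.integrable_sum integrable_scaleR_left)
    fix b :: "real^'m"
    have kt: "integrable lborel (\<lambda>\<sigma>. k (0 + - 1 * \<sigma>) * norm (B *v b))"
      by (intro integrable_mult_left lborel_integrable_real_affine[OF k(1)]) simp
    have [measurable]: "(\<lambda>\<sigma>. green (- \<sigma>) (B *v b)) \<in> borel_measurable lborel" by measurable
    have "integrable lborel (\<lambda>\<sigma>. green (- \<sigma>) (B *v b))"
      by (rule Bochner_Integration.integrable_bound[OF kt]) (use k in \<open>auto simp: abs_mult\<close>)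
    then show "integrable lborel (\<lambda>\<sigma>. green (- \<sigma>) (B *v b) $ i)"
      by (rule integrable_bounded_linear[OF bounded_linear_vec_nth])
  qed
  have eq: "e_sol A B u 0 = (\<Sum>i\<in>UNIV. (LINT t|lborel. g i t \<bullet> rep_linf u t) *\<^sub>R axis i 1)" for u
  proof -
    obtain M where M: "AE \<sigma> in lborel. norm (inp u \<sigma>) \<le> M" using inp_bound by blast
    have i: "integrable lborel (\<lambda>\<sigma>. green (- \<sigma>) (inp u \<sigma>))"
      using integrable_green[OF inp_measurable M, of 0] by simp
    have "(LINT t|lborel. g i t \<bullet> rep_linf u t) = gsol (inp u) 0 $ i" for i
      using integral_bounded_linear[OF bounded_linear_vec_nth i, of i] by (simp add: g_pair gsol_def inp_def)
    then show ?thesis by (simp add: e_sol_eq vec_eq_iff sum_component axis_def if_distrib cong: if_cong)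
  qed
  have "continuous_map weak_star euclidean (\<lambda>u. (LINT t|lborel. g i t \<bullet> rep_linf u t) *\<^sub>R (axis i 1 :: real^'n))" for i
  proof -
    have "continuous_map euclidean euclidean (\<lambda>r. r *\<^sub>R (axis i 1 :: real^'n))"
      by (auto intro: continuous_intros)
    from continuous_map_compose[OF continuous_map_weak_star_pairing[OF g_int] this]
    show ?thesis by (simp add: o_def)
  qed
  then show ?thesis unfolding eq by (intro continuous_map_sum) auto
qed

end

text \<open>In the norm \<open>anorm\<close> the growth bound holds with the constant \<open>1\<close> instead of \<open>K\<close>.\<close>

locale adapted_norm =
  fixes F :: "real \<Rightarrow> 'a::euclidean_space \<Rightarrow> 'a" and S :: "'a set" and b K :: real
  assumes subspace_S: "subspace S" and linear_F: "\<And>\<tau>. linear (F \<tau>)" and F_0: "\<And>x. F 0 x = x"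
    and K_pos: "K > 0"
    and growth: "\<And>\<tau> x. \<tau> \<ge> 0 \<Longrightarrow> x \<in> S \<Longrightarrow> norm (F \<tau> x) \<le> K * exp (b * \<tau>) * norm x"
begin

text \<open>The Lyapunov norm for the rate b. The supremum is known to be finite only on S, which is
  why the facts below are restricted to S; evaluating it after time t merely shifts the range of
  \<tau>.\<close>

definition anorm :: "'a \<Rightarrow> real" where
  "anorm x = (SUP \<tau>\<in>{0..}. exp (- b * \<tau>) * norm (F \<tau> x))"

lemma growth': "\<tau> \<ge> 0 \<Longrightarrow> x \<in> S \<Longrightarrow> exp (- b * \<tau>) * norm (F \<tau> x) \<le> K * norm x"
  using growth[of \<tau> x] by (simp add: exp_minus field_simps)

lemma anorm_ge: "\<tau> \<ge> 0 \<Longrightarrow> x \<in> S \<Longrightarrow> exp (- b * \<tau>) * norm (F \<tau> x) \<le> anorm x"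
  unfolding anorm_def using growth'[of _ x] by (intro cSUP_upper bdd_aboveI2) auto

lemma anorm_le: "(\<And>\<tau>. \<tau> \<ge> 0 \<Longrightarrow> exp (- b * \<tau>) * norm (F \<tau> x) \<le> c) \<Longrightarrow> anorm x \<le> c"
  unfolding anorm_def by (intro cSUP_least) auto

lemma norm_le_anorm: "x \<in> S \<Longrightarrow> norm x \<le> anorm x"
  using anorm_ge[of 0 x] by (simp add: F_0)

lemma anorm_le_norm: "x \<in> S \<Longrightarrow> anorm x \<le> K * norm x"
  by (intro anorm_le growth')

lemma anorm_nonneg: "x \<in> S \<Longrightarrow> 0 \<le> anorm x"
  using norm_le_anorm[of x] norm_ge_zero[of x] by linarith

lemma anorm_0: "anorm 0 = 0"
  using anorm_le_norm[OF subspace_0[OF subspace_S]] anorm_nonneg[OF subspace_0[OF subspace_S]] by simp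

lemma anorm_triangle:
  assumes "x \<in> S" "y \<in> S"
  shows "anorm (x + y) \<le> anorm x + anorm y"
proof (rule anorm_le)
  fix \<tau> :: real assume \<tau>: "\<tau> \<ge> 0"
  have "exp (- b * \<tau>) * norm (F \<tau> (x + y)) \<le> exp (- b * \<tau>) * (norm (F \<tau> x) + norm (F \<tau> y))"
    by (simp add: linear_add[OF linear_F] norm_triangle_ineq)
  also have "\<dots> \<le> anorm x + anorm y"
    using anorm_ge[OF \<tau> assms(1)] anorm_ge[OF \<tau> assms(2)] by (simp add: distrib_left)
  finally show "exp (- b * \<tau>) * norm (F \<tau> (x + y)) \<le> anorm x + anorm y" .
qed

lemma anorm_scale_le: "x \<in> S \<Longrightarrow> anorm (c *\<^sub>R x) \<le> \<bar>c\<bar> * anorm x"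
proof (rule anorm_le)
  fix \<tau> :: real assume "x \<in> S" and \<tau>: "\<tau> \<ge> 0"
  have "exp (- b * \<tau>) * norm (F \<tau> (c *\<^sub>R x)) = \<bar>c\<bar> * (exp (- b * \<tau>) * norm (F \<tau> x))"
    by (simp add: linear_scale[OF linear_F])
  also have "\<dots> \<le> \<bar>c\<bar> * anorm x" using anorm_ge[OF \<tau> \<open>x \<in> S\<close>] by (rule mult_left_mono) simp
  finally show "exp (- b * \<tau>) * norm (F \<tau> (c *\<^sub>R x)) \<le> \<bar>c\<bar> * anorm x" .
qed

lemma anorm_scale:
  assumes "x \<in> S"
  shows "anorm (c *\<^sub>R x) = \<bar>c\<bar> * anorm x"
proof (cases "c = 0")
  case False
  have "anorm (inverse c *\<^sub>R (c *\<^sub>R x)) \<le> \<bar>inverse c\<bar> * anorm (c *\<^sub>R x)"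
    using assms subspace_S by (intro anorm_scale_le subspace_scale)
  then have "\<bar>c\<bar> * anorm x \<le> anorm (c *\<^sub>R x)" using False by (simp add: field_simps)
  then show ?thesis using anorm_scale_le[OF assms, of c] by simp
qed (simp add: anorm_0)

lemma anorm_diff_le:
  assumes "x \<in> S" "y \<in> S"
  shows "\<bar>anorm x - anorm y\<bar> \<le> K * norm (x - y)"
proof -
  have 1: "anorm x - anorm y \<le> K * norm (x - y)" if "x \<in> S" "y \<in> S" for x y
    using anorm_triangle[of "x - y" y] anorm_le_norm[of "x - y"] that subspace_diff[OF subspace_S, of x y]
    by simp
  show ?thesis using 1[OF assms] 1[OF assms(2,1)] by (simp add: norm_minus_commute abs_le_iff)
qed

lemma continuous_on_anorm:
  assumes "continuous_on T f" "\<And>x. x \<in> T \<Longrightarrow> f x \<in> S"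
  shows "continuous_on T (\<lambda>x. anorm (f x))"
proof -
  have "K-lipschitz_on S anorm"
    using anorm_diff_le K_pos by (intro lipschitz_onI) (auto simp: dist_norm dist_real_def)
  then have "continuous_on S anorm" by (rule lipschitz_on_continuous_on)
  from continuous_on_compose2[OF this assms(1)] assms(2) show ?thesis by blast
qed

end

text \<open>At zeros of f the product tends to 0 whatever the bounded factor does. Meant for radial
  rescalings, whose factor is a quotient of two norms and need not have a limit at the
  origin.\<close>

lemma continuous_on_bounded_scale:
  fixes f :: "'z::metric_space \<Rightarrow> 'v::real_normed_vector" and \<rho> :: "'z \<Rightarrow> real"
  assumes f: "continuous_on Z f" and \<rho>: "continuous_on {z \<in> Z. f z \<noteq> 0} \<rho>"
    and K: "\<And>z. z \<in> Z \<Longrightarrow> \<bar>\<rho> z\<bar> \<le> K"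
  shows "continuous_on Z (\<lambda>z. \<rho> z *\<^sub>R f z)"
  unfolding continuous_on_eq_continuous_within
proof
  fix z assume z: "z \<in> Z"
  show "continuous (at z within Z) (\<lambda>z. \<rho> z *\<^sub>R f z)"
  proof (cases "f z = 0")
    case True
    have lim: "(f \<longlongrightarrow> 0) (at z within Z)"
      using f z True by (metis continuous_on)
    have "((\<lambda>z. \<rho> z *\<^sub>R f z) \<longlongrightarrow> 0) (at z within Z)"
    proof (rule Lim_null_comparison)
      show "\<forall>\<^sub>F x in at z within Z. norm (\<rho> x *\<^sub>R f x) \<le> K * norm (f x)"
        unfolding eventually_at_filter by (rule always_eventually) (simp add: K mult_right_mono)
      show "((\<lambda>x. K * norm (f x)) \<longlongrightarrow> 0) (at z within Z)"
        using tendsto_mult_right_zero[OF tendsto_norm_zero[OF lim]] .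
    qed
    then show ?thesis using True by (simp add: continuous_within)
  next
    case False
    obtain G where G: "open G" "{z \<in> Z. f z \<noteq> 0} = Z \<inter> G"
    proof -
      have "openin (top_of_set Z) (Z \<inter> f -` (- {0}))"
        by (rule continuous_openin_preimage_gen[OF f]) auto
      then show ?thesis using that by (auto simp: openin_open)
    qed
    have "z \<in> G" using G z False by auto
    then have eq: "at z within Z = at z within {z \<in> Z. f z \<noteq> 0}"
      using G by (intro at_within_nhd[of z G]) auto
    have "continuous_on {z \<in> Z. f z \<noteq> 0} (\<lambda>z. \<rho> z *\<^sub>R f z)"
      by (intro continuous_intros \<rho> continuous_on_subset[OF f]) auto
    then show ?thesis unfolding eq using z False by (simp add: continuous_on_eq_continuous_within)
  qed
qed

section \<open>The local stable manifold\<close>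

text \<open>The rates \<beta> < \<gamma> come from the gap below \<open>l0\<close>. They and the
  constants of the growth bounds are parameters, so that two adapted norms become available as
  sublocales: \<open>Pn\<close> for the slow spaces in forward time, \<open>Qn\<close> for the space
  of \<open>l0\<close> in backward time.\<close>

locale stable_setting = linear_control A ip B U
  for A :: "real^'n^'n" and ip and B :: "real^'m^'n" and U +
  fixes l0 :: real and SL :: "'n lifted set" and \<beta> \<gamma> K1 K2 :: real
  assumes l0_nonzero: "l0 \<noteq> 0" and SL: "is_SL ip A l0 SL"
    and \<beta>_less_\<gamma>: "\<beta> < \<gamma>" and \<beta>_pos: "0 < l0 \<Longrightarrow> 0 < \<beta>" and K1_pos: "K1 > 0" and K2_pos: "K2 > 0"
    and forward: "\<And>\<tau> x. \<tau> \<ge> 0 \<Longrightarrow> x \<in> lsum A {..<l0} \<Longrightarrow> norm (flow A \<tau> x) \<le> K1 * exp (\<beta> * \<tau>) * norm x"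
    and backward: "\<And>\<tau> x. \<tau> \<ge> 0 \<Longrightarrow> x \<in> lsum A {l0} \<Longrightarrow> norm (flow A (- \<tau>) x) \<le> K2 * exp (- \<gamma> * \<tau>) * norm x"
begin

sublocale Pn: adapted_norm "flow A" "lsum A {..<l0}" \<beta> K1
  by unfold_locales (simp_all add: flow_linear_simps K1_pos forward)

sublocale Qn: adapted_norm "\<lambda>\<tau>. flow A (- \<tau>)" "lsum A {l0}" "- \<gamma>" K2
  by unfold_locales (simp_all add: flow_linear_simps K2_pos backward[simplified])

abbreviation Pm :: "real^'n \<Rightarrow> real^'n" where "Pm \<equiv> lproj A {..<l0}"

lemma Pm_in: "Pm x \<in> lsum A {..<l0}" by (rule lproj_in)

lemma Pn_flow: "t \<ge> 0 \<Longrightarrow> x \<in> lsum A {..<l0} \<Longrightarrow> Pn.anorm (flow A t x) \<le> exp (\<beta> * t) * Pn.anorm x"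
proof (rule Pn.anorm_le)
  fix \<tau> :: real assume t: "t \<ge> 0" "x \<in> lsum A {..<l0}" "\<tau> \<ge> 0"
  have "exp (- \<beta> * \<tau>) * norm (flow A \<tau> (flow A t x)) =
      exp (\<beta> * t) * (exp (- \<beta> * (\<tau> + t)) * norm (flow A (\<tau> + t) x))"
    by (simp add: flow_add mult.assoc[symmetric] exp_add[symmetric] algebra_simps)
  also have "\<dots> \<le> exp (\<beta> * t) * Pn.anorm x"
    by (rule mult_left_mono[OF Pn.anorm_ge]) (use t in auto)
  finally show "exp (- \<beta> * \<tau>) * norm (flow A \<tau> (flow A t x)) \<le> exp (\<beta> * t) * Pn.anorm x" .
qed

text \<open>The norm contracts by e^{-\<gamma>t} in backward time; read forward, this is a lower
  growth bound with constant 1.\<close>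

lemma Qn_flow: "t \<ge> 0 \<Longrightarrow> x \<in> lsum A {l0} \<Longrightarrow> exp (\<gamma> * t) * Qn.anorm x \<le> Qn.anorm (flow A t x)"
proof -
  assume t: "t \<ge> 0" "x \<in> lsum A {l0}"
  have "Qn.anorm x \<le> exp (- \<gamma> * t) * Qn.anorm (flow A t x)"
  proof (rule Qn.anorm_le)
    fix \<tau> :: real assume \<tau>: "\<tau> \<ge> 0"
    have "flow A (- \<tau>) x = flow A (- (\<tau> + t)) (flow A t x)" by (simp flip: flow_add)
    then have "exp (- (- \<gamma>) * \<tau>) * norm (flow A (- \<tau>) x) =
        exp (- \<gamma> * t) * (exp (- (- \<gamma>) * (\<tau> + t)) * norm (flow A (- (\<tau> + t)) (flow A t x)))"
      by (simp add: mult.assoc[symmetric] exp_add[symmetric] algebra_simps)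
    also have "\<dots> \<le> exp (- \<gamma> * t) * Qn.anorm (flow A t x)"
      by (rule mult_left_mono[OF Qn.anorm_ge]) (use t \<tau> lsum_flow in auto)
    finally show "exp (- (- \<gamma>) * \<tau>) * norm (flow A (- \<tau>) x) \<le> exp (- \<gamma> * t) * Qn.anorm (flow A t x)" .
  qed
  then show ?thesis by (simp add: exp_minus field_simps)
qed

text \<open>At rate \<beta> the input contributes at most a multiple of the integral of e^{\<beta>(t
  - \<sigma>)} over [0, t], that is of (e^{\<beta>t} - 1)/\<beta>. Keeping the -1 is what later
  allows the growth bound for \<open>vn\<close> to have constant 1. Positivity of \<beta> is
  available for \<open>0 < l0\<close>; in the other case elements of \<open>V u\<close> have last
  coordinate 0.\<close>

lemma duhamel_anorm:
  "\<exists>C>0. \<forall>u\<in>controls U. \<forall>t\<ge>0. 0 < l0 \<longrightarrow>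
     Pn.anorm (Pm (LINT \<sigma>:{0..t}|lborel. flow A (t - \<sigma>) (inp u \<sigma>))) \<le> C * (exp (\<beta> * t) - 1)"
proof (cases "0 < l0")
  case True
  then have \<beta>: "\<beta> > 0" by (rule \<beta>_pos)
  obtain M where M: "M > 0" "\<And>u. u \<in> controls U \<Longrightarrow> AE \<sigma> in lborel. norm (inp u \<sigma>) \<le> M"
    using inp_uniform_bound by blast
  obtain P where P: "P > 0" "\<And>x. norm (Pm x) \<le> P * norm x"
    using linear_bounded_pos[OF linear_lproj] by (metis mult.commute)
  define C where "C = K1 * (P * M) / \<beta>"
  have "Pn.anorm (Pm (LINT \<sigma>:{0..t}|lborel. flow A (t - \<sigma>) (inp u \<sigma>))) \<le> C * (exp (\<beta> * t) - 1)"
    if u: "u \<in> controls U" and t: "t \<ge> 0" for u t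
  proof (rule Pn.anorm_le)
    fix \<tau> :: real assume \<tau>: "\<tau> \<ge> 0"
    \<comment> \<open>A majorant of the integrand after a further time \<tau>, the parameter of the
      supremum in the adapted norm.\<close>
    define k where "k \<sigma> = exp (\<beta> * \<tau>) * (K1 * (P * M) * exp (\<beta> * (t - \<sigma>)))" for \<sigma>
    have k: "has_bochner_integral lborel (\<lambda>\<sigma>. indicator {0..t} \<sigma> *\<^sub>R k \<sigma>) (exp (\<beta> * \<tau>) * (C * (exp (\<beta> * t) - 1)))"
    proof -
      have "has_bochner_integral lborel (\<lambda>\<sigma>. indicator {0..t} \<sigma> *\<^sub>R k \<sigma>)
          (- exp (\<beta> * \<tau>) * (C * exp (\<beta> * (t - t))) - - exp (\<beta> * \<tau>) * (C * exp (\<beta> * (t - 0))))"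
      proof (rule has_bochner_integral_FTC_Icc[OF t, of "\<lambda>\<sigma>. - exp (\<beta> * \<tau>) * (C * exp (\<beta> * (t - \<sigma>)))"])
        fix x
        have "((\<lambda>\<sigma>. - exp (\<beta> * \<tau>) * (C * exp (\<beta> * (t - \<sigma>)))) has_real_derivative k x) (at x)"
          using \<beta> by (auto intro!: derivative_eq_intros simp: k_def C_def)
        then show "((\<lambda>\<sigma>. - exp (\<beta> * \<tau>) * (C * exp (\<beta> * (t - \<sigma>)))) has_vector_derivative k x) (at x within {0..t})"
          by (simp add: has_real_derivative_iff_has_vector_derivative has_vector_derivative_at_within)
        show "continuous_on {0..t} k" unfolding k_def by (intro continuous_intros)
      qed
      then show ?thesis by (simp add: algebra_simps)
    qed
    define h where "h \<sigma> = flow A \<tau> (flow A (t - \<sigma>) (Pm (inp u \<sigma>)))" for \<sigma>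
    have i: "integrable lborel (\<lambda>\<sigma>. indicator {0..t} \<sigma> *\<^sub>R h \<sigma>)"
      using integrable_bounded_linear[OF bounded_linear_flow duhamel_integrable[unfolded set_integrable_def], of A \<tau> t "{..<l0}" u]
      by (simp add: h_def flow_linear_simps)
    have "flow A \<tau> (Pm (LINT \<sigma>:{0..t}|lborel. flow A (t - \<sigma>) (inp u \<sigma>))) =
        (LINT \<sigma>|lborel. indicator {0..t} \<sigma> *\<^sub>R h \<sigma>)"
      unfolding duhamel_proj
      using integral_bounded_linear[OF bounded_linear_flow duhamel_integrable[unfolded set_integrable_def], of A \<tau> t "{..<l0}" u]
      by (simp add: h_def set_lebesgue_integral_def flow_linear_simps)
    also have "norm \<dots> \<le> (LINT \<sigma>|lborel. norm (indicator {0..t} \<sigma> *\<^sub>R h \<sigma>))"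
      by (rule integral_norm_bound)
    also have "\<dots> \<le> (LINT \<sigma>|lborel. indicator {0..t} \<sigma> *\<^sub>R k \<sigma>)"
    proof (rule integral_mono_AE)
      show "integrable lborel (\<lambda>\<sigma>. norm (indicat_real {0..t} \<sigma> *\<^sub>R h \<sigma>))" using i by (rule integrable_norm)
      show "integrable lborel (\<lambda>\<sigma>. indicat_real {0..t} \<sigma> *\<^sub>R k \<sigma>)" using k has_bochner_integral_iff by blast
      show "AE \<sigma> in lborel. norm (indicat_real {0..t} \<sigma> *\<^sub>R h \<sigma>) \<le> indicat_real {0..t} \<sigma> *\<^sub>R k \<sigma>"
        using M(2)[OF u]
      proof eventually_elim
        case (elim \<sigma>)
        show ?case
        proof (cases "\<sigma> \<in> {0..t}")
          case True
          have "norm (h \<sigma>) = norm (flow A (\<tau> + (t - \<sigma>)) (Pm (inp u \<sigma>)))"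
            by (simp only: h_def flow_add)
          also have "\<dots> \<le> K1 * exp (\<beta> * (\<tau> + (t - \<sigma>))) * norm (Pm (inp u \<sigma>))"
            using True \<tau> by (intro forward Pm_in) auto
          also have "\<dots> \<le> K1 * exp (\<beta> * (\<tau> + (t - \<sigma>))) * (P * M)"
          proof (rule mult_left_mono)
            show "norm (Pm (inp u \<sigma>)) \<le> P * M"
              using P(2)[of "inp u \<sigma>"] mult_left_mono[OF elim, of P] P(1) by linarith
          qed (use K1_pos in simp)
          also have "\<dots> = k \<sigma>" by (simp add: k_def exp_add distrib_left)
          finally show ?thesis using True by simp
        qed simp
      qed
    qed
    also have "\<dots> = exp (\<beta> * \<tau>) * (C * (exp (\<beta> * t) - 1))"
      using k by (rule has_bochner_integral_integral_eq)
    finally show "exp (- \<beta> * \<tau>) * norm (flow A \<tau> (Pm (LINT \<sigma>:{0..t}|lborel. flow A (t - \<sigma>) (inp u \<sigma>))))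
        \<le> C * (exp (\<beta> * t) - 1)"
      by (simp add: exp_minus field_simps)
  qed
  moreover have "C > 0" using K1_pos P M \<beta> by (simp add: C_def)
  ultimately show ?thesis by blast
next
  case False
  then show ?thesis by (intro exI[of _ 1]) simp
qed

section \<open>Slow subspaces and the adapted norm on them\<close>

definition C :: real where
  "C = (SOME C. C > 0 \<and> (\<forall>u\<in>controls U. \<forall>t\<ge>0. 0 < l0 \<longrightarrow>
     Pn.anorm (Pm (LINT \<sigma>:{0..t}|lborel. flow A (t - \<sigma>) (inp u \<sigma>))) \<le> C * (exp (\<beta> * t) - 1)))"

lemma C_pos: "C > 0"
  and C_bound: "u \<in> controls U \<Longrightarrow> t \<ge> 0 \<Longrightarrow> 0 < l0 \<Longrightarrow>
     Pn.anorm (Pm (LINT \<sigma>:{0..t}|lborel. flow A (t - \<sigma>) (inp u \<sigma>))) \<le> C * (exp (\<beta> * t) - 1)"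
  using someI_ex[OF duhamel_anorm] unfolding C_def by blast+

text \<open>One formula for both signs of \<open>l0\<close>. For positive \<open>l0\<close> the
  space \<open>L_zero A\<close> is contained in \<open>lsum A {..<l0}\<close>, so the center bundle
  contributes only the direction (e(u,0), 1) in addition.\<close>

definition V :: "(real^'m) linf \<Rightarrow> 'n lifted set" where
  "V u = {(r *\<^sub>R e_sol A B u 0 + x, r) | r x. x \<in> lsum A {..<l0} \<and> (l0 < 0 \<longrightarrow> r = 0)}"

lemma subspace_V: "subspace (V u)"
proof (rule subspaceI)
  show "0 \<in> V u" unfolding V_def by (intro CollectI exI[of _ 0]) (simp add: subspace_0 zero_prod_def)
  fix v w :: "'n lifted" and c :: real
  assume "v \<in> V u"
  then obtain r x where v: "v = (r *\<^sub>R e_sol A B u 0 + x, r)" "x \<in> lsum A {..<l0}" "l0 < 0 \<longrightarrow> r = 0"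
    unfolding V_def by blast
  show "c *\<^sub>R v \<in> V u"
    unfolding V_def using v
    by (intro CollectI exI[of _ "c * r"] exI[of _ "c *\<^sub>R x"]) (simp add: subspace_scale scaleR_add_right)
  assume "w \<in> V u"
  then obtain q y where w: "w = (q *\<^sub>R e_sol A B u 0 + y, q)" "y \<in> lsum A {..<l0}" "l0 < 0 \<longrightarrow> q = 0"
    unfolding V_def by blast
  show "v + w \<in> V u"
    unfolding V_def using v w
    by (intro CollectI exI[of _ "r + q"] exI[of _ "x + y"]) (simp add: subspace_add scaleR_add_left)
qed

text \<open>The weight C absorbs the input: e^{\<beta>t} a + |r| C (e^{\<beta>t} - 1) + C |r| =
  e^{\<beta>t} (a + C |r|). It is a norm on \<open>V u\<close>, but only a seminorm on the whole
  space, where it ignores multiples of points of \<open>SL\<close>.\<close>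

definition vn :: "'n lifted \<Rightarrow> real" where
  "vn w = Pn.anorm (Pm (fst w)) + C * \<bar>snd w\<bar>"

text \<open>Dividing by the norm of s makes the size invariant under a common positive rescaling of
  s and w, as it occurs when the flow is projected to the sphere.\<close>

definition N :: "'n lifted \<Rightarrow> 'n lifted \<Rightarrow> real" where
  "N s w = vn w / Qn.anorm (fst s)"

text \<open>The hyperbolic part of the Duhamel integral moves e(u,0) to e(u,t), the value for the
  shifted control. Its part in \<open>lsum A {0}\<close> joins the slow component x, as 0 lies below
  \<open>l0\<close> whenever r can be nonzero.\<close>

lemma phi1_V:
  assumes u: "u \<in> controls U" and w: "w \<in> V u" and t: "t \<ge> 0"
  shows "phi1 A B t w u \<in> V (shift t u)" "vn (phi1 A B t w u) \<le> exp (\<beta> * t) * vn w"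
proof -
  obtain r x where w: "w = (r *\<^sub>R e_sol A B u 0 + x, r)" "x \<in> lsum A {..<l0}" "l0 < 0 \<longrightarrow> r = 0"
    using w unfolding V_def by blast
  define I where "I = (LINT \<sigma>:{0..t}|lborel. flow A (t - \<sigma>) (inp u \<sigma>))"
  have phi: "phi1 A B t w u = (flow A t (fst w) + r *\<^sub>R I, r)"
    by (simp add: phi1_eq[OF t] w(1) I_def)
  have "flow A t (fst w) + r *\<^sub>R I =
      r *\<^sub>R e_sol A B (shift t u) 0 + (flow A t x + r *\<^sub>R lproj A {0} I)"
    using lproj_UNIV[of "- {0}" I]
    by (simp add: w(1) e_sol_shift e_sol_duhamel[OF t, of u] I_def[symmetric] flow_linear_simps
        scaleR_add_right[symmetric] add.assoc)
  moreover have "r *\<^sub>R lproj A {0} I \<in> lsum A {..<l0}"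
  proof (cases "l0 < 0")
    case True
    then show ?thesis using w by (simp add: subspace_0)
  next
    case False
    then have "lsum A {0} \<subseteq> lsum A {..<l0}" using l0_nonzero by (intro lsum_mono) auto
    then show ?thesis using lproj_in[of "{0}" I] by (intro subspace_scale) auto
  qed
  ultimately show "phi1 A B t w u \<in> V (shift t u)"
    unfolding V_def phi using w
    by (intro CollectI exI[of _ r] exI[of _ "flow A t x + r *\<^sub>R lproj A {0} I"])
      (simp add: subspace_add lsum_flow)
  have Pn_r: "Pn.anorm (r *\<^sub>R Pm I) \<le> \<bar>r\<bar> * (C * (exp (\<beta> * t) - 1))"
  proof (cases "l0 < 0")
    case True
    then show ?thesis using w by (simp add: Pn.anorm_0)
  next
    case False
    then have "Pn.anorm (Pm I) \<le> C * (exp (\<beta> * t) - 1)"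
      unfolding I_def using l0_nonzero by (intro C_bound u t) auto
    then show ?thesis by (simp add: Pn.anorm_scale Pm_in mult_left_mono)
  qed
  have "vn (phi1 A B t w u) = Pn.anorm (flow A t (Pm (fst w)) + r *\<^sub>R Pm I) + C * \<bar>r\<bar>"
    by (simp add: vn_def phi lproj_add lproj_scale lproj_flow)
  also have "\<dots> \<le> (Pn.anorm (flow A t (Pm (fst w))) + Pn.anorm (r *\<^sub>R Pm I)) + C * \<bar>r\<bar>"
    by (intro add_right_mono Pn.anorm_triangle lsum_flow Pm_in subspace_scale subspace_lsum)
  also have "\<dots> \<le> (exp (\<beta> * t) * Pn.anorm (Pm (fst w)) + \<bar>r\<bar> * (C * (exp (\<beta> * t) - 1))) + C * \<bar>r\<bar>"
    by (intro add_right_mono add_mono Pn_flow t Pm_in Pn_r)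
  also have "\<dots> = exp (\<beta> * t) * vn w" by (simp add: vn_def w(1) algebra_simps)
  finally show "vn (phi1 A B t w u) \<le> exp (\<beta> * t) * vn w" .
qed

lemma SL_simps:
  assumes "s \<in> SL"
  shows "snd s = 0" "fst s \<in> lsum A {l0}" "s \<in> psphere ip" "s \<in> psphere0 ip" "fst s \<noteq> 0" "Pm (fst s) = 0"
proof -
  have "s \<in> L_inf A l0" and p: "s \<in> psphere ip" using SL assms by (auto simp: is_SL_def)
  then show s: "snd s = 0" "fst s \<in> lsum A {l0}" by (auto simp: L_inf_def lsum_singleton)
  show "s \<in> psphere ip" by (rule p)
  then show "s \<in> psphere0 ip" using s by (simp add: psphere0_def)
  then show "fst s \<noteq> 0" by (rule psphere0_fst_nonzero)
  show "Pm (fst s) = 0" using s by (rule_tac lproj_disjoint) auto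
qed

lemma vn_nonneg: "0 \<le> vn w"
  using C_pos by (simp add: vn_def Pn.anorm_nonneg Pm_in)

lemma vn_scale: "vn (c *\<^sub>R w) = \<bar>c\<bar> * vn w"
  by (simp add: vn_def lproj_scale Pn.anorm_scale Pm_in abs_mult algebra_simps)

lemma Qn_pos: "s \<in> SL \<Longrightarrow> Qn.anorm (fst s) > 0"
  using Qn.norm_le_anorm[of "fst s"] SL_simps[of s] by (meson less_le_trans zero_less_norm_iff)

lemma N_nonneg: "s \<in> SL \<Longrightarrow> 0 \<le> N s w"
  using vn_nonneg[of w] Qn_pos[of s] by (simp add: N_def)

lemma N_scale: "N s (c *\<^sub>R w) = \<bar>c\<bar> * N s w"
  by (simp add: N_def vn_scale)

text \<open>The tangential part differs from w by a multiple of s, which has no slow component and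
  no last coordinate. So elements of \<open>V u\<close> and their tangential parts have the same
  size.\<close>

lemma vn_tproj: "s \<in> SL \<Longrightarrow> vn (tproj ip s w) = vn w"
  using SL_simps[of s] by (simp add: vn_def tproj_def lproj_diff lproj_scale)

lemma N_tproj: "s \<in> SL \<Longrightarrow> N s (tproj ip s w) = N s w"
  by (simp add: N_def vn_tproj)

text \<open>Recovers the element of \<open>V u\<close> from its tangential part at a point of \<open>SL\<close>.\<close>

definition wlift :: "real^'n \<Rightarrow> 'n lifted \<Rightarrow> 'n lifted" where
  "wlift e v = (Pm (fst v) + snd v *\<^sub>R (e - Pm e), snd v)"

lemma wlift_tproj:
  assumes "s \<in> SL" "w \<in> V u"
  shows "wlift (e_sol A B u 0) (tproj ip s w) = w"
proof -
  obtain r x where w: "w = (r *\<^sub>R e_sol A B u 0 + x, r)" "x \<in> lsum A {..<l0}"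
    using assms(2) unfolding V_def by blast
  then show ?thesis using SL_simps[OF assms(1)]
    by (simp add: wlift_def tproj_def lproj_diff lproj_scale lproj_add lproj_id algebra_simps)
qed

lemma wlift_scale: "wlift e (c *\<^sub>R v) = c *\<^sub>R wlift e v"
  by (simp add: wlift_def lproj_scale scaleR_add_right)

text \<open>Uniform in the control and in the base point: e(u,0) is bounded over all controls, and
  \<open>Qn.anorm\<close> lies between positive constants on unit vectors. The first inequality is
  restricted to \<open>V u\<close> because \<open>vn\<close> is only a seminorm elsewhere.\<close>

lemma exists_comparison:
  "\<exists>K>0. (\<forall>u\<in>controls U. \<forall>s\<in>SL. \<forall>w\<in>V u. nrm ip w \<le> K * N s w) \<and> (\<forall>s\<in>SL. \<forall>w. N s w \<le> K * nrm ip w)"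
proof -
  obtain c0 C0 where c0: "c0 > 0" "C0 > 0" "\<And>p. c0 * norm p \<le> nrm ip p" "\<And>p. nrm ip p \<le> C0 * norm p"
    using nrm_norm_equiv by blast
  obtain P where P: "P > 0" "\<And>x. norm (Pm x) \<le> P * norm x"
    using linear_bounded_pos[OF linear_lproj] by (metis mult.commute)
  obtain e0 where e0: "e0 > 0" "\<And>u. u \<in> controls U \<Longrightarrow> norm (e_sol A B u 0) \<le> e0"
    using e_sol_bound by blast
  have Qb: "1 / C0 \<le> Qn.anorm (fst s)" "Qn.anorm (fst s) \<le> K2 / c0" if s: "s \<in> SL" for s
  proof -
    have n: "norm s = norm (fst s)" using SL_simps[OF s] by (simp add: norm_prod_def)
    have 1: "nrm ip s = 1" using SL_simps[OF s] by (simp add: psphere_def)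
    have "1 \<le> C0 * norm (fst s)" using c0(4)[of s] n 1 by simp
    moreover have "norm (fst s) \<le> Qn.anorm (fst s)" by (intro Qn.norm_le_anorm SL_simps s)
    ultimately have "1 \<le> C0 * Qn.anorm (fst s)" using c0 by (meson mult_left_mono less_imp_le order_trans)
    then show "1 / C0 \<le> Qn.anorm (fst s)" using c0 by (simp add: field_simps)
    have "c0 * norm (fst s) \<le> 1" using c0(3)[of s] n 1 by simp
    then have "K2 * (c0 * norm (fst s)) \<le> K2 * 1" using K2_pos by (intro mult_left_mono) auto
    moreover have "Qn.anorm (fst s) \<le> K2 * norm (fst s)" by (intro Qn.anorm_le_norm SL_simps s)
    then have "c0 * Qn.anorm (fst s) \<le> c0 * (K2 * norm (fst s))" using c0 by (intro mult_left_mono) auto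
    ultimately have "c0 * Qn.anorm (fst s) \<le> K2" by (simp add: mult_ac)
    then show "Qn.anorm (fst s) \<le> K2 / c0" using c0 by (simp add: field_simps)
  qed
  define a where "a = 1 + (e0 + P * e0 + 1) / C"
  have a: "a > 0" using C_pos e0 P by (simp add: a_def add_pos_nonneg)
  have lower: "norm w \<le> a * vn w" if u: "u \<in> controls U" and w: "w \<in> V u" for u w
  proof -
    obtain r x where w: "w = (r *\<^sub>R e_sol A B u 0 + x, r)" "x \<in> lsum A {..<l0}"
      using w unfolding V_def by blast
    define e where "e = e_sol A B u 0"
    have x: "x = Pm (fst w) - r *\<^sub>R Pm e" using w by (simp add: lproj_add lproj_scale lproj_id e_def)
    have ne: "norm e \<le> e0" using e0(2)[OF u] by (simp add: e_def)
    then have nPe: "norm (Pm e) \<le> P * e0" using P(2)[of e] mult_left_mono[OF ne, of P] P(1) by linarith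
    have "norm w \<le> norm (fst w) + norm (snd w)" using norm_Pair_le[of "fst w" "snd w"] by simp
    also have "norm (fst w) \<le> norm (r *\<^sub>R e) + norm x" using norm_triangle_ineq[of "r *\<^sub>R e" x] by (simp add: w(1) e_def)
    also have "norm x \<le> norm (Pm (fst w)) + norm (r *\<^sub>R Pm e)" unfolding x by (rule norm_triangle_ineq4)
    also have "norm (r *\<^sub>R e) \<le> \<bar>r\<bar> * e0" using ne by (simp add: mult_left_mono)
    also have "norm (r *\<^sub>R Pm e) \<le> \<bar>r\<bar> * (P * e0)" using nPe by (simp add: mult_left_mono)
    also have "norm (Pm (fst w)) \<le> Pn.anorm (Pm (fst w))" by (intro Pn.norm_le_anorm Pm_in)
    finally have "norm w \<le> Pn.anorm (Pm (fst w)) + \<bar>r\<bar> * (e0 + P * e0 + 1)"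
      by (simp add: w(1) algebra_simps)
    also have "\<bar>r\<bar> * (e0 + P * e0 + 1) = (C * \<bar>r\<bar>) * ((e0 + P * e0 + 1) / C)" using C_pos by simp
    also have "Pn.anorm (Pm (fst w)) + (C * \<bar>r\<bar>) * ((e0 + P * e0 + 1) / C) \<le> a * vn w"
    proof -
      define b where "b = (e0 + P * e0 + 1) / C"
      have b: "0 \<le> b" using C_pos e0 P by (simp add: b_def)
      have "(C * \<bar>r\<bar>) * b \<le> vn w * b"
        using b Pn.anorm_nonneg[OF Pm_in, of "fst w"] by (intro mult_right_mono) (simp_all add: vn_def w(1))
      moreover have "Pn.anorm (Pm (fst w)) \<le> vn w" using C_pos by (simp add: vn_def)
      ultimately have "Pn.anorm (Pm (fst w)) + (C * \<bar>r\<bar>) * b \<le> (1 + b) * vn w" by (simp add: algebra_simps)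
      then show ?thesis by (simp add: a_def b_def)
    qed
    finally show ?thesis .
  qed
  have upper: "vn w \<le> (K1 * P + C) * norm w" for w
  proof -
    have "Pn.anorm (Pm (fst w)) \<le> K1 * norm (Pm (fst w))" by (intro Pn.anorm_le_norm Pm_in)
    also have "\<dots> \<le> K1 * (P * norm w)"
      using K1_pos P(1) order_trans[OF P(2) mult_left_mono[OF norm_fst_le[of "fst w" "snd w"], of P]]
      by (intro mult_left_mono) auto
    finally have "Pn.anorm (Pm (fst w)) \<le> K1 * (P * norm w)" .
    moreover have "C * \<bar>snd w\<bar> \<le> C * norm w"
      using C_pos norm_snd_le[of "snd w" "fst w"] by (intro mult_left_mono) auto
    ultimately show ?thesis by (simp add: vn_def algebra_simps)
  qed
  define K where "K = max (C0 * a * (K2 / c0)) ((K1 * P + C) / c0 * C0)"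
  have "nrm ip w \<le> K * N s w" if "u \<in> controls U" "s \<in> SL" "w \<in> V u" for u s w
  proof -
    have "nrm ip w \<le> C0 * (a * vn w)"
      using c0(4)[of w] mult_left_mono[OF lower[OF that(1,3)], of C0] c0(2) by linarith
    also have "vn w = N s w * Qn.anorm (fst s)" using Qn_pos[OF that(2)] by (simp add: N_def)
    also have "C0 * (a * (N s w * Qn.anorm (fst s))) \<le> C0 * (a * (N s w * (K2 / c0)))"
      using c0 a Qb(2)[OF that(2)] N_nonneg[OF that(2), of w] by (intro mult_left_mono) auto
    also have "\<dots> = (C0 * a * (K2 / c0)) * N s w" by simp
    also have "\<dots> \<le> K * N s w"
      unfolding K_def using N_nonneg[OF that(2), of w] by (intro mult_right_mono max.cobounded1)
    finally show ?thesis .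
  qed
  moreover have "N s w \<le> K * nrm ip w" if "s \<in> SL" for s w
  proof -
    have "N s w \<le> vn w * C0"
    proof -
      have "1 \<le> Qn.anorm (fst s) * C0" using Qb(1)[OF that] c0 by (simp add: field_simps)
      then have "vn w * 1 \<le> vn w * (Qn.anorm (fst s) * C0)" by (rule mult_left_mono[OF _ vn_nonneg])
      then show ?thesis using Qn_pos[OF that] by (simp add: N_def field_simps)
    qed
    also have "vn w \<le> (K1 * P + C) * (nrm ip w / c0)"
    proof -
      have "norm w \<le> nrm ip w / c0" using c0(1,3) by (simp add: field_simps)
      then show ?thesis using upper[of w] mult_left_mono[of "norm w" "nrm ip w / c0" "K1 * P + C"] K1_pos P(1) C_pos
        by (smt (verit) mult_pos_pos)
    qed
    then have "vn w * C0 \<le> ((K1 * P + C) * (nrm ip w / c0)) * C0" using c0 by (intro mult_right_mono) auto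
    also have "\<dots> = ((K1 * P + C) / c0 * C0) * nrm ip w" by simp
    also have "\<dots> \<le> K * nrm ip w"
      unfolding K_def by (intro mult_right_mono max.cobounded2) simp
    finally show ?thesis .
  qed
  moreover have "K > 0"
  proof -
    have "0 < C0 * a * (K2 / c0)" using c0 a K2_pos by simp
    then show ?thesis unfolding K_def by linarith
  qed
  ultimately show ?thesis by blast
qed

end

lemma prod_topology_euclidean: "prod_topology euclidean euclidean = euclidean"
  using prod_topology_subtopology_eu[of UNIV UNIV] by simp

context stable_setting
begin

section \<open>The stable bundle, the manifold and its chart\<close>

definition E :: "('n, 'm) sbundle" where "E = SV_minus ip A B U l0 SL"

lemma tproj_image_span: "span (tproj ip s ` X) = tproj ip s ` span X"
  by (rule linear_span_image[OF linear_tproj])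

text \<open>The tangential projection is linear, so it commutes with spans, and \<open>V u\<close>
  is the span of the vectors that generate the summands before projection.\<close>

lemma fibre_E:
  assumes u: "u \<in> controls U" and s: "s \<in> SL"
  shows "fibre E u s = tproj ip s ` V u"
proof -
  define e where "e = e_sol A B u 0"
  define Vc where "Vc = {(r *\<^sub>R e + y, r) | r y. y \<in> L_zero A}"
  define ks where "ks = {k \<in> lyapunov_exponents A. k < l0 \<and> k \<noteq> 0}"
  define X where "X = (if l0 > 0 then Vc else {}) \<union> (\<Union>k\<in>ks. lyapunov_space A k \<times> {0})"
  have fc: "fibre (SV_c ip A B U SL) u s = tproj ip s ` Vc"
  proof -
    have "fibre (SV_c ip A B U SL) u s = tproj ip s ` {p. (u, p) \<in> V_c A B U}"
      unfolding fibre_def SV_c_def using s by blast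
    also have "{p. (u, p) \<in> V_c A B U} = Vc"
      using u by (auto simp: V_c_def Vc_def e_def)
    finally show ?thesis .
  qed
  have fk: "fibre (SV ip A U SL k) u s = tproj ip s ` (lyapunov_space A k \<times> {0})" for k
    unfolding fibre_def SV_def using u s by blast
  have "(\<Union>E\<in>(if l0 > 0 then {SV_c ip A B U SL} else {}) \<union> SV ip A U SL ` ks. fibre E u s) = tproj ip s ` X"
    unfolding X_def by (simp add: fc fk image_Un image_UN)
  then have "fibre E u s = span (tproj ip s ` X)"
    using u s by (simp add: E_def SV_minus_def bundle_sum_def fibre_def ks_def)
  moreover have "span X = V u"
  proof (rule span_unique)
    show "subspace (V u)" by (rule subspace_V)
    have X_V: "x \<in> V u" if "x \<in> X" for x
      using that unfolding X_def
    proof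
      assume "x \<in> (if l0 > 0 then Vc else {})"
      then obtain r y where x: "x = (r *\<^sub>R e + y, r)" "y \<in> lsum A {0}" "l0 > 0"
        by (auto simp: Vc_def L_zero_eq split: if_splits)
      then have "y \<in> lsum A {..<l0}" using lsum_mono[of "{0}" "{..<l0}" A] by auto
      then show "x \<in> V u" unfolding V_def using x by (auto simp: e_def)
    next
      assume "x \<in> (\<Union>k\<in>ks. lyapunov_space A k \<times> {0})"
      then obtain k y where x: "x = (y, 0)" "k < l0" "y \<in> lyapunov_space A k" by (auto simp: ks_def)
      then have "y \<in> lsum A {..<l0}" using lyapunov_space_subset_lsum[of k "{..<l0}" A] by auto
      then show "x \<in> V u" unfolding V_def using x by (intro CollectI exI[of _ 0] exI[of _ y]) simp
    qed
    then show "X \<subseteq> V u" by blast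
    show "V u \<subseteq> T" if "X \<subseteq> T" "subspace T" for T
    proof
      fix w assume "w \<in> V u"
      then obtain r x where w: "w = (r *\<^sub>R e + x, r)" "x \<in> lsum A {..<l0}" "l0 < 0 \<longrightarrow> r = 0"
        unfolding V_def e_def by blast
      have "(x, 0) \<in> T"
        using w(2)
      proof (induction rule: lsum_induct)
        case zero
        then show ?case using subspace_0[OF that(2)] by (simp add: zero_prod_def)
      next
        case (step k c y z)
        have "(y, 0) \<in> X"
        proof (cases "k = 0")
          \<comment> \<open>The exponent 0 has no bundle \<open>SV\<close> of its own among the
            summands; its space enters through the center bundle with r = 0, which is present
            because 0 = k < \<open>l0\<close>.\<close>
          case True
          have "(0 *\<^sub>R e + y, 0) \<in> Vc"
            unfolding Vc_def L_zero_eq using step True by (intro CollectI exI[of _ 0] exI[of _ y]) (simp add: lsum_singleton)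
          then show ?thesis using step True by (simp add: X_def)
        next
          case False
          then show ?thesis using step by (auto simp: X_def ks_def)
        qed
        then have "c *\<^sub>R (y, 0) + (z, 0) \<in> T"
          using step.IH that by (intro subspace_add subspace_scale) auto
        then show ?case by simp
      qed
      moreover have "(r *\<^sub>R e, r) \<in> T"
      proof (cases "l0 > 0")
        case True
        have "(r *\<^sub>R e + 0, r) \<in> Vc" unfolding Vc_def L_zero_eq by (blast intro: subspace_0 subspace_lsum)
        then show ?thesis using True that(1) by (auto simp: X_def)
      next
        case False
        then show ?thesis using w l0_nonzero subspace_0[OF that(2)] by (simp add: zero_prod_def)
      qed
      ultimately have "(r *\<^sub>R e, r) + (x, 0) \<in> T" by (intro subspace_add that)
      then show "w \<in> T" using w by simp
    qed
  qed
  ultimately show ?thesis by (simp add: tproj_image_span)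
qed

lemma mem_E: "(u, s, v) \<in> E \<longleftrightarrow> u \<in> controls U \<and> s \<in> SL \<and> v \<in> tproj ip s ` V u"
proof -
  have "(u, s, v) \<in> E \<longleftrightarrow> u \<in> controls U \<and> s \<in> SL \<and> v \<in> fibre E u s"
    by (auto simp: fibre_def E_def SV_minus_def bundle_sum_def)
  then show ?thesis using fibre_E by blast
qed

definition K :: real where
  "K = (SOME K. K > 0 \<and> (\<forall>u\<in>controls U. \<forall>s\<in>SL. \<forall>w\<in>V u. nrm ip w \<le> K * N s w) \<and>
     (\<forall>s\<in>SL. \<forall>w. N s w \<le> K * nrm ip w))"

lemma K_pos: "K > 0"
  and nrm_le_N: "u \<in> controls U \<Longrightarrow> s \<in> SL \<Longrightarrow> w \<in> V u \<Longrightarrow> nrm ip w \<le> K * N s w"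
  and N_le_nrm: "s \<in> SL \<Longrightarrow> N s w \<le> K * nrm ip w"
  using someI_ex[OF exists_comparison] unfolding K_def by blast+

lemma N_le_nrm_tproj: "s \<in> SL \<Longrightarrow> N s w \<le> K * nrm ip (tproj ip s w)"
  using N_le_nrm[of s "tproj ip s w"] N_tproj[of s w] by simp

text \<open>With this radius, vectors in the adapted ball have norm below 1/2, so adding one to s
  cannot cancel the radial component of s.\<close>

definition \<delta> :: real where "\<delta> = 1 / (2 * K)"

lemma \<delta>_pos: "\<delta> > 0" using K_pos by (simp add: \<delta>_def)

lemma lift_small:
  assumes "u \<in> controls U" "s \<in> SL" "w \<in> V u" "N s w < \<delta>"
  shows "\<bar>ip_lift ip w s\<bar> < 1"
proof -
  have "nrm ip w \<le> K * N s w" by (rule nrm_le_N[OF assms(1-3)])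
  also have "\<dots> < K * \<delta>" using assms(4) K_pos by simp
  also have "\<dots> < 1" using K_pos by (simp add: \<delta>_def)
  finally have w: "nrm ip w < 1" .
  have s: "nrm ip s = 1" using SL_simps[OF assms(2)] by (simp add: psphere_def)
  show ?thesis using lift_CS[of w s] w s by simp
qed

text \<open>A vanishing sum would put the nonzero vector \<open>fst s\<close>, which belongs to the
  exponent \<open>l0\<close>, into the sum of the spaces with smaller exponents.\<close>

lemma nonzero_sum:
  assumes "s \<in> SL" "w \<in> V u"
  shows "s + w \<noteq> 0"
proof
  assume *: "s + w = 0"
  obtain r x where w: "w = (r *\<^sub>R e_sol A B u 0 + x, r)" "x \<in> lsum A {..<l0}"
    using assms(2) unfolding V_def by blast
  have "snd w = 0" "fst w = - fst s" using * SL_simps[OF assms(1)] by (auto simp: prod_eq_iff eq_neg_iff_add_eq_0 add.commute)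
  then have "- fst s = x" using w by simp
  then have "fst s \<in> lsum A {..<l0}" using w(2) subspace_neg[OF subspace_lsum, of x A "{..<l0}"] by auto
  then show False using lsum_Int_0[of "fst s" "{..<l0}" "{l0}"] SL_simps[OF assms(1)] by auto
qed

text \<open>Parametrized by vectors of \<open>V u\<close>, on which the lifted flow is linear,
  rather than by tangent vectors; it is identified with the image of the chart below.\<close>

definition W :: "('n, 'm) sbundle" where
  "W = {(u, s, sproj ip (s + w)) | u s w. u \<in> controls U \<and> s \<in> SL \<and> w \<in> V u \<and> N s w < \<delta>}"

text \<open>The radial factor turns the ball of radius \<open>\<delta>\<close> in the given norm into the ball of
  radius \<open>\<delta>\<close> in the adapted norm \<open>N\<close>, which shrinks along the flow.\<close>

definition S :: "(real^'m) linf \<times> 'n lifted \<times> 'n lifted \<Rightarrow> (real^'m) linf \<times> 'n lifted \<times> 'n lifted" where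
  "S = (\<lambda>(u, s, v). (u, s, sproj ip (s + wlift (e_sol A B u 0) ((nrm ip v / N s v) *\<^sub>R v))))"

text \<open>The inverse of w \<mapsto> \<pi>(s + w) on \<open>V u\<close>. Once the component of e
  outside the slow spaces is removed, the rest of w is orthogonal to s, so pairing with s recovers
  the scalar by which s + w was divided.\<close>

definition rec :: "real^'n \<Rightarrow> 'n lifted \<Rightarrow> 'n lifted \<Rightarrow> 'n lifted" where
  "rec e s q = q /\<^sub>R ip (fst q - snd q *\<^sub>R (e - Pm e)) (fst s) - s"

lemma rec_denominator:
  assumes s: "s \<in> SL" and w: "w \<in> V u"
  shows "ip (fst (c *\<^sub>R (s + w)) - snd (c *\<^sub>R (s + w)) *\<^sub>R (e_sol A B u 0 - Pm (e_sol A B u 0))) (fst s) = c"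
proof -
  obtain r x where w: "w = (r *\<^sub>R e_sol A B u 0 + x, r)" "x \<in> lsum A {..<l0}"
    using w unfolding V_def by blast
  define e where "e = e_sol A B u 0"
  have "fst (c *\<^sub>R (s + w)) - snd (c *\<^sub>R (s + w)) *\<^sub>R (e - Pm e) = c *\<^sub>R (fst s + (x + r *\<^sub>R Pm e))"
    using SL_simps[OF s] by (simp add: w(1) e_def[symmetric] algebra_simps)
  moreover have "ip (x + r *\<^sub>R Pm e) (fst s) = 0"
    using w(2) Pm_in[of e] SL_simps[OF s]
    by (intro lsum_orthogonal[of _ "{..<l0}" _ "{l0}"] subspace_add subspace_scale) auto
  moreover have "ip (fst s) (fst s) = 1"
    using lift_psphere[OF SL_simps(3)[OF s]] SL_simps[OF s] by (simp add: ip_lift_def)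
  ultimately show ?thesis by (simp add: e_def ip_simps)
qed

lemma rec_sproj:
  assumes "s \<in> SL" "w \<in> V u"
  shows "rec (e_sol A B u 0) s (sproj ip (s + w)) = w"
proof -
  define c where "c = inverse (nrm ip (s + w))"
  have c: "c > 0" using nrm_pos[OF nonzero_sum[OF assms]] by (simp add: c_def)
  have "sproj ip (s + w) = c *\<^sub>R (s + w)" by (simp add: sproj_def c_def)
  then show ?thesis
    unfolding rec_def using rec_denominator[OF assms, of c] c by simp
qed

text \<open>The inverse of the radial rescaling: the direction of the tangential part, with length
  \<open>N s w\<close>.\<close>

definition unb :: "'n lifted \<Rightarrow> 'n lifted \<Rightarrow> 'n lifted" where
  "unb s w = (N s w / nrm ip (tproj ip s w)) *\<^sub>R tproj ip s w"

lemma N_pos_iff: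
  assumes "u \<in> controls U" "s \<in> SL" "w \<in> V u"
  shows "N s w = 0 \<longleftrightarrow> w = 0" "tproj ip s w = 0 \<longleftrightarrow> w = 0"
proof -
  have t0: "tproj ip s 0 = 0" by (rule linear_0[OF linear_tproj])
  have "N s w = 0 \<Longrightarrow> w = 0"
    using nrm_le_N[OF assms] nrm_nonneg[of w] nrm_eq_0_iff[of w] by simp
  moreover have "tproj ip s w = 0 \<Longrightarrow> N s w = 0"
    using N_le_nrm_tproj[OF assms(2), of w] N_nonneg[OF assms(2), of w] by simp
  moreover have "N s 0 = 0" using N_scale[of s 0 0] by simp
  ultimately show "N s w = 0 \<longleftrightarrow> w = 0" "tproj ip s w = 0 \<longleftrightarrow> w = 0" using t0 by blast+
qed

lemma wlift_E:
  assumes "u \<in> controls U" "s \<in> SL" "w \<in> V u"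
  shows "wlift (e_sol A B u 0) ((nrm ip (tproj ip s w) / N s (tproj ip s w)) *\<^sub>R tproj ip s w) =
    (nrm ip (tproj ip s w) / N s w) *\<^sub>R w"
  using wlift_tproj[OF assms(2,3)] by (simp add: wlift_scale N_tproj assms)

text \<open>The rescaled vector w' has \<open>N s w' = nrm ip v\<close>, so the two balls of radius
  \<delta> correspond. At v = 0 the factor is the quotient 0/0 = 0 and multiplies the zero
  vector.\<close>

lemma S_in_W:
  assumes "(u, s, v) \<in> ball_bundle ip E \<delta>"
  shows "S (u, s, v) \<in> W" "fst (snd (S (u, s, v))) = s"
    "unb s (rec (e_sol A B u 0) s (snd (snd (S (u, s, v))))) = v"
proof -
  obtain w where w: "v = tproj ip s w" "w \<in> V u" and u: "u \<in> controls U" and s: "s \<in> SL" and n: "nrm ip v < \<delta>"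
    using assms unfolding ball_bundle_def mem_E by auto
  define w' where "w' = (nrm ip v / N s w) *\<^sub>R w"
  have S: "S (u, s, v) = (u, s, sproj ip (s + w'))"
    using wlift_E[OF u s w(2)] by (simp add: S_def w(1) w'_def)
  have w'V: "w' \<in> V u" unfolding w'_def using w(2) subspace_V by (intro subspace_scale)
  have Nw': "N s w' = nrm ip v"
  proof (cases "w = 0")
    case True
    then show ?thesis using w(1) N_scale[of s 0 0] by (simp add: w'_def linear_0[OF linear_tproj])
  next
    case False
    then have "N s w > 0" using N_pos_iff(1)[OF u s w(2)] N_nonneg[OF s, of w] by linarith
    then show ?thesis by (simp add: w'_def N_scale)
  qed
  show "S (u, s, v) \<in> W" proof -
    have "N s w' < \<delta>" using Nw' n by simp
    then show ?thesis unfolding S W_def using u s w'V by blast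
  qed
  show "fst (snd (S (u, s, v))) = s" by (simp add: S)
  have "unb s w' = v"
  proof (cases "w = 0")
    case True
    then show ?thesis using w(1) by (simp add: unb_def w'_def linear_0[OF linear_tproj])
  next
    case False
    then have 1: "N s w > 0" "nrm ip v > 0"
      using N_pos_iff[OF u s w(2)] N_nonneg[OF s, of w] nrm_pos w(1) by (auto simp: less_le)
    have "tproj ip s w' = (nrm ip v / N s w) *\<^sub>R v" by (simp add: w'_def w(1) linear_scale[OF linear_tproj])
    then show ?thesis using 1 by (simp add: unb_def Nw' nrm_scale)
  qed
  then show "unb s (rec (e_sol A B u 0) s (snd (snd (S (u, s, v))))) = v"
    by (simp add: S rec_sproj[OF s w'V])
qed

lemma unb_in_ball:
  assumes u: "u \<in> controls U" and s: "s \<in> SL" and w: "w \<in> V u" "N s w < \<delta>"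
  shows "(u, s, unb s w) \<in> ball_bundle ip E \<delta>" "S (u, s, unb s w) = (u, s, sproj ip (s + w))"
proof -
  define t where "t = tproj ip s w"
  have n: "nrm ip (unb s w) = N s w"
  proof (cases "w = 0")
    case True
    then show ?thesis using N_scale[of s 0 0] by (simp add: unb_def linear_0[OF linear_tproj])
  next
    case False
    then have "nrm ip t > 0" using N_pos_iff[OF u s w(1)] nrm_pos by (simp add: t_def)
    then show ?thesis using N_nonneg[OF s, of w] by (auto simp: unb_def t_def nrm_scale)
  qed
  have V: "(N s w / nrm ip t) *\<^sub>R w \<in> V u" using w subspace_V by (intro subspace_scale)
  have t': "unb s w = tproj ip s ((N s w / nrm ip t) *\<^sub>R w)"
    by (simp add: unb_def t_def linear_scale[OF linear_tproj])
  show "(u, s, unb s w) \<in> ball_bundle ip E \<delta>"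
    unfolding ball_bundle_def using V t' u s n w by (auto simp: mem_E)
  have "wlift (e_sol A B u 0) ((nrm ip (unb s w) / N s (unb s w)) *\<^sub>R unb s w) = w"
  proof (cases "w = 0")
    case True
    then have "unb s w = 0" by (simp only: unb_def linear_0[OF linear_tproj] scaleR_zero_right)
    moreover have "wlift e 0 = 0" for e by (simp add: wlift_def lproj_0 zero_prod_def)
    ultimately show ?thesis using True by (simp only: scaleR_zero_right)
  next
    case False
    then have 1: "N s w > 0" "nrm ip t > 0"
      using N_pos_iff[OF u s w(1)] N_nonneg[OF s, of w] nrm_pos[of t] by (auto simp: less_le t_def)
    have "N s (unb s w) = (N s w / nrm ip t) * N s w"
      unfolding t' N_tproj[OF s] N_scale using 1 by simp
    then have eq: "nrm ip (unb s w) / N s (unb s w) = nrm ip t / N s w"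
      unfolding n using 1 by simp
    have "(nrm ip t / N s w) *\<^sub>R unb s w = t" using 1 by (simp add: unb_def t_def[symmetric])
    then show ?thesis unfolding eq using wlift_tproj[OF s w(1)] by (simp add: t_def)
  qed
  then show "S (u, s, unb s w) = (u, s, sproj ip (s + w))" by (simp add: S_def)
qed

lemma W_loc_eq: "W_loc ip E \<delta> S = W"
proof
  show "W_loc ip E \<delta> S \<subseteq> W"
    unfolding W_loc_def using S_in_W(1) by auto
  show "W \<subseteq> W_loc ip E \<delta> S"
  proof
    fix x assume "x \<in> W"
    then obtain u s w where x: "x = (u, s, sproj ip (s + w))" "u \<in> controls U" "s \<in> SL" "w \<in> V u" "N s w < \<delta>"
      unfolding W_def by blast
    show "x \<in> W_loc ip E \<delta> S"
      unfolding W_loc_def x(1) unb_in_ball(2)[OF x(2-5), symmetric] using unb_in_ball(1)[OF x(2-5)] by (rule imageI)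
  qed
qed

lemma W_subset: "W \<subseteq> controls U \<times> SL \<times> psphere ip"
  using sproj_in_psphere[OF nonzero_sum] by (auto simp: W_def)

lemma W_subset_cone: "W \<subseteq> angle_cone ip E (SV_plus ip A B U l0 SL) h" if "h > 0"
proof
  fix x assume "x \<in> W"
  then obtain u s w where x: "x = (u, s, sproj ip (s + w))" "u \<in> controls U" "s \<in> SL" "w \<in> V u" "N s w < \<delta>"
    unfolding W_def by blast
  \<comment> \<open>The component of w along s only rescales s. As 1 + a is positive, division by it
    turns s + w into s plus a vector of the stable fibre, and the other component of the cone can be
    taken to be 0.\<close>
  define a where "a = ip_lift ip w s"
  have a: "1 + a > 0" using lift_small[OF x(2-5)] by (simp add: a_def abs_less_iff)
  define v where "v = tproj ip s (inverse (1 + a) *\<^sub>R w)"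
  have "s + w = (1 + a) *\<^sub>R (s + v)"
    using a by (simp add: v_def linear_scale[OF linear_tproj] scaleR_add_right)
      (simp add: tproj_def a_def algebra_simps)
  then have "sproj ip (s + w) = sexp ip s (0 + v)"
    by (simp add: sproj_scale[OF a]) (simp add: sproj_def sexp_def)
  moreover have "(u, s, v) \<in> E"
    unfolding mem_E v_def using x subspace_V by (intro conjI imageI subspace_scale)
  moreover have "(u, s, 0) \<in> SV_plus ip A B U l0 SL"
    using x by (simp add: SV_plus_def bundle_sum_def span_0)
  moreover have "nrm ip 0 \<le> h * nrm ip v" using that by simp
  ultimately show "x \<in> angle_cone ip E (SV_plus ip A B U l0 SL) h"
    unfolding angle_cone_def x(1) by blast
qed

section \<open>Dynamics on the manifold: invariance and rate of attraction\<close>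

lemma phi1_linear:
  assumes "t \<ge> 0"
  shows "linear (\<lambda>p. phi1 A B t p u)"
  by (rule linearI) (simp_all add: phi1_eq[OF assms] flow_linear_simps algebra_simps)

lemma phi1_SL:
  assumes s: "s \<in> SL" and t: "t \<ge> 0"
  shows "phi1 A B t s u = (flow A t (fst s), 0)" "phi1 A B t s u \<noteq> 0"
    "sphi ip A B t s u = sflow0 ip A t s" "sphi ip A B t s u \<in> SL"
proof -
  show 1: "phi1 A B t s u = (flow A t (fst s), 0)"
    using SL_simps[OF s] by (simp add: phi1_eq[OF t])
  show "phi1 A B t s u \<noteq> 0" unfolding 1 using SL_simps[OF s] by (simp add: zero_prod_def)
  show 2: "sphi ip A B t s u = sflow0 ip A t s" by (simp add: sphi_def 1 sflow0_eq)
  show "sphi ip A B t s u \<in> SL" unfolding 2 by (rule SL_flow_invariant[OF SL s t])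
qed

text \<open>The flow maps \<open>s + w\<close> to a multiple of \<open>s' + w'\<close>, where \<open>s'\<close> is the image of \<open>s\<close> on
  the sphere and \<open>w'\<close> the image of \<open>w\<close> under the lifted flow on the same scale.\<close>

lemma flow_sum:
  assumes u: "u \<in> controls U" and s: "s \<in> SL" and w: "w \<in> V u" and t: "t \<ge> 0"
  defines "s' \<equiv> sphi ip A B t s u" and "w' \<equiv> phi1 A B t w u /\<^sub>R nrm ip (phi1 A B t s u)"
  shows "w' \<in> V (shift t u)" "N s' w' \<le> N s w" "sphi ip A B t (sproj ip (s + w)) u = sproj ip (s' + w')"
proof -
  define \<nu> where "\<nu> = nrm ip (phi1 A B t s u)"
  have \<nu>: "\<nu> > 0" using nrm_pos phi1_SL[OF s t] by (simp add: \<nu>_def)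
  show "w' \<in> V (shift t u)" unfolding w'_def using phi1_V(1)[OF u w t] subspace_V by (intro subspace_scale)
  have "fst s' = inverse \<nu> *\<^sub>R flow A t (fst s)"
    by (simp add: s'_def sphi_def sproj_def phi1_SL(1)[OF s t] \<nu>_def)
  then have Q: "Qn.anorm (fst s') = inverse \<nu> * Qn.anorm (flow A t (fst s))"
    using \<nu> SL_simps[OF s] by (simp add: Qn.anorm_scale lsum_flow)
  have "N s' w' = vn (phi1 A B t w u) / Qn.anorm (flow A t (fst s))"
    using \<nu> by (simp add: N_def Q) (simp add: w'_def vn_scale \<nu>_def[symmetric])
  \<comment> \<open>The numerator grows at most at rate \<beta> and the denominator at least at rate
    \<gamma>, so the quotient does not increase.\<close>
  also have "\<dots> \<le> (exp (\<beta> * t) * vn w) / (exp (\<gamma> * t) * Qn.anorm (fst s))"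
    using phi1_V(2)[OF u w t] Qn_flow[OF t SL_simps(2)[OF s]] vn_nonneg[of w] Qn_pos[OF s]
    by (intro frac_le) auto
  also have "\<dots> = (exp (\<beta> * t) / exp (\<gamma> * t)) * N s w" by (simp add: N_def)
  also have "\<dots> \<le> 1 * N s w"
    using \<beta>_less_\<gamma> t N_nonneg[OF s, of w] by (intro mult_right_mono) (auto intro: mult_right_mono)
  finally show "N s' w' \<le> N s w" by simp
  define c where "c = inverse (nrm ip (s + w))"
  have c: "c > 0" using nrm_pos[OF nonzero_sum[OF s w]] by (simp add: c_def)
  have "phi1 A B t (sproj ip (s + w)) u = c *\<^sub>R (phi1 A B t s u + phi1 A B t w u)"
    unfolding sproj_def c_def[symmetric]
    using linear_scale[OF phi1_linear[OF t, of u], of c "s + w"] linear_add[OF phi1_linear[OF t, of u], of s w] by simp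
  also have "phi1 A B t s u + phi1 A B t w u = \<nu> *\<^sub>R (s' + w')"
    using \<nu> by (simp add: s'_def w'_def sphi_def sproj_def \<nu>_def[symmetric] scaleR_add_right)
  finally have "phi1 A B t (sproj ip (s + w)) u = (c * \<nu>) *\<^sub>R (s' + w')" by simp
  then show "sphi ip A B t (sproj ip (s + w)) u = sproj ip (s' + w')"
    using c \<nu> by (simp add: sphi_def sproj_scale)
qed

lemma W_positively_invariant: "positively_invariant ip A B U SL W"
  unfolding positively_invariant_def fibre_def
proof (intro ballI allI impI)
  fix u s0 q t assume u: "u \<in> controls U" and s: "s0 \<in> SL" and "q \<in> {v. (u, s0, v) \<in> W}" and t: "(0::real) \<le> t"
  then obtain w where w: "q = sproj ip (s0 + w)" "w \<in> V u" "N s0 w < \<delta>" unfolding W_def by auto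
  note f = flow_sum[OF u s w(2) t]
  have "sphi ip A B t s0 linf_zero = sphi ip A B t s0 u" by (simp add: phi1_SL[OF s t])
  moreover have "(shift t u, sphi ip A B t s0 u, sphi ip A B t q u) \<in> W"
    unfolding w(1) f(3) W_def
    using f(1) le_less_trans[OF f(2) w(3)] shift_controls[OF u] phi1_SL(4)[OF s t, of u] by blast
  ultimately show "sphi ip A B t q u \<in> {v. (shift t u, sphi ip A B t s0 linf_zero, v) \<in> W}" by simp
qed

text \<open>The lifted flow is its own derivative. The radial part of the direction w is carried
  along the orbit of s, and the derivative of the normalization removes it.\<close>

lemma D_sphi_eq:
  assumes s: "s \<in> SL" and t: "t \<ge> 0"
  shows "D_sphi ip A B t s u (tproj ip s w) =
    tproj ip (sphi ip A B t s u) (phi1 A B t w u /\<^sub>R nrm ip (phi1 A B t s u))"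
proof -
  define \<nu> where "\<nu> = nrm ip (phi1 A B t s u)"
  have \<nu>: "\<nu> > 0" using nrm_pos phi1_SL[OF s t] by (simp add: \<nu>_def)
  note lin = phi1_linear[OF t, of u]
  have "bounded_linear (\<lambda>p. phi1 A B t p u)" using lin linear_conv_bounded_linear by blast
  then have "((\<lambda>p. phi1 A B t p u) has_derivative (\<lambda>p. phi1 A B t p u)) (at s)"
    by (rule bounded_linear_imp_has_derivative)
  from has_derivative_compose[OF this has_derivative_sproj[OF phi1_SL(2)[OF s t]]]
  have "((\<lambda>p. sphi ip A B t p u) has_derivative
      (\<lambda>v. tproj ip (sphi ip A B t s u) (phi1 A B t v u) /\<^sub>R \<nu>)) (at s)"
    by (simp add: sphi_def \<nu>_def)
  then have D: "D_sphi ip A B t s u v = tproj ip (sphi ip A B t s u) (phi1 A B t v u) /\<^sub>R \<nu>" for v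
    unfolding D_sphi_def by (simp add: frechet_derivative_at[symmetric])
  have "phi1 A B t s u = \<nu> *\<^sub>R sphi ip A B t s u" using \<nu> by (simp add: sphi_def sproj_def \<nu>_def[symmetric])
  then have 0: "tproj ip (sphi ip A B t s u) (phi1 A B t s u) = 0"
    using tproj_self[OF SL_simps(3)[OF phi1_SL(4)[OF s t]]]
    by (simp add: linear_scale[OF linear_tproj])
  have "phi1 A B t (tproj ip s w) u = phi1 A B t w u - ip_lift ip w s *\<^sub>R phi1 A B t s u"
    unfolding tproj_def using linear_diff[OF lin, of w] linear_scale[OF lin, of _ s] by simp
  then show ?thesis
    by (simp add: D 0 linear_diff[OF linear_tproj] linear_scale[OF linear_tproj] \<nu>_def)
qed

text \<open>No remainder of a linearization has to be estimated: the distance is bounded, for all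
  times, by a constant times the norm of the linearized flow applied to the tangential part of
  w.\<close>

lemma W_exponentially_attracted: "exponentially_attracted ip A B W (kappa ip A B E)"
  unfolding exponentially_attracted_def
proof (intro allI impI)
  fix u s0 q and \<alpha> :: real assume "(u, s0, q) \<in> W" and \<alpha>: "kappa ip A B E < ereal \<alpha> \<and> \<alpha> < 0"
  then obtain w where w: "q = sproj ip (s0 + w)" "w \<in> V u" "N s0 w < \<delta>" and u: "u \<in> controls U" and s: "s0 \<in> SL"
    unfolding W_def by auto
  define v where "v = tproj ip s0 w"
  define D where "D t = nrm ip (D_sphi ip A B t s0 u v)" for t
  \<comment> \<open>One factor 2 compares arc and chord, the other comes from the radial projection.
    The two factors K come from passing from w' to \<open>N\<close> and from \<open>N\<close> to the
    tangential part.\<close>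
  have dist: "riem_dist ip (sphi ip A B t q u) (sphi ip A B t s0 u) \<le> 4 * K * K * D t" if t: "t \<ge> 0" for t
  proof -
    define s' where "s' = sphi ip A B t s0 u"
    define w' where "w' = phi1 A B t w u /\<^sub>R nrm ip (phi1 A B t s0 u)"
    note f = flow_sum[OF u s w(2) t, folded s'_def w'_def]
    have s': "s' \<in> SL" unfolding s'_def by (rule phi1_SL[OF s t])
    have nz: "s' + w' \<noteq> 0" by (rule nonzero_sum[OF s' f(1)])
    have "riem_dist ip (sphi ip A B t q u) s' \<le> 2 * nrm ip (sproj ip (s' + w') - s')"
      unfolding w(1) f(3) using sproj_in_psphere[OF nz] SL_simps(3)[OF s'] by (rule riem_dist_bounds)
    also have "\<dots> \<le> 2 * (2 * nrm ip w')"
      using nrm_sproj_diff_le[OF SL_simps(3)[OF s'] nz] by simp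
    also have "nrm ip w' \<le> K * N s' w'" by (rule nrm_le_N[OF shift_controls[OF u] s' f(1)])
    also have "N s' w' \<le> K * nrm ip (tproj ip s' w')" by (rule N_le_nrm_tproj[OF s'])
    also have "nrm ip (tproj ip s' w') = D t" by (simp add: D_def v_def D_sphi_eq[OF s t] s'_def w'_def)
    finally show ?thesis using K_pos by (simp add: s'_def mult_ac)
  qed
  have dist0: "0 \<le> riem_dist ip (sphi ip A B t q u) (sphi ip A B t s0 u)" if t: "t \<ge> 0" for t
  proof -
    have "sphi ip A B t q u \<in> psphere ip"
      unfolding w(1) flow_sum(3)[OF u s w(2) t]
      by (rule sproj_in_psphere[OF nonzero_sum[OF phi1_SL(4)[OF s t] flow_sum(1)[OF u s w(2) t]]])
    then have "nrm ip (sphi ip A B t q u - sphi ip A B t s0 u) \<le> riem_dist ip (sphi ip A B t q u) (sphi ip A B t s0 u)"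
      by (rule riem_dist_bounds) (rule SL_simps(3)[OF phi1_SL(4)[OF s t]])
    then show ?thesis using nrm_nonneg order_trans by blast
  qed
  have "\<exists>\<alpha>'<\<alpha>. \<forall>\<^sub>F t in at_top. D t \<le> exp (\<alpha>' * t)"
  \<comment> \<open>The supremum in \<open>kappa\<close> runs over nonzero vectors only and may be
    -\<infinity>, so it says nothing about v = 0, where \<open>D\<close> vanishes for all t \<ge>
    0.\<close>
  proof (cases "v = 0")
    case True
    then have "w = 0" using N_pos_iff(2)[OF u s w(2)] by (simp add: v_def)
    have D0: "D t = 0" if "t \<ge> 0" for t
    proof -
      have "D t = nrm ip (tproj ip (sphi ip A B t s0 u) (phi1 A B t w u /\<^sub>R nrm ip (phi1 A B t s0 u)))"
        by (simp only: D_def v_def D_sphi_eq[OF s that])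
      then show ?thesis
        by (simp only: \<open>w = 0\<close> linear_0[OF phi1_linear[OF that]] scaleR_zero_right linear_0[OF linear_tproj] nrm_0)
    qed
    have "\<forall>\<^sub>F t in at_top. D t \<le> exp ((\<alpha> - 1) * t)"
      using eventually_ge_at_top[of 0] by eventually_elim (simp add: D0)
    then show ?thesis by (intro exI[of _ "\<alpha> - 1"]) simp
  next
    case False
    have "(u, s0, v) \<in> E" using u s w(2) by (auto simp: mem_E v_def)
    then have "Limsup at_top (\<lambda>t. ereal (1 / t * ln (D t))) \<le> kappa ip A B E"
      unfolding kappa_def D_def using False by (intro Sup_upper) blast
    then have "Limsup at_top (\<lambda>t. ereal (1 / t * ln (D t))) < ereal \<alpha>" using \<alpha> by (rule_tac le_less_trans) auto
    \<comment> \<open>A rate strictly below \<alpha> leaves a factor e^{(\<alpha>' - \<alpha>)t}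
      that tends to 0.\<close>
    from ereal_dense2[OF this] obtain \<alpha>'
      where "Limsup at_top (\<lambda>t. ereal (1 / t * ln (D t))) < ereal \<alpha>'" "ereal \<alpha>' < ereal \<alpha>"
      by blast
    then have \<alpha>': "Limsup at_top (\<lambda>t. ereal (1 / t * ln (D t))) < ereal \<alpha>'" "\<alpha>' < \<alpha>" by simp_all
    have "\<forall>\<^sub>F t in at_top. ereal (1 / t * ln (D t)) < ereal \<alpha>'" by (rule Limsup_lessD[OF \<alpha>'(1)])
    then have "\<forall>\<^sub>F t in at_top. D t \<le> exp (\<alpha>' * t)"
      using eventually_gt_at_top[of 0]
    proof eventually_elim
      case (elim t)
      then have ln: "ln (D t) < \<alpha>' * t" by (simp add: field_simps)
      show ?case
      \<comment> \<open>The inequality for the logarithm carries no information where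
        \<open>D t\<close> vanishes, but there the bound is trivial.\<close>
      proof (cases "D t = 0")
        case False
        then have "D t > 0" by (simp add: D_def less_le)
        then have "D t = exp (ln (D t))" by simp
        also have "\<dots> \<le> exp (\<alpha>' * t)" using ln by simp
        finally show ?thesis .
      qed simp
    qed
    then show ?thesis using \<alpha>'(2) by blast
  qed
  then obtain \<alpha>' where \<alpha>': "\<alpha>' < \<alpha>" "\<forall>\<^sub>F t in at_top. D t \<le> exp (\<alpha>' * t)" by blast
  show "((\<lambda>t. exp (- \<alpha> * t) * riem_dist ip (sphi ip A B t q u) (sphi ip A B t s0 u)) \<longlongrightarrow> 0) at_top"
  proof (rule tendsto_sandwich[OF _ _ tendsto_const])
    show "\<forall>\<^sub>F t in at_top. 0 \<le> exp (- \<alpha> * t) * riem_dist ip (sphi ip A B t q u) (sphi ip A B t s0 u)"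
      using eventually_ge_at_top[of 0] by eventually_elim (simp add: dist0)
    show "\<forall>\<^sub>F t in at_top. exp (- \<alpha> * t) * riem_dist ip (sphi ip A B t q u) (sphi ip A B t s0 u) \<le>
        4 * K * K * exp ((\<alpha>' - \<alpha>) * t)"
      using \<alpha>'(2) eventually_ge_at_top[of 0]
    proof eventually_elim
      case (elim t)
      have "4 * K * K * D t \<le> 4 * K * K * exp (\<alpha>' * t)" using elim(1) K_pos by (intro mult_left_mono) auto
      then have "riem_dist ip (sphi ip A B t q u) (sphi ip A B t s0 u) \<le> 4 * K * K * exp (\<alpha>' * t)"
        using dist[OF elim(2)] by linarith
      then have "exp (- \<alpha> * t) * riem_dist ip (sphi ip A B t q u) (sphi ip A B t s0 u) \<le>
          exp (- \<alpha> * t) * (4 * K * K * exp (\<alpha>' * t))" by (rule mult_left_mono) simp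
      also have "\<dots> = 4 * K * K * exp ((\<alpha>' - \<alpha>) * t)"
        by (simp add: left_diff_distrib exp_diff exp_minus divide_inverse)
      finally show ?case .
    qed
    have "((\<lambda>t::real. exp (a * t)) \<longlongrightarrow> 0) at_top" if "a < 0" for a :: real
      using that by real_asymp
    from this[of "\<alpha>' - \<alpha>"] show "((\<lambda>t. 4 * K * K * exp ((\<alpha>' - \<alpha>) * t)) \<longlongrightarrow> 0) at_top"
      using \<alpha>'(1) by (intro tendsto_mult_right_zero) simp
  qed
qed

section \<open>Continuity of the chart and of its inverse\<close>

lemma continuous_on_N:
  assumes "continuous_on T f" "continuous_on T g" "\<And>x. x \<in> T \<Longrightarrow> f x \<in> SL"
  shows "continuous_on T (\<lambda>x. N (f x) (g x))"
  unfolding N_def vn_def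
proof (intro continuous_on_divide continuous_on_add continuous_on_mult continuous_on_rabs
    Pn.continuous_on_anorm Qn.continuous_on_anorm continuous_on_lproj continuous_on_fst continuous_on_snd
    continuous_on_const assms ballI)
  show "Pm (fst (g x)) \<in> lsum A {..<l0}" for x by (rule Pm_in)
  show "fst (f x) \<in> lsum A {l0}" "Qn.anorm (fst (f x)) \<noteq> 0" if "x \<in> T" for x
    using SL_simps(2)[OF assms(3)[OF that]] Qn_pos[OF assms(3)[OF that]] by auto
qed

lemma continuous_on_wlift:
  assumes "continuous_on T f" "continuous_on T g"
  shows "continuous_on T (\<lambda>x. wlift (f x) (g x))"
  unfolding wlift_def by (intro continuous_intros assms)

lemma continuous_on_sproj:
  assumes "continuous_on T f" "\<And>x. x \<in> T \<Longrightarrow> f x \<noteq> 0"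
  shows "continuous_on T (\<lambda>x. sproj ip (f x))"
  unfolding sproj_def using assms by (intro continuous_intros) auto

text \<open>The last component of the chart with the control replaced by the vector e(u,0), so that
  its continuity is a statement about Euclidean spaces.\<close>

definition S3 :: "(real^'n) \<times> 'n lifted \<times> 'n lifted \<Rightarrow> 'n lifted" where
  "S3 = (\<lambda>(e, s, v). sproj ip (s + wlift e ((nrm ip v / N s v) *\<^sub>R v)))"

text \<open>The second condition bounds the radial factor, which need not converge as v tends to 0.
  Vectors of the stable bundle satisfy it.\<close>

definition S3_dom :: "((real^'n) \<times> 'n lifted \<times> 'n lifted) set" where
  "S3_dom = {(e, s, v). s \<in> SL \<and> nrm ip v \<le> (2 * K) * N s v \<and>
     s + wlift e ((nrm ip v / N s v) *\<^sub>R v) \<noteq> 0}"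

lemma continuous_on_S3: "continuous_on S3_dom S3"
proof -
  have "continuous_on S3_dom (\<lambda>z. (nrm ip (snd (snd z)) / N (fst (snd z)) (snd (snd z))) *\<^sub>R snd (snd z))"
  proof (rule continuous_on_bounded_scale[where K = "2 * K"])
    show "continuous_on {z \<in> S3_dom. snd (snd z) \<noteq> 0} (\<lambda>z. nrm ip (snd (snd z)) / N (fst (snd z)) (snd (snd z)))"
    proof (intro continuous_on_divide continuous_on_nrm continuous_on_N continuous_intros ballI)
      fix z assume "z \<in> {z \<in> S3_dom. snd (snd z) \<noteq> 0}"
      then have z: "snd (snd z) \<noteq> 0" "nrm ip (snd (snd z)) \<le> (2 * K) * N (fst (snd z)) (snd (snd z))"
        and zS: "fst (snd z) \<in> SL" by (auto simp: S3_dom_def)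
      show "fst (snd z) \<in> SL" by (rule zS)
      show "N (fst (snd z)) (snd (snd z)) \<noteq> 0" using z nrm_pos[OF z(1)] by auto
    qed
    fix z assume "z \<in> S3_dom"
    then have z: "nrm ip (snd (snd z)) \<le> (2 * K) * N (fst (snd z)) (snd (snd z))" "fst (snd z) \<in> SL"
      by (auto simp: S3_dom_def)
    then show "\<bar>nrm ip (snd (snd z)) / N (fst (snd z)) (snd (snd z))\<bar> \<le> 2 * K"
      using N_nonneg[OF z(2), of "snd (snd z)"] K_pos
      by (cases "N (fst (snd z)) (snd (snd z)) = 0") (auto simp: field_simps)
  qed (intro continuous_intros)
  then have "continuous_on S3_dom (\<lambda>z. fst (snd z) +
      wlift (fst z) ((nrm ip (snd (snd z)) / N (fst (snd z)) (snd (snd z))) *\<^sub>R snd (snd z)))"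
    by (intro continuous_on_add continuous_on_wlift continuous_on_fst continuous_on_snd continuous_on_id)
  then have "continuous_on S3_dom (\<lambda>z. sproj ip (fst (snd z) +
      wlift (fst z) ((nrm ip (snd (snd z)) / N (fst (snd z)) (snd (snd z))) *\<^sub>R snd (snd z))))"
    by (rule continuous_on_sproj) (auto simp: S3_dom_def)
  then show ?thesis unfolding S3_def case_prod_unfold .
qed

definition R3 :: "(real^'n) \<times> 'n lifted \<times> 'n lifted \<Rightarrow> 'n lifted" where
  "R3 = (\<lambda>(e, s, q). unb s (rec e s q))"

definition R3_dom :: "((real^'n) \<times> 'n lifted \<times> 'n lifted) set" where
  "R3_dom = {(e, s, q). s \<in> SL \<and> ip (fst q - snd q *\<^sub>R (e - Pm e)) (fst s) \<noteq> 0}"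

text \<open>The factor is bounded by K, which settles continuity at vectors with vanishing
  tangential part, where it need not have a limit.\<close>

lemma continuous_on_unb: "continuous_on (SL \<times> UNIV) (\<lambda>z. unb (fst z) (snd z))"
  unfolding unb_def
proof (rule continuous_on_bounded_scale[where K = K])
  have t: "continuous_on T (\<lambda>z. tproj ip (fst z) (snd z))" for T
    unfolding tproj_def by (intro continuous_intros)
  show "continuous_on (SL \<times> UNIV) (\<lambda>z. tproj ip (fst z) (snd z))" by (rule t)
  show "continuous_on {z \<in> SL \<times> UNIV. tproj ip (fst z) (snd z) \<noteq> 0}
     (\<lambda>z. N (fst z) (snd z) / nrm ip (tproj ip (fst z) (snd z)))"
    by (intro continuous_on_divide continuous_on_nrm t continuous_on_N continuous_intros) auto
  fix z :: "'n lifted \<times> 'n lifted" assume "z \<in> SL \<times> UNIV"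
  then have z: "fst z \<in> SL" by auto
  show "\<bar>N (fst z) (snd z) / nrm ip (tproj ip (fst z) (snd z))\<bar> \<le> K"
    using N_le_nrm_tproj[OF z, of "snd z"] N_nonneg[OF z, of "snd z"] K_pos nrm_pos[of "tproj ip (fst z) (snd z)"]
    by (cases "tproj ip (fst z) (snd z) = 0") (simp_all add: abs_div_pos pos_divide_le_eq abs_of_nonneg)
qed

lemma continuous_on_R3: "continuous_on R3_dom R3"
proof -
  have "bounded_bilinear ip" using bil_ip bilinear_conv_bounded_bilinear by blast
  note ip_cont = bounded_bilinear.continuous_on[OF this]
  have c: "continuous_on R3_dom (\<lambda>z. (fst (snd z), rec (fst z) (fst (snd z)) (snd (snd z))))"
    unfolding rec_def by (intro continuous_intros ip_cont) (auto simp: R3_dom_def)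
  have sub: "(\<lambda>z. (fst (snd z), rec (fst z) (fst (snd z)) (snd (snd z)))) ` R3_dom \<subseteq> SL \<times> UNIV"
    by (auto simp: R3_dom_def)
  from continuous_on_compose2[OF continuous_on_unb c sub] show ?thesis
    by (simp add: R3_def case_prod_unfold)
qed

text \<open>By the triangle inequality the tangential projection at most doubles the norm of w,
  whence 2K.\<close>

lemma nrm_le_N_E: "(u, s, v) \<in> E \<Longrightarrow> nrm ip v \<le> (2 * K) * N s v"
proof -
  assume "(u, s, v) \<in> E"
  then obtain w where w: "v = tproj ip s w" "w \<in> V u" and u: "u \<in> controls U" and s: "s \<in> SL"
    unfolding mem_E by auto
  have s1: "nrm ip s = 1" using SL_simps[OF s] by (simp add: psphere_def)
  have "nrm ip v \<le> nrm ip w + nrm ip (- (ip_lift ip w s *\<^sub>R s))"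
    unfolding w(1) tproj_def diff_conv_add_uminus by (rule nrm_triangle)
  also have "\<dots> = nrm ip w + \<bar>ip_lift ip w s\<bar>" by (simp add: nrm_minus nrm_scale s1)
  also have "\<dots> \<le> 2 * nrm ip w" using lift_CS[of w s] s1 by simp
  also have "\<dots> \<le> 2 * (K * N s w)" using nrm_le_N[OF u s w(2)] by simp
  finally show ?thesis by (simp add: w(1) N_tproj[OF s])
qed

lemma S_dom: "(u, s, v) \<in> ball_bundle ip E \<delta> \<Longrightarrow> (e_sol A B u 0, s, v) \<in> S3_dom"
proof -
  assume a: "(u, s, v) \<in> ball_bundle ip E \<delta>"
  then have E: "(u, s, v) \<in> E" by (simp add: ball_bundle_def)
  then have s: "s \<in> SL" by (simp add: mem_E)
  have "snd (snd (S (u, s, v))) \<in> psphere ip" using S_in_W(1)[OF a] W_subset by auto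
  then have "sproj ip (s + wlift (e_sol A B u 0) ((nrm ip v / N s v) *\<^sub>R v)) \<noteq> 0"
    using psphere_nonzero by (simp add: S_def)
  then have "s + wlift (e_sol A B u 0) ((nrm ip v / N s v) *\<^sub>R v) \<noteq> 0" by (auto simp: sproj_def)
  then show ?thesis using s nrm_le_N_E[OF E] by (simp add: S3_dom_def)
qed

lemma R_dom: "(u, s, q) \<in> W \<Longrightarrow> (e_sol A B u 0, s, q) \<in> R3_dom"
proof -
  assume "(u, s, q) \<in> W"
  then obtain w where w: "q = sproj ip (s + w)" "w \<in> V u" and s: "s \<in> SL" unfolding W_def by auto
  have "nrm ip (s + w) > 0" using nrm_pos[OF nonzero_sum[OF s w(2)]] .
  then show ?thesis
    using rec_denominator[OF s w(2), of "inverse (nrm ip (s + w))"] s nonzero_sum[OF s w(2)]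
    by (simp add: R3_dom_def w(1) sproj_def)
qed

definition R :: "(real^'m) linf \<times> 'n lifted \<times> 'n lifted \<Rightarrow> (real^'m) linf \<times> 'n lifted \<times> 'n lifted" where
  "R x = (fst x, fst (snd x), R3 (e_sol A B (fst x) 0, snd x))"

lemma S_eq: "S x = (fst x, fst (snd x), S3 (e_sol A B (fst x) 0, snd x))"
  by (cases x) (simp add: S_def S3_def)

lemma R_S: "x \<in> ball_bundle ip E \<delta> \<Longrightarrow> R (S x) = x"
proof -
  assume x: "x \<in> ball_bundle ip E \<delta>"
  obtain u s v where "x = (u, s, v)" by (cases x) auto
  then show ?thesis using S_in_W(3)[of u s v] x by (simp add: R_def R3_def S_eq)
qed

lemma S_R:
  assumes "y \<in> W"
  shows "R y \<in> ball_bundle ip E \<delta>" "S (R y) = y"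
proof -
  obtain u s w where y: "y = (u, s, sproj ip (s + w))" "u \<in> controls U" "s \<in> SL" "w \<in> V u" "N s w < \<delta>"
    using assms unfolding W_def by blast
  have "R y = (u, s, unb s w)" using rec_sproj[OF y(3,4)] by (simp add: R_def R3_def y(1))
  then show "R y \<in> ball_bundle ip E \<delta>" "S (R y) = y" using unb_in_ball[OF y(2-5)] y(1) by auto
qed

lemma topspace_weak_star: "topspace weak_star = (UNIV :: (real^'m) linf set)"
proof -
  have "openin weak_star {u :: (real^'m) linf. (LINT t|lborel. 0 \<bullet> rep_linf u t) \<in> UNIV}"
    unfolding weak_star_def
    by (rule topology_generated_by_Basis, intro CollectI exI[of _ "\<lambda>_. 0"] exI[of _ UNIV]) auto
  then show ?thesis using openin_subset by fastforce
qed

lemma topspace_total_top: "topspace (total_top Y) = (Y :: ('n, 'm) sbundle)"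
  by (simp add: total_top_def topspace_weak_star)

lemma topspace_base_top: "topspace (base_top U SL) = controls U \<times> SL"
  by (simp add: base_top_def topspace_weak_star)

lemma continuous_map_total_fst: "continuous_map (total_top (Y :: ('n, 'm) sbundle)) weak_star fst"
  unfolding total_top_def by (intro continuous_map_from_subtopology continuous_map_fst)

lemma continuous_map_total_snd: "continuous_map (total_top (Y :: ('n, 'm) sbundle)) euclidean snd"
  unfolding total_top_def prod_topology_euclidean
  by (intro continuous_map_from_subtopology continuous_map_snd)

text \<open>The only place where the topology of the controls meets the fibre coordinate: weak star
  continuity of e(u,0) is composed with a map that is continuous on the Euclidean set Z.\<close>

lemma continuous_map_total_third:
  fixes Y :: "('n, 'm) sbundle" and k :: "(real^'n) \<times> 'n lifted \<times> 'n lifted \<Rightarrow> 'n lifted"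
  assumes k: "continuous_on Z k" and Z: "\<And>u s v. (u, s, v) \<in> Y \<Longrightarrow> (e_sol A B u 0, s, v) \<in> Z"
  shows "continuous_map (total_top Y) euclidean (\<lambda>x. k (e_sol A B (fst x) 0, snd x))"
proof -
  have "continuous_map (total_top Y) euclidean (\<lambda>x. e_sol A B (fst x) 0)"
    using continuous_map_compose[OF continuous_map_total_fst e_sol_continuous] by (simp add: o_def)
  then have "continuous_map (total_top Y) euclidean (\<lambda>x. (e_sol A B (fst x) 0, snd x))"
    unfolding prod_topology_euclidean[symmetric]
    using continuous_map_total_snd[of Y, folded prod_topology_euclidean]
    by (rule continuous_map_pairedI)
  then have "continuous_map (total_top Y) (top_of_set Z) (\<lambda>x. (e_sol A B (fst x) 0, snd x))"
    using Z by (auto simp: continuous_map_in_subtopology topspace_total_top)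
  moreover have "continuous_map (top_of_set Z) euclidean k" using k by simp
  ultimately show ?thesis using continuous_map_compose[of _ _ _ _ k] by (fastforce simp: o_def)
qed

lemma continuous_map_total_total:
  fixes Y Y' :: "('n, 'm) sbundle"
  assumes k: "continuous_on Z k" and Z: "\<And>u s v. (u, s, v) \<in> Y \<Longrightarrow> (e_sol A B u 0, s, v) \<in> Z"
    and im: "\<And>x. x \<in> Y \<Longrightarrow> (fst x, fst (snd x), k (e_sol A B (fst x) 0, snd x)) \<in> Y'"
  shows "continuous_map (total_top Y) (total_top Y') (\<lambda>x. (fst x, fst (snd x), k (e_sol A B (fst x) 0, snd x)))"
proof -
  have "continuous_map (total_top Y) euclidean (\<lambda>x. fst (snd x))"
    using continuous_map_compose[OF continuous_map_total_snd, of euclidean fst] by (simp add: o_def continuous_on_fst)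
  then have "continuous_map (total_top Y) (prod_topology weak_star (prod_topology euclidean euclidean))
      (\<lambda>x. (fst x, fst (snd x), k (e_sol A B (fst x) 0, snd x)))"
    by (intro continuous_map_pairedI continuous_map_total_fst continuous_map_total_third[OF k Z])
  then show ?thesis
    using im unfolding total_top_def[of Y'] by (auto simp: continuous_map_in_subtopology topspace_total_top)
qed

lemma continuous_map_base_proj:
  fixes Y :: "('n, 'm) sbundle"
  assumes "Y \<subseteq> controls U \<times> SL \<times> UNIV"
  shows "continuous_map (total_top Y) (base_top U SL) base_proj"
proof -
  have "continuous_map (total_top Y) euclidean (\<lambda>x. fst (snd x))"
    using continuous_map_compose[OF continuous_map_total_snd, of euclidean fst] by (simp add: o_def continuous_on_fst)
  then have "continuous_map (total_top Y) (prod_topology weak_star euclidean) (\<lambda>x. (fst x, fst (snd x)))"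
    by (intro continuous_map_pairedI continuous_map_total_fst)
  moreover have "base_proj = (\<lambda>x :: (real^'m) linf \<times> 'n lifted \<times> 'n lifted. (fst x, fst (snd x)))"
    by (auto simp: base_proj_def)
  ultimately show ?thesis
    using assms unfolding base_top_def
    by (auto simp: continuous_map_in_subtopology topspace_total_top base_proj_def)
qed

lemma S_bundle_iso: "bundle_iso_onto_image ip U SL E \<delta> S"
proof -
  have ball_sub: "ball_bundle ip E \<delta> \<subseteq> controls U \<times> SL \<times> UNIV"
    by (auto simp: ball_bundle_def mem_E)
  have cS: "continuous_map (total_top (ball_bundle ip E \<delta>)) (total_top W) S"
    unfolding S_eq[abs_def]
  proof (rule continuous_map_total_total[OF continuous_on_S3 S_dom])
    show "(fst x, fst (snd x), S3 (e_sol A B (fst x) 0, snd x)) \<in> W" if "x \<in> ball_bundle ip E \<delta>" for x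
      using S_in_W(1)[of "fst x" "fst (snd x)" "snd (snd x)"] that by (simp add: S_eq)
  qed
  have cR: "continuous_map (total_top W) (total_top (ball_bundle ip E \<delta>)) R"
    unfolding R_def[abs_def]
  proof (rule continuous_map_total_total[OF continuous_on_R3 R_dom])
    show "(fst x, fst (snd x), R3 (e_sol A B (fst x) 0, snd x)) \<in> ball_bundle ip E \<delta>" if "x \<in> W" for x
      using S_R(1)[OF that] by (simp add: R_def)
  qed
  have pS: "base_proj (S x) = base_proj x" and pR: "base_proj (R x) = base_proj x" for x
    by (simp_all add: base_proj_def S_eq R_def case_prod_unfold)
  have W_sub: "W \<subseteq> controls U \<times> SL \<times> UNIV" using W_subset by auto
  show ?thesis
    unfolding bundle_iso_onto_image_def W_loc_eq bundle_isomorphism_def bundle_morphism_def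
      topspace_total_top topspace_base_top
    using W_subset cS cR pS pR R_S S_R(2)
      continuous_map_base_proj[OF ball_sub] continuous_map_base_proj[OF W_sub]
    by (intro conjI exI[of _ R] exI[of _ id]) simp_all
qed

text \<open>For fixed (u, s) the chart is a homeomorphism from a ball in the linear fibre. That ball
  is contained in a subspace, which bounds its dimension from above, and contains a Euclidean ball
  of this subspace, which bounds it from below.\<close>

lemma W_dimension:
  assumes u: "u \<in> controls U" and s: "s \<in> SL"
  shows "has_top_dimension (fibre W u s) (dim (fibre E u s))"
proof -
  define T where "T = fibre E u s"
  define D where "D = {v \<in> T. nrm ip v < \<delta>}"
  define e where "e = e_sol A B u 0"
  have T: "subspace T"
    unfolding T_def fibre_E[OF u s] by (rule linear_subspace_image[OF linear_tproj subspace_V])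
  have D_ball: "v \<in> D \<longleftrightarrow> (u, s, v) \<in> ball_bundle ip E \<delta>" for v
    by (simp add: D_def T_def fibre_def ball_bundle_def)
  have S_D: "S (u, s, v) = (u, s, S3 (e, s, v))" and R_D: "R (u, s, v) = (u, s, R3 (e, s, v))" for v
    by (simp_all add: S_eq R_def e_def)
  have "top_of_set D homeomorphic_space top_of_set (fibre W u s)"
    unfolding homeomorphic_space_def homeomorphic_maps_def
  proof (rule exI[of _ "\<lambda>v. S3 (e, s, v)"], rule exI[of _ "\<lambda>q. R3 (e, s, q)"], intro conjI ballI)
    have S3W: "S3 (e, s, v) \<in> fibre W u s" if "v \<in> D" for v
      using S_in_W(1)[of u s v] that by (simp add: S_D D_ball fibre_def)
    have R3D: "R3 (e, s, q) \<in> D" if "q \<in> fibre W u s" for q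
      using S_R(1)[of "(u, s, q)"] that by (simp add: R_D D_ball fibre_def)
    have "continuous_on D (\<lambda>v. S3 (e, s, v))"
      by (rule continuous_on_compose2[OF continuous_on_S3]) (auto intro!: continuous_intros simp: D_ball S_dom e_def)
    then show "continuous_map (top_of_set D) (top_of_set (fibre W u s)) (\<lambda>v. S3 (e, s, v))"
      using S3W by (auto simp: continuous_map_in_subtopology)
    have "continuous_on (fibre W u s) (\<lambda>q. R3 (e, s, q))"
      by (rule continuous_on_compose2[OF continuous_on_R3]) (auto intro!: continuous_intros simp: R_dom e_def fibre_def)
    then show "continuous_map (top_of_set (fibre W u s)) (top_of_set D) (\<lambda>q. R3 (e, s, q))"
      using R3D by (auto simp: continuous_map_in_subtopology)
    show "R3 (e, s, S3 (e, s, v)) = v" if "v \<in> topspace (top_of_set D)" for v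
      using R_S[of "(u, s, v)"] that by (simp add: S_D R_D D_ball)
    show "S3 (e, s, R3 (e, s, q)) = q" if "q \<in> topspace (top_of_set (fibre W u s))" for q
      using S_R(2)[of "(u, s, q)"] that by (simp add: S_D R_D fibre_def)
  qed
  note hom = homeomorphic_space_dimension_le[OF this, symmetric]
  obtain c0 C0 where c0: "C0 > 0" "\<And>p. nrm ip p \<le> C0 * norm p" using nrm_norm_equiv by metis
  have "T \<inter> cball 0 (\<delta> / (2 * C0)) \<subseteq> D"
  proof
    fix v assume v: "v \<in> T \<inter> cball 0 (\<delta> / (2 * C0))"
    then have "C0 * norm v \<le> C0 * (\<delta> / (2 * C0))" using c0(1) by (intro mult_left_mono) auto
    also have "\<dots> < \<delta>" using c0(1) \<delta>_pos by simp
    finally show "v \<in> D" using c0(2)[of v] v by (simp add: D_def)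
  qed
  moreover have "\<not> top_of_set (T \<inter> cball 0 (\<delta> / (2 * C0))) dim_le (int (dim T) - 1)"
    using not_dim_le_cball[OF T] c0 \<delta>_pos by simp
  ultimately have "\<not> top_of_set D dim_le (int (dim T) - 1)"
    using dimension_le_subtopologies by blast
  moreover have "top_of_set D dim_le int (dim T)"
    by (rule dimension_le_subtopologies[OF subspace_dim_le[OF T]]) (auto simp: D_def)
  ultimately show ?thesis
    unfolding has_top_dimension_def hom T_def[symmetric] by simp
qed

lemma S_local_stable: "local_stable ip A B U SL E \<delta> S"
  unfolding local_stable_def W_loc_eq
  by (intro conjI ballI S_bundle_iso W_exponentially_attracted W_dimension W_positively_invariant)

end

theorem corollary3:
  fixes A :: "real^'n^'n" and B :: "real^'m^'n" and U :: "(real^'m) set"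
    and ip :: "real^'n \<Rightarrow> real^'n \<Rightarrow> real" and l0 :: real and SL :: "'n lifted set"
  assumes "compact U" and "convex U" and "0 \<in> interior U"
    and "is_scalar_product ip" and "lyapunov_orthogonal ip A"
    and "l0 \<in> lyapunov_exponents A" and "l0 \<noteq> 0"
    and "is_SL ip A l0 SL"
  shows "\<exists>\<delta>>0. \<exists>S.
           local_stable ip A B U SL (SV_minus ip A B U l0 SL) \<delta> S \<and>
           (\<forall>h>0. \<exists>\<delta>'>0. \<delta>' \<le> \<delta> \<and>
              local_stable ip A B U SL (SV_minus ip A B U l0 SL) \<delta>' S \<and>
              W_loc ip (SV_minus ip A B U l0 SL) \<delta>' S
                \<subseteq> angle_cone ip (SV_minus ip A B U l0 SL) (SV_plus ip A B U l0 SL) h)"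
proof -
  interpret lyapunov_scalar_product A ip
    by (rule lyapunov_scalar_product.intro[OF assms(4,5)])
  \<comment> \<open>The rates are fixed before the constants: the growth bounds need strict
    separation from the exponents.\<close>
  obtain \<beta> \<gamma> where gap: "(\<forall>k\<in>lyapunov_exponents A. k < l0 \<longrightarrow> k < \<beta>) \<and> \<beta> < \<gamma> \<and> \<gamma> < l0 \<and> (0 < l0 \<longrightarrow> 0 < \<beta>)"
    using exponent_gap[of l0] by (elim exE)
  have "\<exists>K>0. \<forall>t\<ge>0. \<forall>x\<in>lsum A {..<l0}. norm (flow A t x) \<le> K * exp (\<beta> * t) * norm x"
    by (rule lsum_growth_forward) (use gap in simp)
  then obtain K1 where K1: "K1 > 0"
    "\<And>t x. t \<ge> 0 \<Longrightarrow> x \<in> lsum A {..<l0} \<Longrightarrow> norm (flow A t x) \<le> K1 * exp (\<beta> * t) * norm x"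
    by blast
  have "\<exists>K>0. \<forall>t\<ge>0. \<forall>x\<in>lsum A {l0}. norm (flow A (- t) x) \<le> K * exp (- \<gamma> * t) * norm x"
    by (rule lsum_growth_backward) (use gap in simp)
  then obtain K2 where K2: "K2 > 0"
    "\<And>t x. t \<ge> 0 \<Longrightarrow> x \<in> lsum A {l0} \<Longrightarrow> norm (flow A (- t) x) \<le> K2 * exp (- \<gamma> * t) * norm x"
    by blast
  have "\<beta> < \<gamma>" "0 < l0 \<Longrightarrow> 0 < \<beta>" using gap by simp_all
  then interpret stable_setting A ip B U l0 SL \<beta> \<gamma> K1 K2
    by unfold_locales (assumption | rule assms K1 K2)+
  show ?thesis
    unfolding E_def[symmetric]
  proof (rule exI[of _ \<delta>], rule conjI[OF \<delta>_pos], rule exI[of _ S], intro conjI allI impI)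
    show "local_stable ip A B U SL E \<delta> S" by (rule S_local_stable)
    fix h :: real assume "h > 0"
    then have "W_loc ip E \<delta> S \<subseteq> angle_cone ip E (SV_plus ip A B U l0 SL) h"
      unfolding W_loc_eq by (rule W_subset_cone)
    then show "\<exists>\<delta>'>0. \<delta>' \<le> \<delta> \<and> local_stable ip A B U SL E \<delta>' S \<and>
        W_loc ip E \<delta>' S \<subseteq> angle_cone ip E (SV_plus ip A B U l0 SL) h"
      \<comment> \<open>The cone condition holds for every h at the radius already chosen, so the
        radius need not shrink with h.\<close>
      using \<delta>_pos S_local_stable by (intro exI[of _ \<delta>]) simp
  qed
qed

end
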